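(* Let $R$ be an indecomposable commutative ring. Let $(\Sigma_1,i_1,q_1)$ and $(\Sigma_2,i_2,q_2)$ be discrete $R$-twists over ample Hausdorff groupoids $G_1$ and $G_2$, respectively. Suppose that $G_1$ is effective. The following are equivalent. (1) The twists $(\Sigma_1,i_1,q_1)$ and $(\Sigma_2,i_2,q_2)$ are isomorphic. (2) There exists a diagonal-preserving isomorphism of $R$-algebras $\Psi\colon A_R(G_1;\Sigma_1)\to A_R(G_2;\Sigma_2)$. (3) There exists an isomorphism of $R$-algebras $\Psi\colon A_R(G_1;\Sigma_1)\to A_R(G_2;\Sigma_2)$ such that $\Psi\big(A_R(G_1^{(0)};q_1^{-1}(G_1^{(0)}))\big)\subseteq A_R(G_2^{(0)};q_2^{-1}(G_2^{(0)}))$.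
   Context: **Rings and groupoids.** A commutative ring $R$ with identity is indecomposable if $0\neq1$ and its only idempotents are $0$ and $1$. $R^\times$ is its group of units, with the discrete topology. Groupoids are locally compact topological groupoids with Hausdorff unit space $G^{(0)}$ and range/source maps $r,s$. A bisection is a subset $D$ contained in an open set $O$ such that $r|_O,s|_O$ are homeomorphisms onto open subsets of $G^{(0)}$. $G$ is étale if $r$ is a local homeomorphism, and ample if it is étale with a basis of compact open bisections. $G$ is effective if the topological interior of $\operatorname{Iso}(G)=\{\gamma\in G:r(\gamma)=s(\gamma)\}$ equals $G^{(0)}$. **Twists.** A discrete $R$-twist $(\Sigma,i,q)$ over an étale groupoid $G$ is a sequence $G^{(0)}\times R^\times\xrightarrow{i}\Sigma\xrightarrow{q}G$, where $G^{(0)}\times R^\times$ is the trivial group bundle, $\Sigma$ is a topological groupoid with $\Sigma^{(0)}=i(G^{(0)}\times\{1\})$ (identified with $G^{(0)}$), and $i,q$ are continuous groupoid homomorphisms restricting to homeomorphisms of unit spaces, such that: (DT1) $i(\{x\}\times R^\times)=q^{-1}(x)$ for $x\in G^{(0)}$, $i$ injective, $q$ surjective; (DT2) each $\alpha\in G$ has an open bisection $B_\alpha\ni\alpha$ and a continuous $P_\alpha\colon B_\alpha\to\Sigma$ with $q\circ P_\alpha=\mathrm{id}$ and $(\beta,t)\mapsto i(r(\beta),t)P_\alpha(\beta)$ a homeomorphism $B_\alpha\times R^\times\to q^{-1}(B_\alpha)$; (DT3) $i(r(\sigma),t)\sigma=\sigma i(s(\sigma),t)$. Write $t\cdot\sigma=i(r(\sigma),t)\sigma$.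 Two twists $(\Sigma_1,i_1,q_1)$ over $G_1$ and $(\Sigma_2,i_2,q_2)$ over $G_2$ are isomorphic if there are isomorphisms of topological groupoids $\psi\colon\Sigma_1\to\Sigma_2$ and $\psi_G\colon G_1\to G_2$ with $\psi\circ i_1=i_2\circ(\psi_G|_{G_1^{(0)}}\times\mathrm{id})$ and $q_2\circ\psi=\psi_G\circ q_1$. **Twisted Steinberg algebra.** $\operatorname{supp}(f)=\{f\neq0\}$, $\operatorname{supp}_G(f)=q(\operatorname{supp}(f))$. For $G$ ample Hausdorff, $A_R(G;\Sigma)$ is the set of locally constant $f\colon\Sigma\to R$ with $f(t\cdot\sigma)=t^{-1}f(\sigma)$ for $t\in R^\times$ and $q(\operatorname{supp}(f))$ compact; it is an $R$-algebra under pointwise operations and $(f*g)(\sigma)=\sum_{\alpha\in r^{-1}(r(\sigma))\cap\operatorname{supp}_G(f)}f(S(\alpha))g(S(\alpha)^{-1}\sigma)$, with $S\colon\operatorname{supp}_G(f)\to\operatorname{supp}(f)$ any section for $q$. $A_R(G^{(0)};q^{-1}(G^{(0)}))$ is the commutative subalgebra of those $f$ supported in $q^{-1}(G^{(0)})$ (the diagonal subalgebra). An isomorphism $\Psi\colon A_R(G_1;\Sigma_1)\to A_R(G_2;\Sigma_2)$ is diagonal-preserving if $\Psi\big(A_R(G_1^{(0)};q_1^{-1}(G_1^{(0)}))\big)=A_R(G_2^{(0)};q_2^{-1}(G_2^{(0)}))$. *)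

theory Defs
  imports "HOL-Analysis.Analysis"
begin

section \<open>Rings\<close>

text \<open>The requirement that 0 and 1 are distinct is already part of the class \<^class>\<open>comm_ring_1\<close>.\<close>

definition indecomposable_ring :: "'r::comm_ring_1 itself \<Rightarrow> bool" where
  "indecomposable_ring _ \<longleftrightarrow> (0::'r) \<noteq> 1 \<and> (\<forall>e::'r. e * e = e \<longrightarrow> e = 0 \<or> e = 1)"

definition ring_units :: "'r::comm_ring_1 set" where
  "ring_units = {t. t dvd 1}"

definition unit_inverse :: "'r::comm_ring_1 \<Rightarrow> 'r" where
  "unit_inverse t = (THE u. t * u = 1)"


section \<open>Topological groupoids\<close>

text \<open>The arrows of a groupoid are the points of its topology. A product \<open>gmult G a b\<close> is meaningful
  when \<open>gsource G a = grange G b\<close>.\<close>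

record 'a grpd =
  gtop :: "'a topology"
  gunits :: "'a set"
  grange :: "'a \<Rightarrow> 'a"
  gsource :: "'a \<Rightarrow> 'a"
  gmult :: "'a \<Rightarrow> 'a \<Rightarrow> 'a"
  ginv :: "'a \<Rightarrow> 'a"

abbreviation garrows :: "'a grpd \<Rightarrow> 'a set" where
  "garrows G \<equiv> topspace (gtop G)"

abbreviation unit_space :: "'a grpd \<Rightarrow> 'a topology" where
  "unit_space G \<equiv> subtopology (gtop G) (gunits G)"

definition composable :: "'a grpd \<Rightarrow> ('a \<times> 'a) set" where
  "composable G = {(a, b). a \<in> garrows G \<and> b \<in> garrows G \<and> gsource G a = grange G b}"

locale groupoid =
  fixes G :: "'a grpd"
  assumes units_arrows: "gunits G \<subseteq> garrows G"
    and range_closed: "a \<in> garrows G \<Longrightarrow> grange G a \<in> gunits G"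
    and source_closed: "a \<in> garrows G \<Longrightarrow> gsource G a \<in> gunits G"
    and range_unit: "x \<in> gunits G \<Longrightarrow> grange G x = x"
    and source_unit: "x \<in> gunits G \<Longrightarrow> gsource G x = x"
    and mult_closed: "(a, b) \<in> composable G \<Longrightarrow> gmult G a b \<in> garrows G"
    and range_mult: "(a, b) \<in> composable G \<Longrightarrow> grange G (gmult G a b) = grange G a"
    and source_mult: "(a, b) \<in> composable G \<Longrightarrow> gsource G (gmult G a b) = gsource G b"
    and mult_assoc: "(a, b) \<in> composable G \<Longrightarrow> (b, c) \<in> composable G \<Longrightarrow>
          gmult G (gmult G a b) c = gmult G a (gmult G b c)"
    and range_mult_left: "a \<in> garrows G \<Longrightarrow> gmult G (grange G a) a = a"
    and source_mult_right: "a \<in> garrows G \<Longrightarrow> gmult G a (gsource G a) = a"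
    and inv_closed: "a \<in> garrows G \<Longrightarrow> ginv G a \<in> garrows G"
    and range_inv: "a \<in> garrows G \<Longrightarrow> grange G (ginv G a) = gsource G a"
    and source_inv: "a \<in> garrows G \<Longrightarrow> gsource G (ginv G a) = grange G a"
    and mult_inv_right: "a \<in> garrows G \<Longrightarrow> gmult G a (ginv G a) = grange G a"
    and mult_inv_left: "a \<in> garrows G \<Longrightarrow> gmult G (ginv G a) a = gsource G a"

text \<open>Following the standing convention, topological groupoids are locally compact and have a
  Hausdorff unit space. Continuity of range and source follows from the axioms below.\<close>

locale topological_groupoid = groupoid +
  assumes continuous_mult:
      "continuous_map (subtopology (prod_topology (gtop G) (gtop G)) (composable G)) (gtop G)
         (\<lambda>(a, b). gmult G a b)"
    and continuous_inv: "continuous_map (gtop G) (gtop G) (ginv G)"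
    and locally_compact: "locally_compact_space (gtop G)"
    and Hausdorff_units: "Hausdorff_space (unit_space G)"

definition groupoid_hom :: "'a grpd \<Rightarrow> 'b grpd \<Rightarrow> ('a \<Rightarrow> 'b) \<Rightarrow> bool" where
  "groupoid_hom G H f \<longleftrightarrow>
     f ` garrows G \<subseteq> garrows H \<and>
     (\<forall>(a, b) \<in> composable G. (f a, f b) \<in> composable H \<and> f (gmult G a b) = gmult H (f a) (f b))"

definition topological_groupoid_iso :: "'a grpd \<Rightarrow> 'b grpd \<Rightarrow> ('a \<Rightarrow> 'b) \<Rightarrow> bool" where
  "topological_groupoid_iso G H f \<longleftrightarrow> groupoid_hom G H f \<and> homeomorphic_map (gtop G) (gtop H) f"

definition homeo_onto_open :: "'a topology \<Rightarrow> 'b topology \<Rightarrow> 'a set \<Rightarrow> ('a \<Rightarrow> 'b) \<Rightarrow> bool" where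
  "homeo_onto_open X Y U f \<longleftrightarrow>
     openin Y (f ` U) \<and> homeomorphic_map (subtopology X U) (subtopology Y (f ` U)) f"

definition local_homeomorphism :: "'a topology \<Rightarrow> 'b topology \<Rightarrow> ('a \<Rightarrow> 'b) \<Rightarrow> bool" where
  "local_homeomorphism X Y f \<longleftrightarrow>
     (\<forall>x \<in> topspace X. \<exists>U. openin X U \<and> x \<in> U \<and> homeo_onto_open X Y U f)"

definition bisection :: "'a grpd \<Rightarrow> 'a set \<Rightarrow> bool" where
  "bisection G D \<longleftrightarrow>
     (\<exists>U. openin (gtop G) U \<and> D \<subseteq> U \<and>
        homeo_onto_open (gtop G) (unit_space G) U (grange G) \<and>
        homeo_onto_open (gtop G) (unit_space G) U (gsource G))"

definition etale_groupoid :: "'a grpd \<Rightarrow> bool" where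
  "etale_groupoid G \<longleftrightarrow>
     topological_groupoid G \<and> local_homeomorphism (gtop G) (unit_space G) (grange G)"

definition ample_groupoid :: "'a grpd \<Rightarrow> bool" where
  "ample_groupoid G \<longleftrightarrow> etale_groupoid G \<and>
     (\<forall>U a. openin (gtop G) U \<and> a \<in> U \<longrightarrow>
        (\<exists>B. openin (gtop G) B \<and> compactin (gtop G) B \<and> bisection G B \<and> a \<in> B \<and> B \<subseteq> U))"

definition isotropy :: "'a grpd \<Rightarrow> 'a set" where
  "isotropy G = {a \<in> garrows G. grange G a = gsource G a}"

definition effective_groupoid :: "'a grpd \<Rightarrow> bool" where
  "effective_groupoid G \<longleftrightarrow> gtop G interior_of isotropy G = gunits G"


section \<open>Discrete twists\<close>

definition unit_bundle :: "'g grpd \<Rightarrow> ('g \<times> 'r::comm_ring_1) grpd" where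
  "unit_bundle G =
     \<lparr> gtop = prod_topology (unit_space G) (discrete_topology ring_units),
       gunits = gunits G \<times> {1},
       grange = (\<lambda>(x, t). (x, 1)),
       gsource = (\<lambda>(x, t). (x, 1)),
       gmult = (\<lambda>(x, t) (y, u). (x, t * u)),
       ginv = (\<lambda>(x, t). (x, unit_inverse t)) \<rparr>"

text \<open>The unit space of the twist is identified with that of \<open>G\<close> by means of \<open>q\<close>, so the range
  (source) of an arrow \<open>\<sigma>\<close> of the twist, seen as a unit of \<open>G\<close>, is the range (source) of \<open>q \<sigma>\<close>.\<close>

locale discrete_twist =
  fixes G :: "'g grpd"
    and \<Sigma> :: "'s grpd"
    and i :: "'g \<times> 'r::comm_ring_1 \<Rightarrow> 's"
    and q :: "'s \<Rightarrow> 'g"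
  assumes etale: "etale_groupoid G"
    and twist_groupoid: "topological_groupoid \<Sigma>"
    and twist_units: "gunits \<Sigma> = i ` (gunits G \<times> {1})"
    and i_hom: "groupoid_hom (unit_bundle G) \<Sigma> i"
    and i_continuous: "continuous_map (gtop (unit_bundle G)) (gtop \<Sigma>) i"
    and i_units: "homeomorphic_map (unit_space (unit_bundle G :: ('g \<times> 'r) grpd)) (unit_space \<Sigma>) i"
    and q_hom: "groupoid_hom \<Sigma> G q"
    and q_continuous: "continuous_map (gtop \<Sigma>) (gtop G) q"
    and q_units: "homeomorphic_map (unit_space \<Sigma>) (unit_space G) q"
    and exact: "x \<in> gunits G \<Longrightarrow> i ` ({x} \<times> ring_units) = {\<sigma> \<in> garrows \<Sigma>. q \<sigma> = x}"
    and i_inj: "inj_on i (gunits G \<times> ring_units)"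
    and q_surj: "q ` garrows \<Sigma> = garrows G"
    and locally_trivial: "a \<in> garrows G \<Longrightarrow>
          \<exists>B P. openin (gtop G) B \<and> bisection G B \<and> a \<in> B \<and>
            continuous_map (subtopology (gtop G) B) (gtop \<Sigma>) P \<and>
            (\<forall>b \<in> B. q (P b) = b) \<and>
            homeomorphic_map
              (prod_topology (subtopology (gtop G) B) (discrete_topology (ring_units :: 'r set)))
              (subtopology (gtop \<Sigma>) {\<sigma> \<in> garrows \<Sigma>. q \<sigma> \<in> B})
              (\<lambda>(b, t). gmult \<Sigma> (i (grange G b, t)) (P b))"
    and central: "\<sigma> \<in> garrows \<Sigma> \<Longrightarrow> t \<in> ring_units \<Longrightarrow>
          gmult \<Sigma> (i (grange G (q \<sigma>), t)) \<sigma> = gmult \<Sigma> \<sigma> (i (gsource G (q \<sigma>), t))"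

definition twist_action ::
  "'g grpd \<Rightarrow> 's grpd \<Rightarrow> ('g \<times> 'r::comm_ring_1 \<Rightarrow> 's) \<Rightarrow> ('s \<Rightarrow> 'g) \<Rightarrow> 'r \<Rightarrow> 's \<Rightarrow> 's" where
  "twist_action G \<Sigma> i q t \<sigma> = gmult \<Sigma> (i (grange G (q \<sigma>), t)) \<sigma>"

definition twists_isomorphic ::
  "'g grpd \<Rightarrow> 's grpd \<Rightarrow> ('g \<times> 'r::comm_ring_1 \<Rightarrow> 's) \<Rightarrow> ('s \<Rightarrow> 'g) \<Rightarrow>
   'h grpd \<Rightarrow> 'u grpd \<Rightarrow> ('h \<times> 'r \<Rightarrow> 'u) \<Rightarrow> ('u \<Rightarrow> 'h) \<Rightarrow> bool" where
  "twists_isomorphic G1 \<Sigma>1 i1 q1 G2 \<Sigma>2 i2 q2 \<longleftrightarrow>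
     (\<exists>\<psi> \<psi>G. topological_groupoid_iso \<Sigma>1 \<Sigma>2 \<psi> \<and> topological_groupoid_iso G1 G2 \<psi>G \<and>
        (\<forall>x \<in> gunits G1. \<forall>t \<in> ring_units. \<psi> (i1 (x, t)) = i2 (\<psi>G x, t)) \<and>
        (\<forall>\<sigma> \<in> garrows \<Sigma>1. q2 (\<psi> \<sigma>) = \<psi>G (q1 \<sigma>)))"


section \<open>Twisted Steinberg algebras\<close>

definition supp :: "('s \<Rightarrow> 'r::zero) \<Rightarrow> 's set" where
  "supp f = {\<sigma>. f \<sigma> \<noteq> 0}"

text \<open>Functions on the arrows of \<open>\<Sigma>\<close> are represented by functions on the underlying type that vanish
  outside the arrows.\<close>

definition steinberg_algebra ::
  "'g grpd \<Rightarrow> 's grpd \<Rightarrow> ('g \<times> 'r::comm_ring_1 \<Rightarrow> 's) \<Rightarrow> ('s \<Rightarrow> 'g) \<Rightarrow> ('s \<Rightarrow> 'r) set" where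
  "steinberg_algebra G \<Sigma> i q =
     {f. (\<forall>\<sigma>. \<sigma> \<notin> garrows \<Sigma> \<longrightarrow> f \<sigma> = 0) \<and>
         (\<forall>\<sigma> \<in> garrows \<Sigma>. \<exists>U. openin (gtop \<Sigma>) U \<and> \<sigma> \<in> U \<and> f constant_on U) \<and>
         (\<forall>t \<in> ring_units. \<forall>\<sigma> \<in> garrows \<Sigma>.
            f (twist_action G \<Sigma> i q t \<sigma>) = unit_inverse t * f \<sigma>) \<and>
         compactin (gtop G) (q ` supp f)}"

text \<open>The section \<open>S\<close> of \<open>q\<close> over the support is \<open>inv_into (supp f) q\<close>; by
  \<open>steinberg_conv_section\<close> below every other section gives the same product.\<close>

definition steinberg_conv ::
  "'g grpd \<Rightarrow> 's grpd \<Rightarrow> ('s \<Rightarrow> 'g) \<Rightarrow> ('s \<Rightarrow> 'r::comm_ring_1) \<Rightarrow> ('s \<Rightarrow> 'r) \<Rightarrow> 's \<Rightarrow> 'r" where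
  "steinberg_conv G \<Sigma> q f g \<sigma> =
     (if \<sigma> \<in> garrows \<Sigma> then
        (\<Sum>\<alpha> \<in> {\<alpha> \<in> q ` supp f. grange G \<alpha> = grange G (q \<sigma>)}.
           f (inv_into (supp f) q \<alpha>) * g (gmult \<Sigma> (ginv \<Sigma> (inv_into (supp f) q \<alpha>)) \<sigma>))
      else 0)"

lemma (in discrete_twist) q_range_source:
  assumes "a \<in> garrows \<Sigma>"
  shows "q (grange \<Sigma> a) = grange G (q a)" "q (gsource \<Sigma> a) = gsource G (q a)"
proof -
  interpret S: topological_groupoid \<Sigma> by (rule twist_groupoid)
  interpret G: topological_groupoid G using etale by (simp add: etale_groupoid_def)
  have sub: "gunits \<Sigma> \<subseteq> garrows \<Sigma>" "gunits G \<subseteq> garrows G"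
    using S.units_arrows G.units_arrows by auto
  have qu: "q u \<in> gunits G" if "u \<in> gunits \<Sigma>" for u
    using homeomorphic_imp_surjective_map [OF q_units] that sub by auto
  have comp: "(grange \<Sigma> a, a) \<in> composable \<Sigma>" "(a, gsource \<Sigma> a) \<in> composable \<Sigma>"
    using assms sub S.range_closed S.source_closed S.range_unit S.source_unit
    by (auto simp: composable_def)
  have "(q (grange \<Sigma> a), q a) \<in> composable G" "(q a, q (gsource \<Sigma> a)) \<in> composable G"
    using comp q_hom unfolding groupoid_hom_def by auto
  then have "gsource G (q (grange \<Sigma> a)) = grange G (q a)"
    "gsource G (q a) = grange G (q (gsource \<Sigma> a))"
    by (auto simp: composable_def)
  then show "q (grange \<Sigma> a) = grange G (q a)" "q (gsource \<Sigma> a) = gsource G (q a)"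
    using G.source_unit G.range_unit qu S.range_closed S.source_closed assms by auto
qed

lemma (in discrete_twist) q_inj_units: "inj_on q (gunits \<Sigma>)"
proof -
  interpret S: topological_groupoid \<Sigma> by (rule twist_groupoid)
  show ?thesis
    using homeomorphic_imp_injective_map [OF q_units] S.units_arrows
    by (simp add: Int_absorb1)
qed

lemma unit_inverse_eq:
  assumes "t * u = (1 :: 'r::comm_ring_1)"
  shows "unit_inverse t = u"
  unfolding unit_inverse_def
proof (rule the_equality)
  fix v assume "t * v = 1"
  then show "v = u"
    using assms by (metis mult.assoc mult.commute mult.right_neutral)
qed (fact assms)

lemma (in discrete_twist) steinberg_conv_section:
  assumes f: "f \<in> steinberg_algebra G \<Sigma> i q" and g: "g \<in> steinberg_algebra G \<Sigma> i q"
    and \<sigma>: "\<sigma> \<in> garrows \<Sigma>"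
    and sect: "\<And>\<alpha>. \<alpha> \<in> q ` supp f \<Longrightarrow> S \<alpha> \<in> supp f \<and> q (S \<alpha>) = \<alpha>"
  shows "steinberg_conv G \<Sigma> q f g \<sigma> =
    (\<Sum>\<alpha> \<in> {\<alpha> \<in> q ` supp f. grange G \<alpha> = grange G (q \<sigma>)}.
       f (S \<alpha>) * g (gmult \<Sigma> (ginv \<Sigma> (S \<alpha>)) \<sigma>))"
proof -
  interpret S: topological_groupoid \<Sigma> by (rule twist_groupoid)
  interpret G: topological_groupoid G using etale by (simp add: etale_groupoid_def)
  have eq: "f a * g (gmult \<Sigma> (ginv \<Sigma> a) \<sigma>) = f b * g (gmult \<Sigma> (ginv \<Sigma> b) \<sigma>)"
    if a: "a \<in> garrows \<Sigma>" and b: "b \<in> garrows \<Sigma>" and ab: "q a = q b"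
      and r: "grange G (q a) = grange G (q \<sigma>)" for a b
  proof -
    define x where "x = grange G (q a)"
    have x: "x \<in> gunits G"
      using a q_surj G.range_closed unfolding x_def by blast
    have rs: "grange \<Sigma> a = grange \<Sigma> b" "gsource \<Sigma> a = gsource \<Sigma> b"
      "grange \<Sigma> a = grange \<Sigma> \<sigma>"
      using q_inj_units q_range_source a b \<sigma> ab r S.range_closed S.source_closed
      by (metis inj_onD)+
    have ia: "ginv \<Sigma> a \<in> garrows \<Sigma>" and ib: "ginv \<Sigma> b \<in> garrows \<Sigma>"
      using a b S.inv_closed by auto
    have c1: "(b, ginv \<Sigma> a) \<in> composable \<Sigma>" "(ginv \<Sigma> a, a) \<in> composable \<Sigma>"
      "(ginv \<Sigma> b, b) \<in> composable \<Sigma>" "(ginv \<Sigma> b, \<sigma>) \<in> composable \<Sigma>"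
      using a b ia ib rs \<sigma> by (auto simp: composable_def S.range_inv S.source_inv)
    define d where "d = gmult \<Sigma> b (ginv \<Sigma> a)"
    have d: "d \<in> garrows \<Sigma>" using c1 S.mult_closed d_def by auto
    have hom: "q (gmult \<Sigma> c e) = gmult G (q c) (q e)" "(q c, q e) \<in> composable G"
      if "(c, e) \<in> composable \<Sigma>" for c e
      using that q_hom unfolding groupoid_hom_def by auto
    have dsrc: "grange \<Sigma> d = grange \<Sigma> b" "gsource \<Sigma> d = gsource \<Sigma> (ginv \<Sigma> a)"
      unfolding d_def using c1 S.range_mult S.source_mult by auto
    have "q d = gmult G (q a) (q (ginv \<Sigma> a))" using hom c1 ab d_def by auto
    also have "\<dots> = q (gmult \<Sigma> a (ginv \<Sigma> a))"
      using hom a ia by (auto simp: composable_def S.range_inv)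
    also have "\<dots> = x" unfolding x_def using a q_range_source S.mult_inv_right by auto
    finally have "q d = x" .
    then obtain t where t: "t \<in> ring_units" "d = i (x, t)"
      using exact [OF x] d by blast
    then obtain u where tu: "t * u = 1" unfolding ring_units_def by (metis dvdE mem_Collect_eq)
    have inv_t: "unit_inverse t = u" using tu by (rule unit_inverse_eq)
    have da: "gmult \<Sigma> d a = b"
      using S.mult_assoc [OF c1(1,2)] a b rs d_def S.mult_inv_left S.source_mult_right by simp
    have "f (twist_action G \<Sigma> i q t a) = u * f a"
      using f t(1) a inv_t unfolding steinberg_algebra_def by auto
    then have fb: "f b = u * f a"
      using da t by (simp add: twist_action_def x_def)
    have qib: "gsource G (q (ginv \<Sigma> b)) = x"
      using q_range_source [OF ib] q_range_source [OF b] b ab by (simp add: S.source_inv x_def)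
    define k where "k = i (grange G (q (ginv \<Sigma> b)), t)"
    have y: "grange G (q (ginv \<Sigma> b)) \<in> gunits G"
      using ib q_surj G.range_closed by blast
    have k: "k \<in> garrows \<Sigma>" "q k = grange G (q (ginv \<Sigma> b))"
      using exact [OF y] t(1) unfolding k_def by blast+
    have ksrc: "gsource \<Sigma> k = grange \<Sigma> (ginv \<Sigma> b)"
      using q_inj_units q_range_source k ib y S.range_closed S.source_closed G.source_unit
      by (metis inj_onD)
    have ck: "(k, ginv \<Sigma> b) \<in> composable \<Sigma>"
      using k ib ksrc by (simp add: composable_def)
    have "gmult \<Sigma> k (ginv \<Sigma> b) = gmult \<Sigma> (ginv \<Sigma> b) d"
      using central [OF ib t(1)] t(2) qib k_def by simp
    also have "\<dots> = gmult \<Sigma> (gmult \<Sigma> (ginv \<Sigma> b) b) (ginv \<Sigma> a)"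
      using S.mult_assoc c1 d_def by simp
    also have "\<dots> = ginv \<Sigma> a"
      using b a ia rs S.mult_inv_left S.range_mult_left S.range_inv by metis
    finally have kb: "gmult \<Sigma> k (ginv \<Sigma> b) = ginv \<Sigma> a" .
    define e where "e = gmult \<Sigma> (ginv \<Sigma> b) \<sigma>"
    have e: "e \<in> garrows \<Sigma>" "grange \<Sigma> e = grange \<Sigma> (ginv \<Sigma> b)"
      using S.mult_closed c1 S.range_mult e_def by auto
    have "twist_action G \<Sigma> i q t e = gmult \<Sigma> k e"
      using q_range_source [OF e(1)] q_range_source [OF ib] e(2)
      by (simp add: twist_action_def k_def)
    also have "\<dots> = gmult \<Sigma> (ginv \<Sigma> a) \<sigma>"
      using S.mult_assoc [OF ck c1(4)] kb e_def by simp
    finally have te: "twist_action G \<Sigma> i q t e = gmult \<Sigma> (ginv \<Sigma> a) \<sigma>" .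
    have "g (twist_action G \<Sigma> i q t e) = u * g e"
      using g t(1) e(1) inv_t unfolding steinberg_algebra_def by auto
    then have "g (gmult \<Sigma> (ginv \<Sigma> a) \<sigma>) = u * g e"
      using te by simp
    then show ?thesis using fb e_def by (simp add: algebra_simps)
  qed
  have arr: "supp f \<subseteq> garrows \<Sigma>"
    using f by (auto simp: steinberg_algebra_def supp_def)
  show ?thesis
    unfolding steinberg_conv_def using \<sigma>
  proof (simp, intro sum.cong refl)
    fix \<alpha> assume \<alpha>: "\<alpha> \<in> {\<alpha> \<in> q ` supp f. grange G \<alpha> = grange G (q \<sigma>)}"
    then have "inv_into (supp f) q \<alpha> \<in> supp f" "q (inv_into (supp f) q \<alpha>) = \<alpha>"
      by (auto intro: inv_into_into f_inv_into_f)
    then show "f (inv_into (supp f) q \<alpha>) * g (gmult \<Sigma> (ginv \<Sigma> (inv_into (supp f) q \<alpha>)) \<sigma>) =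
        f (S \<alpha>) * g (gmult \<Sigma> (ginv \<Sigma> (S \<alpha>)) \<sigma>)"
      using \<alpha> sect arr by (intro eq) auto
  qed
qed

definition diagonal_subalgebra ::
  "'g grpd \<Rightarrow> 's grpd \<Rightarrow> ('g \<times> 'r::comm_ring_1 \<Rightarrow> 's) \<Rightarrow> ('s \<Rightarrow> 'g) \<Rightarrow> ('s \<Rightarrow> 'r) set" where
  "diagonal_subalgebra G \<Sigma> i q =
     {f \<in> steinberg_algebra G \<Sigma> i q. supp f \<subseteq> {\<sigma> \<in> garrows \<Sigma>. q \<sigma> \<in> gunits G}}"

text \<open>The algebras need not be unital, so an isomorphism of algebras is a bijection that preserves
  sums, scalar multiples and products.\<close>

definition steinberg_algebra_iso ::
  "'g grpd \<Rightarrow> 's grpd \<Rightarrow> ('g \<times> 'r::comm_ring_1 \<Rightarrow> 's) \<Rightarrow> ('s \<Rightarrow> 'g) \<Rightarrow>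
   'h grpd \<Rightarrow> 'u grpd \<Rightarrow> ('h \<times> 'r \<Rightarrow> 'u) \<Rightarrow> ('u \<Rightarrow> 'h) \<Rightarrow> (('s \<Rightarrow> 'r) \<Rightarrow> ('u \<Rightarrow> 'r)) \<Rightarrow> bool" where
  "steinberg_algebra_iso G1 \<Sigma>1 i1 q1 G2 \<Sigma>2 i2 q2 \<Psi> \<longleftrightarrow>
     bij_betw \<Psi> (steinberg_algebra G1 \<Sigma>1 i1 q1) (steinberg_algebra G2 \<Sigma>2 i2 q2) \<and>
     (\<forall>f \<in> steinberg_algebra G1 \<Sigma>1 i1 q1. \<forall>g \<in> steinberg_algebra G1 \<Sigma>1 i1 q1.
        \<Psi> (\<lambda>\<sigma>. f \<sigma> + g \<sigma>) = (\<lambda>\<tau>. \<Psi> f \<tau> + \<Psi> g \<tau>) \<and>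
        \<Psi> (steinberg_conv G1 \<Sigma>1 q1 f g) = steinberg_conv G2 \<Sigma>2 q2 (\<Psi> f) (\<Psi> g)) \<and>
     (\<forall>c. \<forall>f \<in> steinberg_algebra G1 \<Sigma>1 i1 q1. \<Psi> (\<lambda>\<sigma>. c * f \<sigma>) = (\<lambda>\<tau>. c * \<Psi> f \<tau>))"

definition diagonal_preserving ::
  "'g grpd \<Rightarrow> 's grpd \<Rightarrow> ('g \<times> 'r::comm_ring_1 \<Rightarrow> 's) \<Rightarrow> ('s \<Rightarrow> 'g) \<Rightarrow>
   'h grpd \<Rightarrow> 'u grpd \<Rightarrow> ('h \<times> 'r \<Rightarrow> 'u) \<Rightarrow> ('u \<Rightarrow> 'h) \<Rightarrow> (('s \<Rightarrow> 'r) \<Rightarrow> ('u \<Rightarrow> 'r)) \<Rightarrow> bool" where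
  "diagonal_preserving G1 \<Sigma>1 i1 q1 G2 \<Sigma>2 i2 q2 \<Psi> \<longleftrightarrow>
     \<Psi> ` diagonal_subalgebra G1 \<Sigma>1 i1 q1 = diagonal_subalgebra G2 \<Sigma>2 i2 q2"

end

theory Submission
  imports Defs
begin

text \<open>Functions transport along an isomorphism of twists, and transport preserves products and
  diagonals; this is the easy implication, carried by \<open>twist_iso\<close>.  For the others, the twist has to
  be read off from the algebra \<open>A\<close> and its diagonal \<open>D\<close>.

  Effectiveness of \<open>G\<close> means that \<open>D\<close> is a maximal commutative subalgebra of \<open>A\<close>: a function that
  commutes with \<open>D\<close> lives on the interior of the isotropy, and conversely every compact open
  bisection inside the isotropy carries a function that commutes with \<open>D\<close>
  (\<open>diag_maximal_commutative\<close>, \<open>effectiveI\<close>).  So if \<open>\<Psi>\<close> maps \<open>D\<^sub>1\<close> into the commutative algebra \<open>D\<^sub>2\<close>,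
  the preimage of \<open>D\<^sub>2\<close> commutes with \<open>D\<^sub>1\<close> and is therefore \<open>D\<^sub>1\<close>; moreover \<open>D\<^sub>2\<close> is then maximal
  commutative and \<open>G\<^sub>2\<close> is effective as well.

  The bridge between algebra and arrows are the bisection functions: the elements of \<open>A\<close> whose
  support projects to a bisection and whose values on the support are units.  Such an \<open>n\<close> can
  exchange each idempotent of \<open>D\<close> on its left for one on its right and vice versa.  Since \<open>R\<close> is
  indecomposable, idempotents of \<open>D\<close> take only the values 0 and 1 on units, so the exchange property
  of a function says that range and source determine each other on its support; in an effective
  groupoid this makes both injective.  Unit values are recognised locally, because near an arrow any
  function is a scalar multiple of the characteristic function of a sheet of the covering \<open>q\<close>.  Hence
  \<open>\<Psi>\<close> preserves bisection functions (\<open>\<Psi>_bisection_function\<close>).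

  An arrow \<open>\<sigma>\<close> of \<open>\<Sigma>\<^sub>1\<close> is determined by the bisection functions \<open>n\<close> with \<open>n \<sigma> = 1\<close>.  Their images
  form a downward directed family of nonempty compact sets \<open>{\<Psi> n = 1}\<close>, which have a common point
  \<open>\<tau>\<close> (\<open>exists_limit_arrow\<close>); applying the same to the inverse of \<open>\<Psi>\<close> shows that \<open>\<sigma>\<close> and \<open>\<tau>\<close> determine
  each other.  The sets \<open>{n = 1}\<close> form a basis of the topology, so \<open>\<sigma> \<mapsto> \<tau>\<close> is a homeomorphism.  It
  is equivariant because units of \<open>R\<close> scale bisection functions, and multiplicative because
  \<open>{n * m = 1}\<close> is the product of \<open>{n = 1}\<close> and \<open>{m = 1}\<close>.\<close>

section \<open>Topological groupoids\<close>

context groupoid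
begin

lemma range_arrow: "a \<in> garrows G \<Longrightarrow> grange G a \<in> garrows G"
  and source_arrow: "a \<in> garrows G \<Longrightarrow> gsource G a \<in> garrows G"
  using range_closed source_closed units_arrows by auto

lemma composable_iff:
  "(a, b) \<in> composable G \<longleftrightarrow> a \<in> garrows G \<and> b \<in> garrows G \<and> gsource G a = grange G b"
  by (simp add: composable_def)

lemma inv_mult_cancel:
  assumes "a \<in> garrows G" "b \<in> garrows G" "gsource G a = grange G b"
  shows "gmult G (ginv G a) (gmult G a b) = b"
  using mult_assoc[of "ginv G a" a b] assms
  by (simp add: composable_iff inv_closed source_inv mult_inv_left range_mult_left)

lemma mult_inv_cancel:
  assumes "a \<in> garrows G" "b \<in> garrows G" "grange G a = grange G b"
  shows "gmult G a (gmult G (ginv G a) b) = b"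
  using mult_assoc[of a "ginv G a" b] assms
  by (simp add: composable_iff inv_closed source_inv range_inv mult_inv_right range_mult_left)

lemma mult_inv_cancel_right:
  assumes "a \<in> garrows G" "b \<in> garrows G" "gsource G a = grange G b"
  shows "gmult G (gmult G a b) (ginv G b) = a"
  using mult_assoc[of a b "ginv G b"] assms
  by (metis composable_iff inv_closed mult_inv_right range_inv source_mult_right)

lemma inv_inv:
  assumes "a \<in> garrows G"
  shows "ginv G (ginv G a) = a"
  using inv_mult_cancel[of "ginv G a" a] assms
  by (metis inv_closed mult_inv_left source_inv source_mult_right range_inv)

lemma inv_unit: "x \<in> gunits G \<Longrightarrow> ginv G x = x"
  by (metis inv_closed mult_inv_right range_inv range_mult_left range_unit source_unit subsetD units_arrows)

text \<open>A unit of the form \<open>a b\<^bsup>-1\<^esup>\<close> can only be the range of \<open>b\<close>; this is how distinct arrows with a common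
  source yield a non-unit arrow of the isotropy.\<close>

lemma eq_if_mult_inv_unit:
  assumes "a \<in> garrows G" "b \<in> garrows G" "gsource G a = gsource G b"
    and "gmult G a (ginv G b) \<in> gunits G"
  shows "a = b"
proof -
  have c: "(a, ginv G b) \<in> composable G"
    using assms by (simp add: composable_iff inv_closed range_inv)
  have "gmult G a (ginv G b) = grange G b"
    using source_unit[OF assms(4)] source_mult[OF c] source_inv[OF assms(2)] by simp
  then have "gmult G (gmult G a (ginv G b)) b = b"
    by (simp add: assms range_mult_left)
  moreover have "gmult G (gmult G a (ginv G b)) b = a"
    using mult_inv_cancel_right[of a "ginv G b"] assms by (simp add: inv_inv inv_closed range_inv)
  ultimately show ?thesis by simp
qed

end

context topological_groupoid
begin

lemma continuous_map_gmult:
  assumes "continuous_map X (gtop G) f" "continuous_map X (gtop G) g"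
    and "\<And>x. x \<in> topspace X \<Longrightarrow> gsource G (f x) = grange G (g x)"
  shows "continuous_map X (gtop G) (\<lambda>x. gmult G (f x) (g x))"
proof -
  have "f x \<in> garrows G" "g x \<in> garrows G" if "x \<in> topspace X" for x
    using assms(1,2) that by (auto simp: continuous_map_def)
  then have "continuous_map X (subtopology (prod_topology (gtop G) (gtop G)) (composable G))
      (\<lambda>x. (f x, g x))"
    using assms by (auto simp: continuous_map_in_subtopology continuous_map_pairedI composable_iff)
  from continuous_map_compose[OF this continuous_mult] show ?thesis
    by (simp add: o_def)
qed

lemma continuous_range: "continuous_map (gtop G) (unit_space G) (grange G)"
proof -
  have "continuous_map (gtop G) (gtop G) (\<lambda>a. gmult G a (ginv G a))"
    by (rule continuous_map_gmult) (auto simp: continuous_inv range_inv)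
  then have "continuous_map (gtop G) (gtop G) (grange G)"
    by (rule continuous_map_eq) (simp add: mult_inv_right)
  then show ?thesis
    by (auto simp: continuous_map_in_subtopology range_closed)
qed

lemma continuous_source: "continuous_map (gtop G) (unit_space G) (gsource G)"
proof -
  have "continuous_map (gtop G) (unit_space G) (\<lambda>a. grange G (ginv G a))"
    using continuous_map_compose[OF continuous_inv continuous_range] by (simp add: o_def)
  then show ?thesis
    by (rule continuous_map_eq) (simp add: range_inv)
qed

lemma topspace_unit_space: "topspace (unit_space G) = gunits G"
  using units_arrows by auto

lemma homeomorphic_inv: "homeomorphic_map (gtop G) (gtop G) (ginv G)"
  by (rule homeomorphic_maps_imp_map[of _ _ _ "ginv G"])
    (auto simp: homeomorphic_maps_def continuous_inv inv_inv)

lemma open_range_imp_open_source: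
  assumes "open_map (gtop G) (unit_space G) (grange G)"
  shows "open_map (gtop G) (unit_space G) (gsource G)"
proof -
  have "open_map (gtop G) (unit_space G) (grange G \<circ> ginv G)"
    using assms homeomorphic_inv by (auto intro: open_map_compose homeomorphic_imp_open_map)
  then show ?thesis
    by (rule open_map_eq) (simp add: range_inv)
qed

text \<open>Over an open set on which the range map is injective, left division by the arrow of the set
  with the same range is continuous.  This is what makes both products of open sets open and
  convolutions locally constant.\<close>

lemma continuous_left_division:
  assumes r: "open_map (gtop G) (unit_space G) (grange G)"
    and U: "openin (gtop G) U" and inj: "inj_on (grange G) U"
  shows "openin (gtop G) {c \<in> garrows G. grange G c \<in> grange G ` U}"
    and "continuous_map (subtopology (gtop G) {c \<in> garrows G. grange G c \<in> grange G ` U}) (gtop G)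
           (\<lambda>c. gmult G (ginv G (inv_into U (grange G) (grange G c))) c)"
proof -
  let ?V = "{c \<in> garrows G. grange G c \<in> grange G ` U}"
  let ?a = "\<lambda>c. inv_into U (grange G) (grange G c)"
  have sub: "U \<subseteq> garrows G" using U by (rule openin_subset)
  have pre: "openin (gtop G) {c \<in> garrows G. grange G c \<in> grange G ` W}" if "openin (gtop G) W" for W
    using r that openin_continuous_map_preimage[OF continuous_range] by (simp add: open_map_def)
  show V: "openin (gtop G) ?V" using pre[OF U] .
  have a: "?a c \<in> U" "grange G (?a c) = grange G c" if "c \<in> ?V" for c
    using that by (auto intro: inv_into_into f_inv_into_f)
  have acont: "continuous_map (subtopology (gtop G) ?V) (gtop G) ?a"
  proof (unfold continuous_map_def, intro conjI allI impI)
    show "?a \<in> topspace (subtopology (gtop G) ?V) \<rightarrow> garrows G"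
      using a sub by auto
    fix W assume W: "openin (gtop G) W"
    have "{c \<in> topspace (subtopology (gtop G) ?V). ?a c \<in> W} =
        {c \<in> garrows G. grange G c \<in> grange G ` (U \<inter> W)}" (is "?L = ?R")
    proof
      show "?L \<subseteq> ?R"
      proof
        fix c assume c: "c \<in> ?L"
        then have "c \<in> ?V" by simp
        then have "?a c \<in> U \<inter> W" "grange G c = grange G (?a c)" using a[of c] c by auto
        then have "grange G c \<in> grange G ` (U \<inter> W)" by (metis imageI)
        then show "c \<in> ?R" using c by simp
      qed
      show "?R \<subseteq> ?L" using inj by auto
    qed
    moreover have "openin (gtop G) {c \<in> garrows G. grange G c \<in> grange G ` (U \<inter> W)}"
      using pre U W by blast
    moreover have "{c \<in> garrows G. grange G c \<in> grange G ` (U \<inter> W)} \<subseteq> ?V" by auto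
    ultimately show "openin (subtopology (gtop G) ?V) {c \<in> topspace (subtopology (gtop G) ?V). ?a c \<in> W}"
      using openin_open_subtopology[OF V] by simp
  qed
  show "continuous_map (subtopology (gtop G) ?V) (gtop G) (\<lambda>c. gmult G (ginv G (?a c)) c)"
  proof (rule continuous_map_gmult)
    show "continuous_map (subtopology (gtop G) ?V) (gtop G) (\<lambda>c. ginv G (?a c))"
      using continuous_map_compose[OF acont continuous_inv] by (simp add: o_def)
    show "continuous_map (subtopology (gtop G) ?V) (gtop G) (\<lambda>c. c)"
      by (simp add: continuous_map_from_subtopology)
    show "gsource G (ginv G (?a c)) = grange G c" if "c \<in> topspace (subtopology (gtop G) ?V)" for c
    proof -
      have "c \<in> ?V" using that by simp
      then show ?thesis using a[of c] sub by (auto simp: source_inv)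
    qed
  qed
qed

end

text \<open>The composable pairs are closed because range and source map into the Hausdorff unit space.\<close>

lemma (in topological_groupoid) compact_mult:
  assumes "compactin (gtop G) C" "compactin (gtop G) D"
  shows "compactin (gtop G) {gmult G a b | a b. a \<in> C \<and> b \<in> D \<and> gsource G a = grange G b}"
proof -
  let ?X = "prod_topology (gtop G) (gtop G)"
  let ?E = "{z \<in> topspace ?X. gsource G (fst z) = grange G (snd z)}"
  have CD: "C \<subseteq> garrows G" "D \<subseteq> garrows G" using assms compactin_subset_topspace by auto
  have "continuous_map ?X (unit_space G) (gsource G \<circ> fst)"
    "continuous_map ?X (unit_space G) (grange G \<circ> snd)"
    using continuous_source continuous_range continuous_map_fst continuous_map_snd
    by (blast intro: continuous_map_compose)+
  then have "closedin ?X ?E"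
    using closedin_continuous_maps_eq[OF Hausdorff_units, of ?X "gsource G \<circ> fst" "grange G \<circ> snd"]
    by simp
  have "compactin ?X (C \<times> D)" using assms by (simp add: compactin_Times)
  then have "compactin ?X (?E \<inter> C \<times> D)"
    using \<open>closedin ?X ?E\<close> by (rule closed_Int_compactin[rotated])
  then have "compactin (subtopology ?X (composable G)) (?E \<inter> C \<times> D)"
    using CD by (auto simp: compactin_subtopology composable_iff)
  then have "compactin (gtop G) ((\<lambda>(a, b). gmult G a b) ` (?E \<inter> C \<times> D))"
    using continuous_mult by (rule image_compactin)
  moreover have "(\<lambda>(a, b). gmult G a b) ` (?E \<inter> C \<times> D) =
      {gmult G a b | a b. a \<in> C \<and> b \<in> D \<and> gsource G a = grange G b}"
    using CD by force
  ultimately show ?thesis by simp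
qed

lemma (in topological_groupoid) open_delete_unit: "openin (unit_space G) (gunits G - {x})"
proof -
  have "openin (unit_space G) (topspace (unit_space G) - {x})"
    using Hausdorff_imp_t1_space[OF Hausdorff_units] openin_topspace
    unfolding t1_space_openin_delete_alt by blast
  then show ?thesis by (simp only: topspace_unit_space)
qed

section \<open>Etale groupoids\<close>

lemma etale_groupoidD:
  assumes "etale_groupoid G"
  shows etale_topological: "topological_groupoid G"
    and etale_open_range: "open_map (gtop G) (unit_space G) (grange G)"
    and etale_range_locally_injective:
      "\<And>a. a \<in> garrows G \<Longrightarrow> \<exists>U. openin (gtop G) U \<and> a \<in> U \<and> inj_on (grange G) U"
    and etale_open_units: "openin (gtop G) (gunits G)"
proof -
  show "topological_groupoid G" using assms by (simp add: etale_groupoid_def)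
  then interpret topological_groupoid G .
  have loc: "\<exists>U. openin (gtop G) U \<and> a \<in> U \<and> homeo_onto_open (gtop G) (unit_space G) U (grange G)"
    if "a \<in> garrows G" for a
    using assms that by (auto simp: etale_groupoid_def local_homeomorphism_def)
  show inj: "\<exists>U. openin (gtop G) U \<and> a \<in> U \<and> inj_on (grange G) U" if a: "a \<in> garrows G" for a
  proof -
    obtain U where U: "openin (gtop G) U" "a \<in> U"
      "homeo_onto_open (gtop G) (unit_space G) U (grange G)" using loc a by blast
    have "inj_on (grange G) U"
      using U homeomorphic_imp_injective_map openin_subset[OF U(1)]
      by (fastforce simp: homeo_onto_open_def Int_absorb1)
    then show ?thesis using U by blast
  qed
  show "open_map (gtop G) (unit_space G) (grange G)"
    unfolding open_map_def
  proof (intro allI impI)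
    fix W assume W: "openin (gtop G) W"
    show "openin (unit_space G) (grange G ` W)"
    proof (subst openin_subopen, intro ballI)
      fix x assume "x \<in> grange G ` W"
      then obtain a where a: "a \<in> W" "x = grange G a" by auto
      obtain U where U: "openin (gtop G) U" "a \<in> U" "openin (unit_space G) (grange G ` U)"
        and h: "homeomorphic_map (subtopology (gtop G) U) (subtopology (unit_space G) (grange G ` U)) (grange G)"
        using loc a W openin_subset unfolding homeo_onto_open_def by (meson subsetD)
      have "openin (subtopology (gtop G) U) (U \<inter> W)"
        using U W openin_open_subtopology by blast
      then have "openin (subtopology (unit_space G) (grange G ` U)) (grange G ` (U \<inter> W))"
        using homeomorphic_imp_open_map[OF h] by (simp add: open_map_def)
      then have "openin (unit_space G) (grange G ` (U \<inter> W))"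
        using U(3) openin_trans_full by blast
      then show "\<exists>T. openin (unit_space G) T \<and> x \<in> T \<and> T \<subseteq> grange G ` W"
        using a U by blast
    qed
  qed
  show "openin (gtop G) (gunits G)"
  proof (subst openin_subopen, intro ballI)
    fix x assume x: "x \<in> gunits G"
    then obtain U where U: "openin (gtop G) U" "x \<in> U" "inj_on (grange G) U"
      using inj units_arrows by blast
    have "continuous_map (gtop G) (gtop G) (grange G)"
      using continuous_range by (simp add: continuous_map_in_subtopology)
    \<comment> \<open>Both \<open>a\<close> and \<open>r(a)\<close> have range \<open>r(a)\<close>, so if both lie in \<open>U\<close> they coincide.\<close>
    then have V: "openin (gtop G) (U \<inter> {a \<in> garrows G. grange G a \<in> U})"
      using U openin_continuous_map_preimage by blast
    have "U \<inter> {a \<in> garrows G. grange G a \<in> U} \<subseteq> gunits G"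
    proof clarify
      fix a assume a: "a \<in> U" "a \<in> garrows G" "grange G a \<in> U"
      then have "grange G a = a"
        using U(3) range_unit[OF range_closed[OF a(2)]] by (auto dest: inj_onD)
      then show "a \<in> gunits G" using range_closed[OF a(2)] by simp
    qed
    then show "\<exists>T. openin (gtop G) T \<and> x \<in> T \<and> T \<subseteq> gunits G"
      using V U x units_arrows range_unit by (intro exI[of _ "U \<inter> {a \<in> garrows G. grange G a \<in> U}"]) auto
  qed
qed

text \<open>A product \<open>c = a b\<close> with \<open>a\<close> in a small open set \<open>W\<close> is recognised by the condition that dividing \<open>c\<close>
  on the left by the arrow of \<open>W\<close> with the same range lands in \<open>V\<close>; this is an open condition.\<close>

lemma etale_open_mult:
  assumes G: "etale_groupoid G" and U: "openin (gtop G) U" and V: "openin (gtop G) V"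
  shows "openin (gtop G) {gmult G a b | a b. a \<in> U \<and> b \<in> V \<and> gsource G a = grange G b}"
    (is "openin _ ?UV")
proof (subst openin_subopen, intro ballI)
  interpret topological_groupoid G using G by (rule etale_topological)
  fix c assume "c \<in> ?UV"
  then obtain a b where ab: "a \<in> U" "b \<in> V" "gsource G a = grange G b" and c: "c = gmult G a b"
    by auto
  have arr: "U \<subseteq> garrows G" "V \<subseteq> garrows G" using U V openin_subset by auto
  obtain O' where O': "openin (gtop G) O'" "a \<in> O'" "inj_on (grange G) O'"
    using etale_range_locally_injective[OF G] ab arr by blast
  define W where "W = O' \<inter> U"
  have W: "openin (gtop G) W" "a \<in> W" "inj_on (grange G) W" "W \<subseteq> U"
    using O' U ab by (auto simp: W_def intro: inj_on_subset)
  let ?dom = "{c \<in> garrows G. grange G c \<in> grange G ` W}"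
  let ?a = "\<lambda>c. inv_into W (grange G) (grange G c)"
  note div = continuous_left_division[OF etale_open_range[OF G] W(1,3)]
  have T: "openin (gtop G) {c \<in> ?dom. gmult G (ginv G (?a c)) c \<in> V}"
    using openin_trans_full[OF openin_continuous_map_preimage[OF div(2) V] div(1)]
    by (simp add: conj_ac)
  have ca: "c \<in> garrows G" "grange G c = grange G a"
    using mult_closed[of a b] range_mult[of a b] c ab arr by (auto simp: composable_iff)
  have "?a c = a" using W ca by simp
  then have "gmult G (ginv G (?a c)) c = b"
    using inv_mult_cancel ab arr c by auto
  then have "c \<in> {c \<in> ?dom. gmult G (ginv G (?a c)) c \<in> V}"
    using ab ca W by auto
  moreover have "{c \<in> ?dom. gmult G (ginv G (?a c)) c \<in> V} \<subseteq> ?UV"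
  proof
    fix d assume d: "d \<in> {c \<in> ?dom. gmult G (ginv G (?a c)) c \<in> V}"
    then have ad: "?a d \<in> W" "grange G (?a d) = grange G d"
      by (auto intro: inv_into_into f_inv_into_f)
    then have ad': "?a d \<in> garrows G" "d \<in> garrows G" using d W arr by auto
    have "d = gmult G (?a d) (gmult G (ginv G (?a d)) d)"
      using mult_inv_cancel[OF ad' ad(2)] by simp
    moreover have "gsource G (?a d) = grange G (gmult G (ginv G (?a d)) d)"
      using ad ad' by (subst range_mult) (auto simp: composable_iff inv_closed source_inv range_inv)
    ultimately show "d \<in> ?UV" using ad W d by blast
  qed
  ultimately show "\<exists>T. openin (gtop G) T \<and> c \<in> T \<and> T \<subseteq> ?UV"
    using T by blast
qed

section \<open>Units of the ring\<close>

lemma one_ring_units: "1 \<in> ring_units"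
  by (simp add: ring_units_def)

lemma mult_ring_units: "t \<in> ring_units \<Longrightarrow> u \<in> ring_units \<Longrightarrow> t * u \<in> ring_units"
  using mult_dvd_mono[of t 1 u 1] by (simp add: ring_units_def)

lemma ring_unit_inverse:
  assumes "(t :: 'r::comm_ring_1) \<in> ring_units"
  shows "t * unit_inverse t = 1" "unit_inverse t * t = 1" "unit_inverse t \<in> ring_units"
proof -
  obtain u where u: "t * u = 1" using assms by (auto simp: ring_units_def elim: dvdE)
  then have "unit_inverse t = u" by (rule unit_inverse_eq)
  with u show "t * unit_inverse t = 1" "unit_inverse t * t = 1" "unit_inverse t \<in> ring_units"
    by (auto simp: ring_units_def mult.commute intro: dvdI[of _ _ t])
qed

lemma unit_inverse_cancel:
  assumes "(t :: 'r::comm_ring_1) \<in> ring_units"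
  shows "unit_inverse t * a = unit_inverse t * b \<longleftrightarrow> a = b"
  by (metis assms mult.left_neutral mult.assoc ring_unit_inverse(1))

lemma unit_inverse_mult_eq_0:
  "(t :: 'r::comm_ring_1) \<in> ring_units \<Longrightarrow> unit_inverse t * a = 0 \<longleftrightarrow> a = 0"
  using unit_inverse_cancel[of t a 0] by simp

lemma ring_units_dvd: "t \<in> ring_units \<Longrightarrow> c dvd t \<Longrightarrow> c \<in> ring_units"
  by (auto simp: ring_units_def intro: dvd_trans)

section \<open>The action of the units on a twist and the covering of the groupoid\<close>

sublocale discrete_twist \<subseteq> base: topological_groupoid G
  using etale by (simp add: etale_groupoid_def)

sublocale discrete_twist \<subseteq> twist: topological_groupoid \<Sigma>
  by (rule twist_groupoid)

context discrete_twist
begin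

abbreviation act :: "'r \<Rightarrow> 's \<Rightarrow> 's" where
  "act \<equiv> twist_action G \<Sigma> i q"

abbreviation unit_over :: "'g \<Rightarrow> 's" where
  "unit_over x \<equiv> i (x, 1)"

lemma topspace_unit_bundle: "garrows (unit_bundle G :: ('g \<times> 'r) grpd) = gunits G \<times> ring_units"
  using base.units_arrows by (auto simp: unit_bundle_def)

lemma i_arrow: "x \<in> gunits G \<Longrightarrow> t \<in> ring_units \<Longrightarrow> i (x, t) \<in> garrows \<Sigma>"
  and q_i: "x \<in> gunits G \<Longrightarrow> t \<in> ring_units \<Longrightarrow> q (i (x, t)) = x"
  using exact[of x] by blast+

lemma i_mult:
  assumes "x \<in> gunits G" "t \<in> ring_units" "u \<in> ring_units"
  shows "gmult \<Sigma> (i (x, t)) (i (x, u)) = i (x, t * u)"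
    and "(i (x, t), i (x, u)) \<in> composable \<Sigma>"
proof -
  have "((x, t), (x, u)) \<in> composable (unit_bundle G)"
    using assms topspace_unit_bundle by (auto simp: composable_def unit_bundle_def)
  moreover have "gmult (unit_bundle G) (x, t) (x, u) = (x, t * u)"
    by (simp add: unit_bundle_def)
  ultimately show "gmult \<Sigma> (i (x, t)) (i (x, u)) = i (x, t * u)"
    "(i (x, t), i (x, u)) \<in> composable \<Sigma>"
    using i_hom unfolding groupoid_hom_def by fastforce+
qed

lemma q_arrow: "\<sigma> \<in> garrows \<Sigma> \<Longrightarrow> q \<sigma> \<in> garrows G"
  using q_surj by blast

lemma arrow_over:
  assumes "a \<in> garrows G"
  obtains \<sigma> where "\<sigma> \<in> garrows \<Sigma>" "a = q \<sigma>"
  using assms q_surj by (metis imageE)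

lemma q_mult: "(\<sigma>, \<tau>) \<in> composable \<Sigma> \<Longrightarrow> q (gmult \<Sigma> \<sigma> \<tau>) = gmult G (q \<sigma>) (q \<tau>)"
  using q_hom unfolding groupoid_hom_def by auto

lemma unit_over_unit: "x \<in> gunits G \<Longrightarrow> unit_over x \<in> gunits \<Sigma>"
  by (simp add: twist_units)

lemma range_twist: "\<sigma> \<in> garrows \<Sigma> \<Longrightarrow> grange \<Sigma> \<sigma> = unit_over (grange G (q \<sigma>))"
  and source_twist: "\<sigma> \<in> garrows \<Sigma> \<Longrightarrow> gsource \<Sigma> \<sigma> = unit_over (gsource G (q \<sigma>))"
proof -
  assume \<sigma>: "\<sigma> \<in> garrows \<Sigma>"
  have x: "grange G (q \<sigma>) \<in> gunits G" "gsource G (q \<sigma>) \<in> gunits G"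
    using \<sigma> by (simp_all add: q_arrow base.range_closed base.source_closed)
  show "grange \<Sigma> \<sigma> = unit_over (grange G (q \<sigma>))" "gsource \<Sigma> \<sigma> = unit_over (gsource G (q \<sigma>))"
    using q_inj_units q_range_source[OF \<sigma>] x \<sigma>
    by (auto intro!: inj_onD[OF q_inj_units]
        simp: unit_over_unit twist.range_closed twist.source_closed q_i one_ring_units)
qed

lemma composable_twist_iff:
  "(\<sigma>, \<tau>) \<in> composable \<Sigma> \<longleftrightarrow>
     \<sigma> \<in> garrows \<Sigma> \<and> \<tau> \<in> garrows \<Sigma> \<and> gsource G (q \<sigma>) = grange G (q \<tau>)"
proof -
  have "gsource \<Sigma> \<sigma> = grange \<Sigma> \<tau> \<longleftrightarrow> gsource G (q \<sigma>) = grange G (q \<tau>)"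
    if "\<sigma> \<in> garrows \<Sigma>" "\<tau> \<in> garrows \<Sigma>"
    using q_range_source[OF that(1)] q_range_source[OF that(2)] range_twist[OF that(2)]
      source_twist[OF that(1)] by metis
  then show ?thesis by (auto simp: twist.composable_iff)
qed

lemma q_inv: "\<sigma> \<in> garrows \<Sigma> \<Longrightarrow> q (ginv \<Sigma> \<sigma>) = ginv G (q \<sigma>)"
proof -
  assume \<sigma>: "\<sigma> \<in> garrows \<Sigma>"
  let ?\<sigma>' = "ginv \<Sigma> \<sigma>"
  have i: "?\<sigma>' \<in> garrows \<Sigma>" using \<sigma> by (rule twist.inv_closed)
  have c: "(\<sigma>, ?\<sigma>') \<in> composable \<Sigma>"
    using \<sigma> i by (simp add: twist.composable_iff twist.range_inv)
  then have s: "gsource G (q \<sigma>) = grange G (q ?\<sigma>')" by (simp add: composable_twist_iff)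
  have "gmult G (q \<sigma>) (q ?\<sigma>') = grange G (q \<sigma>)"
    using q_mult[OF c] twist.mult_inv_right[OF \<sigma>] q_range_source[OF \<sigma>] by simp
  then have "gmult G (ginv G (q \<sigma>)) (grange G (q \<sigma>)) = q ?\<sigma>'"
    using base.inv_mult_cancel[OF q_arrow[OF \<sigma>] q_arrow[OF i] s] by simp
  then show ?thesis
    using base.source_mult_right[OF base.inv_closed[OF q_arrow[OF \<sigma>]]]
    by (simp add: base.source_inv q_arrow \<sigma>)
qed

lemma act_composable:
  assumes "\<sigma> \<in> garrows \<Sigma>" "t \<in> ring_units"
  shows "(i (grange G (q \<sigma>), t), \<sigma>) \<in> composable \<Sigma>"
    and "(\<sigma>, i (gsource G (q \<sigma>), t)) \<in> composable \<Sigma>"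
  using assms base.range_closed[OF q_arrow[OF assms(1)]] base.source_closed[OF q_arrow[OF assms(1)]]
  by (simp_all add: composable_twist_iff i_arrow q_i base.source_unit base.range_unit)

lemma act_arrow: "\<sigma> \<in> garrows \<Sigma> \<Longrightarrow> t \<in> ring_units \<Longrightarrow> act t \<sigma> \<in> garrows \<Sigma>"
  unfolding twist_action_def by (intro twist.mult_closed act_composable)

lemma q_act: "\<sigma> \<in> garrows \<Sigma> \<Longrightarrow> t \<in> ring_units \<Longrightarrow> q (act t \<sigma>) = q \<sigma>"
  unfolding twist_action_def
  by (simp add: q_mult act_composable q_i base.range_closed q_arrow base.range_mult_left)

lemma act_one: "\<sigma> \<in> garrows \<Sigma> \<Longrightarrow> act 1 \<sigma> = \<sigma>"
  unfolding twist_action_def using range_twist twist.range_mult_left by metis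

lemma act_act:
  assumes "\<sigma> \<in> garrows \<Sigma>" "t \<in> ring_units" "u \<in> ring_units"
  shows "act t (act u \<sigma>) = act (t * u) \<sigma>"
proof -
  have "grange G (q \<sigma>) \<in> gunits G" using assms by (simp add: base.range_closed q_arrow)
  then have "gmult \<Sigma> (gmult \<Sigma> (i (grange G (q \<sigma>), t)) (i (grange G (q \<sigma>), u))) \<sigma> =
      gmult \<Sigma> (i (grange G (q \<sigma>), t)) (gmult \<Sigma> (i (grange G (q \<sigma>), u)) \<sigma>)"
    using assms by (intro twist.mult_assoc i_mult act_composable)
  moreover have "grange G (q (act u \<sigma>)) = grange G (q \<sigma>)" using assms by (simp add: q_act)
  ultimately show ?thesis
    using assms by (simp add: twist_action_def i_mult base.range_closed q_arrow)
qed

lemma act_unit_over: "x \<in> gunits G \<Longrightarrow> t \<in> ring_units \<Longrightarrow> act t (unit_over x) = i (x, t)"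
  using i_mult(1)[of x t 1]
  by (simp add: twist_action_def q_i one_ring_units base.range_unit)

lemma act_free:
  assumes "\<sigma> \<in> garrows \<Sigma>" "t \<in> ring_units" "u \<in> ring_units" "act t \<sigma> = act u \<sigma>"
  shows "t = u"
proof -
  let ?x = "grange G (q \<sigma>)"
  have x: "?x \<in> gunits G" using assms by (simp add: base.range_closed q_arrow)
  have "i (?x, s) = gmult \<Sigma> (act s \<sigma>) (ginv \<Sigma> \<sigma>)" if "s \<in> ring_units" for s
    using twist.mult_inv_cancel_right[of "i (?x, s)" \<sigma>] act_composable(1)[OF assms(1) that]
    by (simp add: twist_action_def twist.composable_iff)
  then have "i (?x, t) = i (?x, u)" using assms by simp
  then show ?thesis using i_inj x assms by (auto dest: inj_onD)
qed

text \<open>Two arrows over the same arrow of \<open>G\<close> differ by an element of the fibre over a unit, and exactness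
  identifies that fibre with the units of the ring.\<close>

lemma fibre_orbit:
  assumes "\<sigma> \<in> garrows \<Sigma>" "\<tau> \<in> garrows \<Sigma>" "q \<sigma> = q \<tau>"
  obtains t where "t \<in> ring_units" "\<tau> = act t \<sigma>"
proof -
  let ?x = "grange G (q \<sigma>)" and ?d = "gmult \<Sigma> \<tau> (ginv \<Sigma> \<sigma>)"
  have x: "?x \<in> gunits G" using assms by (simp add: base.range_closed q_arrow)
  have c: "(\<tau>, ginv \<Sigma> \<sigma>) \<in> composable \<Sigma>"
    using assms by (simp add: composable_twist_iff twist.inv_closed q_inv base.range_inv q_arrow)
  have "q ?d = ?x"
    using q_mult[OF c] assms by (simp add: q_inv base.mult_inv_right q_arrow)
  moreover have "?d \<in> garrows \<Sigma>" using c by (rule twist.mult_closed)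
  ultimately obtain t where t: "t \<in> ring_units" "?d = i (?x, t)"
    using exact[OF x] by blast
  have "gmult \<Sigma> ?d (ginv \<Sigma> (ginv \<Sigma> \<sigma>)) = \<tau>"
    using c by (intro twist.mult_inv_cancel_right) (auto simp: twist.composable_iff)
  then have "\<tau> = act t \<sigma>"
    using t assms by (simp add: twist_action_def twist.inv_inv)
  then show thesis using that t by blast
qed

lemma act_mult_left:
  assumes "(\<sigma>, \<tau>) \<in> composable \<Sigma>" "t \<in> ring_units"
  shows "gmult \<Sigma> (act t \<sigma>) \<tau> = act t (gmult \<Sigma> \<sigma> \<tau>)"
proof -
  have "grange G (q (gmult \<Sigma> \<sigma> \<tau>)) = grange G (q \<sigma>)"
    using assms by (simp add: q_mult base.range_mult base.composable_iff composable_twist_iff q_arrow)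
  then show ?thesis
    unfolding twist_action_def
    using twist.mult_assoc[OF act_composable(1)[OF _ assms(2)] assms(1)] assms(1)
    by (simp add: composable_twist_iff)
qed

text \<open>Here centrality of the unit bundle enters.\<close>

lemma act_mult_right:
  assumes c: "(\<sigma>, \<tau>) \<in> composable \<Sigma>" and t: "t \<in> ring_units"
  shows "gmult \<Sigma> \<sigma> (act t \<tau>) = act t (gmult \<Sigma> \<sigma> \<tau>)"
proof -
  have arr: "\<sigma> \<in> garrows \<Sigma>" "\<tau> \<in> garrows \<Sigma>" "gsource G (q \<sigma>) = grange G (q \<tau>)"
    using c by (auto simp: composable_twist_iff)
  have "gmult \<Sigma> \<sigma> (act t \<tau>) = gmult \<Sigma> (gmult \<Sigma> \<sigma> (i (gsource G (q \<sigma>), t))) \<tau>"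
    using twist.mult_assoc[of \<sigma> "i (grange G (q \<tau>), t)" \<tau>]
      act_composable(2)[OF arr(1) t] act_composable(1)[OF arr(2) t] arr(3)
    by (simp add: twist_action_def)
  also have "\<dots> = gmult \<Sigma> (act t \<sigma>) \<tau>"
    using central[OF arr(1) t] by (simp add: twist_action_def)
  also have "\<dots> = act t (gmult \<Sigma> \<sigma> \<tau>)" using act_mult_left[OF c t] .
  finally show ?thesis .
qed

lemma continuous_unit_over: "continuous_map (unit_space G) (gtop \<Sigma>) unit_over"
  and continuous_i: "t \<in> ring_units \<Longrightarrow> continuous_map (unit_space G) (gtop \<Sigma>) (\<lambda>x. i (x, t))"
proof -
  have c: "continuous_map (unit_space G) (gtop \<Sigma>) (\<lambda>x. i (x, t))" if "t \<in> ring_units" for t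
  proof -
    have "continuous_map (unit_space G) (prod_topology (unit_space G) (discrete_topology ring_units)) (\<lambda>x. (x, t))"
      using that by (intro continuous_map_pairedI) auto
    then show ?thesis
      using continuous_map_compose i_continuous by (fastforce simp: unit_bundle_def o_def)
  qed
  show "continuous_map (unit_space G) (gtop \<Sigma>) unit_over" by (rule c[OF one_ring_units])
  show "t \<in> ring_units \<Longrightarrow> continuous_map (unit_space G) (gtop \<Sigma>) (\<lambda>x. i (x, t))" by (rule c)
qed

lemma continuous_range_q: "continuous_map (gtop \<Sigma>) (unit_space G) (\<lambda>\<sigma>. grange G (q \<sigma>))"
  and continuous_source_q: "continuous_map (gtop \<Sigma>) (unit_space G) (\<lambda>\<sigma>. gsource G (q \<sigma>))"
  using continuous_map_compose[OF q_continuous base.continuous_range]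
    continuous_map_compose[OF q_continuous base.continuous_source] by (simp_all add: o_def)

lemma continuous_act:
  assumes "t \<in> ring_units"
  shows "continuous_map (gtop \<Sigma>) (gtop \<Sigma>) (act t)"
proof -
  have "continuous_map (gtop \<Sigma>) (gtop \<Sigma>) (\<lambda>\<sigma>. i (grange G (q \<sigma>), t))"
    using continuous_map_compose[OF continuous_range_q continuous_i[OF assms]] by (simp add: o_def)
  then have "continuous_map (gtop \<Sigma>) (gtop \<Sigma>) (\<lambda>\<sigma>. gmult \<Sigma> (i (grange G (q \<sigma>), t)) \<sigma>)"
    by (rule twist.continuous_map_gmult)
      (use act_composable(1)[OF _ assms] in \<open>auto simp: twist.composable_iff\<close>)
  then show ?thesis by (simp add: twist_action_def[abs_def])
qed

text \<open>A local trivialisation cuts an open neighbourhood of an arrow \<open>\<sigma>\<close> of the twist into the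
  sheets of the covering \<open>q\<close>; only the sheet through \<open>\<sigma>\<close> matters for the topological properties of
  \<open>q\<close>.\<close>

lemma local_sheet:
  assumes \<sigma>: "\<sigma> \<in> garrows \<Sigma>"
  obtains B p where "openin (gtop G) B" "q \<sigma> \<in> B" "p (q \<sigma>) = \<sigma>"
    "continuous_map (subtopology (gtop G) B) (gtop \<Sigma>) p" "\<And>b. b \<in> B \<Longrightarrow> q (p b) = b"
    "openin (gtop \<Sigma>) (p ` B)"
proof -
  obtain B P where B: "openin (gtop G) B" "q \<sigma> \<in> B"
    and qP: "\<forall>b\<in>B. q (P b) = b"
    and P: "continuous_map (subtopology (gtop G) B) (gtop \<Sigma>) P"
    and h: "homeomorphic_map
              (prod_topology (subtopology (gtop G) B) (discrete_topology (ring_units :: 'r set)))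
              (subtopology (gtop \<Sigma>) {\<sigma> \<in> garrows \<Sigma>. q \<sigma> \<in> B})
              (\<lambda>(b, t). gmult \<Sigma> (i (grange G b, t)) (P b))" (is "homeomorphic_map ?X ?Y ?h")
    using locally_trivial[OF q_arrow[OF \<sigma>]] by blast
  have BG: "B \<subseteq> garrows G" using B(1) by (rule openin_subset)
  have tX: "topspace ?X = B \<times> ring_units" using BG by auto
  have PS: "P b \<in> garrows \<Sigma>" if "b \<in> B" for b
    using P that BG by (auto simp: continuous_map_def)
  obtain t where t: "t \<in> ring_units" "\<sigma> = act t (P (q \<sigma>))"
    using fibre_orbit[of "P (q \<sigma>)" \<sigma>] PS qP B \<sigma> by metis
  let ?p = "\<lambda>b. act t (P b)"
  have hp: "?h (b, t) = ?p b" if "b \<in> B" for b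
    using qP that by (simp add: twist_action_def)
  have qp: "q (?p b) = b" if "b \<in> B" for b
    using that PS qP by (simp add: q_act t)
  show thesis
  proof
    show "openin (gtop G) B" "q \<sigma> \<in> B" by fact+
    show "?p (q \<sigma>) = \<sigma>" using t by simp
    show "continuous_map (subtopology (gtop G) B) (gtop \<Sigma>) ?p"
      using continuous_map_compose[OF P continuous_act[OF t(1)]] by (simp add: o_def)
    show "q (?p b) = b" if "b \<in> B" for b using qp that .
    have "openin ?X (B \<times> {t})"
      using t BG by (subst openin_prod_Times_iff) (auto simp: openin_subtopology_refl)
    then have "openin ?Y (?h ` (B \<times> {t}))"
      using homeomorphic_imp_open_map[OF h] by (simp only: open_map_def)
    moreover have "?h ` (B \<times> {t}) = ?p ` B" using hp by force
    moreover have "openin (gtop \<Sigma>) {\<sigma> \<in> garrows \<Sigma>. q \<sigma> \<in> B}"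
      using openin_continuous_map_preimage[OF q_continuous B(1)] .
    ultimately show "openin (gtop \<Sigma>) (?p ` B)"
      using openin_trans_full by metis
  qed
qed

lemma q_open: "open_map (gtop \<Sigma>) (gtop G) q"
  unfolding open_map_def
proof (intro allI impI)
  fix U assume U: "openin (gtop \<Sigma>) U"
  show "openin (gtop G) (q ` U)"
  proof (subst openin_subopen, intro ballI)
    fix a assume "a \<in> q ` U"
    then obtain \<sigma> where \<sigma>: "\<sigma> \<in> U" "a = q \<sigma>" by auto
    then have "\<sigma> \<in> garrows \<Sigma>" using openin_subset[OF U] by auto
    then obtain B p where p: "openin (gtop G) B" "q \<sigma> \<in> B" "p (q \<sigma>) = \<sigma>"
      "continuous_map (subtopology (gtop G) B) (gtop \<Sigma>) p" "\<And>b. b \<in> B \<Longrightarrow> q (p b) = b"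
      by (rule local_sheet) blast
    have "openin (gtop G) {b \<in> topspace (subtopology (gtop G) B). p b \<in> U}"
      using openin_continuous_map_preimage[OF p(4) U] p(1) openin_trans_full by blast
    moreover have "a \<in> {b \<in> topspace (subtopology (gtop G) B). p b \<in> U}"
      using \<sigma> p openin_subset[OF p(1)] by auto
    moreover have "{b \<in> topspace (subtopology (gtop G) B). p b \<in> U} \<subseteq> q ` U"
      using p(5) by force
    ultimately show "\<exists>T. openin (gtop G) T \<and> a \<in> T \<and> T \<subseteq> q ` U" by blast
  qed
qed

lemma q_locally_injective:
  assumes "\<sigma> \<in> garrows \<Sigma>"
  obtains U where "openin (gtop \<Sigma>) U" "\<sigma> \<in> U" "inj_on q U"
proof -
  obtain B p where p: "q \<sigma> \<in> B" "p (q \<sigma>) = \<sigma>" "\<And>b. b \<in> B \<Longrightarrow> q (p b) = b"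
    "openin (gtop \<Sigma>) (p ` B)"
    using local_sheet[OF assms] by metis
  then show thesis
    by (intro that[of "p ` B"]) (auto intro!: inj_onI rev_image_eqI)
qed

lemma quotient_q: "quotient_map (gtop \<Sigma>) (gtop G) q"
  using q_open q_continuous q_surj by (intro continuous_open_imp_quotient_map) auto

text \<open>Near \<open>s a\<close> the map \<open>q\<close> is injective, so an arrow there coincides with the value of \<open>s\<close> at its image
  as soon as that value is near \<open>s a\<close> too.  In particular \<open>\<Sigma>\<close> has an open unit space.\<close>

lemma open_continuous_section:
  assumes U: "openin (gtop G) U" and s: "continuous_map (subtopology (gtop G) U) (gtop \<Sigma>) s"
    and qs: "\<And>a. a \<in> U \<Longrightarrow> q (s a) = a"
  shows "openin (gtop \<Sigma>) (s ` U)"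
proof (subst openin_subopen, intro ballI)
  have UG: "U \<subseteq> garrows G" using U by (rule openin_subset)
  fix \<sigma> assume "\<sigma> \<in> s ` U"
  then obtain a where a: "a \<in> U" "\<sigma> = s a" by auto
  have sa: "s b \<in> garrows \<Sigma>" if "b \<in> U" for b
    using s that UG by (auto simp: continuous_map_def)
  obtain O' where O': "openin (gtop \<Sigma>) O'" "\<sigma> \<in> O'" "inj_on q O'"
    using q_locally_injective sa a by metis
  define V where "V = {b \<in> topspace (subtopology (gtop G) U). s b \<in> O'}"
  have "openin (subtopology (gtop G) U) V"
    unfolding V_def using s O'(1) by (rule openin_continuous_map_preimage)
  then have V: "openin (gtop G) V" using U by (rule openin_trans_full)
  have V': "V \<subseteq> U" "a \<in> V" using a O'(2) UG by (auto simp: V_def)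
  have T: "openin (gtop \<Sigma>) (O' \<inter> {\<sigma> \<in> garrows \<Sigma>. q \<sigma> \<in> V})"
    using O' V openin_continuous_map_preimage[OF q_continuous] by blast
  have "O' \<inter> {\<sigma> \<in> garrows \<Sigma>. q \<sigma> \<in> V} \<subseteq> s ` U"
  proof
    fix \<tau> assume \<tau>: "\<tau> \<in> O' \<inter> {\<sigma> \<in> garrows \<Sigma>. q \<sigma> \<in> V}"
    then have "s (q \<tau>) \<in> O'" "q (s (q \<tau>)) = q \<tau>" using qs V' by (auto simp: V_def)
    then have "s (q \<tau>) = \<tau>" using O'(3) \<tau> by (auto dest: inj_onD)
    then show "\<tau> \<in> s ` U" using \<tau> V' by (metis IntD2 imageI mem_Collect_eq subsetD)
  qed
  moreover have "\<sigma> \<in> O' \<inter> {\<sigma> \<in> garrows \<Sigma>. q \<sigma> \<in> V}"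
    using O' a sa qs V' by auto
  ultimately show "\<exists>T. openin (gtop \<Sigma>) T \<and> \<sigma> \<in> T \<and> T \<subseteq> s ` U" using T by blast
qed

lemma open_units_over:
  assumes "openin (gtop G) K" "K \<subseteq> gunits G"
  shows "openin (gtop \<Sigma>) (unit_over ` K)"
  using assms
  by (intro open_continuous_section)
    (auto simp: q_i one_ring_units subtopology_subtopology Int_absorb1
      intro: continuous_map_from_subtopology_mono[OF continuous_unit_over, of K, simplified])

text \<open>Up to the embedding of units, the range map of \<open>\<Sigma>\<close> is \<open>q\<close> followed by the range map of \<open>G\<close>, and both
  are open.\<close>

lemma open_range_twist: "open_map (gtop \<Sigma>) (unit_space \<Sigma>) (grange \<Sigma>)"
  unfolding open_map_def
proof (intro allI impI)
  fix U assume U: "openin (gtop \<Sigma>) U"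
  have "openin (unit_space G) (grange G ` q ` U)"
    using U q_open etale_open_range[OF etale] by (simp add: open_map_def)
  then have K: "openin (gtop G) (grange G ` q ` U)"
    using etale_open_units[OF etale] openin_trans_full by blast
  have Kunits: "grange G ` q ` U \<subseteq> gunits G"
    using openin_subset[OF U] by (auto simp: base.range_closed q_arrow)
  have "grange \<Sigma> ` U = unit_over ` grange G ` q ` U"
    unfolding image_image using openin_subset[OF U] range_twist by (intro image_cong) auto
  moreover have "unit_over ` grange G ` q ` U \<subseteq> gunits \<Sigma>"
    using Kunits unit_over_unit by blast
  ultimately show "openin (unit_space \<Sigma>) (grange \<Sigma> ` U)"
    using open_units_over[OF K Kunits] by (simp add: openin_subset_topspace_eq openin_subtopology_Int2 Int_absorb2 openin_subtopology) (metis Int_absorb2)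
qed

end

section \<open>Compact open sets and twisted functions\<close>

locale ample_twist = discrete_twist G \<Sigma> i q
  for G :: "'g grpd" and \<Sigma> :: "'s grpd" and i :: "'g \<times> 'r::comm_ring_1 \<Rightarrow> 's" and q :: "'s \<Rightarrow> 'g" +
  assumes ample: "ample_groupoid G"
    and Hausdorff: "Hausdorff_space (gtop G)"
begin

abbreviation rng :: "'s \<Rightarrow> 'g" where "rng \<sigma> \<equiv> grange G (q \<sigma>)"
abbreviation src :: "'s \<Rightarrow> 'g" where "src \<sigma> \<equiv> gsource G (q \<sigma>)"
abbreviation conv :: "('s \<Rightarrow> 'r) \<Rightarrow> ('s \<Rightarrow> 'r) \<Rightarrow> 's \<Rightarrow> 'r" where
  "conv \<equiv> steinberg_conv G \<Sigma> q"
abbreviation alg :: "('s \<Rightarrow> 'r) set" where "alg \<equiv> steinberg_algebra G \<Sigma> i q"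
abbreviation diag :: "('s \<Rightarrow> 'r) set" where "diag \<equiv> diagonal_subalgebra G \<Sigma> i q"

lemma compact_open_bisection:
  assumes "openin (gtop G) U" "a \<in> U"
  obtains B where "openin (gtop G) B" "compactin (gtop G) B" "a \<in> B" "B \<subseteq> U"
    "inj_on (grange G) B" "inj_on (gsource G) B"
proof -
  obtain B where B: "openin (gtop G) B" "compactin (gtop G) B" "bisection G B" "a \<in> B" "B \<subseteq> U"
    using ample assms unfolding ample_groupoid_def by blast
  obtain V where V: "openin (gtop G) V" "B \<subseteq> V"
    "homeo_onto_open (gtop G) (unit_space G) V (grange G)"
    "homeo_onto_open (gtop G) (unit_space G) V (gsource G)"
    using B(3) by (auto simp: bisection_def)
  have "inj_on (grange G) V" "inj_on (gsource G) V"
    using V(3,4) openin_subset[OF V(1)] homeomorphic_imp_injective_map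
    by (fastforce simp: homeo_onto_open_def Int_absorb1)+
  then show thesis using that B V(2) by (meson inj_on_subset)
qed

lemma separating_compact_open:
  assumes "x \<in> gunits G" "y \<in> gunits G" "x \<noteq> y"
  obtains K where "openin (gtop G) K" "compactin (gtop G) K" "K \<subseteq> gunits G" "x \<in> K" "y \<notin> K"
proof -
  obtain U V where "openin (gtop G) U" "openin (gtop G) V" "x \<in> U" "y \<in> V" "disjnt U V"
    using Hausdorff assms base.units_arrows by (metis Hausdorff_space_def subsetD)
  then have U: "openin (gtop G) (U \<inter> gunits G)" "x \<in> U \<inter> gunits G" "y \<notin> U"
    using assms etale_open_units[OF etale] by (auto simp: disjnt_iff)
  obtain B where "openin (gtop G) B" "compactin (gtop G) B" "x \<in> B" "B \<subseteq> U \<inter> gunits G"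
    using compact_open_bisection[OF U(1,2)] .
  then show thesis using that U by blast
qed

lemma image_compact_open:
  assumes "openin (gtop G) C" "compactin (gtop G) C"
  shows "openin (gtop G) (gsource G ` C)" "compactin (gtop G) (gsource G ` C)"
    "gsource G ` C \<subseteq> gunits G"
    and "openin (gtop G) (grange G ` C)" "compactin (gtop G) (grange G ` C)"
    "grange G ` C \<subseteq> gunits G"
proof -
  have "continuous_map (gtop G) (gtop G) (gsource G)" "continuous_map (gtop G) (gtop G) (grange G)"
    using base.continuous_source base.continuous_range by (auto simp: continuous_map_in_subtopology)
  then show "compactin (gtop G) (gsource G ` C)" "compactin (gtop G) (grange G ` C)"
    using assms image_compactin by blast+
  have "openin (unit_space G) (gsource G ` C)" "openin (unit_space G) (grange G ` C)"
    using assms etale_open_range[OF etale]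
      base.open_range_imp_open_source[OF etale_open_range[OF etale]]
    by (simp_all add: open_map_def)
  then show "openin (gtop G) (gsource G ` C)" "openin (gtop G) (grange G ` C)"
    using etale_open_units[OF etale] openin_trans_full by blast+
  show "gsource G ` C \<subseteq> gunits G" "grange G ` C \<subseteq> gunits G"
    using openin_subset[OF assms(1)] base.source_closed base.range_closed by auto
qed

text \<open>Range is locally injective, so finitely many arrows of a compact set share a range.  This makes the
  sum in a convolution finite, which matters because a sum over an infinite set is 0 by convention.\<close>

lemma finite_range_fibre:
  assumes "compactin (gtop G) C"
  shows "finite {a \<in> C. grange G a = x}"
proof -
  let ?\<U> = "{U. openin (gtop G) U \<and> inj_on (grange G) U}"
  have "C \<subseteq> \<Union>?\<U>"
    using etale_range_locally_injective[OF etale] compactin_subset_topspace[OF assms] by blast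
  then obtain \<F> where F: "finite \<F>" "\<F> \<subseteq> ?\<U>" "C \<subseteq> \<Union>\<F>"
    using compactinD[OF assms, of ?\<U>] by blast
  have "finite {a \<in> U. grange G a = x}" if "U \<in> \<F>" for U
  proof -
    have "inj_on (grange G) U" using F that by auto
    then have "{a \<in> U. grange G a = x} \<subseteq> {inv_into U (grange G) x}"
      by auto
    then show ?thesis using finite_subset by blast
  qed
  then have "finite (\<Union>U\<in>\<F>. {a \<in> U. grange G a = x})" using F by blast
  moreover have "{a \<in> C. grange G a = x} \<subseteq> (\<Union>U\<in>\<F>. {a \<in> U. grange G a = x})" using F by blast
  ultimately show ?thesis by (rule finite_subset[rotated])
qed

lemma rng_src_unit: "\<sigma> \<in> garrows \<Sigma> \<Longrightarrow> rng \<sigma> \<in> gunits G" "\<sigma> \<in> garrows \<Sigma> \<Longrightarrow> src \<sigma> \<in> gunits G"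
  by (simp_all add: base.range_closed base.source_closed q_arrow)

lemma unit_over_arrow: "x \<in> gunits G \<Longrightarrow> unit_over x \<in> garrows \<Sigma>"
  by (simp add: i_arrow one_ring_units)

lemma q_unit_over: "x \<in> gunits G \<Longrightarrow> q (unit_over x) = x"
  by (simp add: q_i one_ring_units)

text \<open>The defining conditions of the algebra other than compactness of the support.\<close>

definition twisted :: "('s \<Rightarrow> 'r) \<Rightarrow> bool" where
  "twisted f \<longleftrightarrow>
     (\<forall>\<sigma>. \<sigma> \<notin> garrows \<Sigma> \<longrightarrow> f \<sigma> = 0) \<and>
     (\<forall>\<sigma> \<in> garrows \<Sigma>. \<exists>U. openin (gtop \<Sigma>) U \<and> \<sigma> \<in> U \<and> f constant_on U) \<and>
     (\<forall>t \<in> ring_units. \<forall>\<sigma> \<in> garrows \<Sigma>. f (act t \<sigma>) = unit_inverse t * f \<sigma>)"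

lemma alg_iff: "f \<in> alg \<longleftrightarrow> twisted f \<and> compactin (gtop G) (q ` supp f)"
  by (auto simp: twisted_def steinberg_algebra_def)

lemma alg_twisted: "f \<in> alg \<Longrightarrow> twisted f"
  by (simp add: alg_iff)

lemma twisted_act:
  "twisted f \<Longrightarrow> t \<in> ring_units \<Longrightarrow> \<sigma> \<in> garrows \<Sigma> \<Longrightarrow> f (act t \<sigma>) = unit_inverse t * f \<sigma>"
  by (simp add: twisted_def)

lemma supp_arrow: "twisted f \<Longrightarrow> f \<sigma> \<noteq> 0 \<Longrightarrow> \<sigma> \<in> garrows \<Sigma>"
  by (auto simp: twisted_def)

lemma twisted_open:
  assumes "twisted f"
  shows "openin (gtop \<Sigma>) {\<sigma> \<in> garrows \<Sigma>. P (f \<sigma>)}"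
proof (subst openin_subopen, intro ballI)
  fix \<sigma> assume \<sigma>: "\<sigma> \<in> {\<sigma> \<in> garrows \<Sigma>. P (f \<sigma>)}"
  then obtain U where U: "openin (gtop \<Sigma>) U" "\<sigma> \<in> U" "f constant_on U"
    using assms by (auto simp: twisted_def)
  then have "U \<subseteq> {\<sigma> \<in> garrows \<Sigma>. P (f \<sigma>)}"
    using \<sigma> openin_subset[OF U(1)] by (auto simp: constant_on_def)
  then show "\<exists>T. openin (gtop \<Sigma>) T \<and> \<sigma> \<in> T \<and> T \<subseteq> {\<sigma> \<in> garrows \<Sigma>. P (f \<sigma>)}"
    using U by blast
qed

lemma twistedI:
  assumes "\<And>\<sigma>. \<sigma> \<notin> garrows \<Sigma> \<Longrightarrow> f \<sigma> = 0"
    and "\<And>\<sigma>. \<sigma> \<in> garrows \<Sigma> \<Longrightarrow> \<exists>U. openin (gtop \<Sigma>) U \<and> \<sigma> \<in> U \<and> (\<forall>\<tau>\<in>U. f \<tau> = f \<sigma>)"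
    and "\<And>t \<sigma>. t \<in> ring_units \<Longrightarrow> \<sigma> \<in> garrows \<Sigma> \<Longrightarrow> f (act t \<sigma>) = unit_inverse t * f \<sigma>"
  shows "twisted f"
  unfolding twisted_def constant_on_def using assms by meson

lemma mem_q_supp_iff:
  assumes "twisted f" "\<sigma> \<in> garrows \<Sigma>"
  shows "q \<sigma> \<in> q ` supp f \<longleftrightarrow> f \<sigma> \<noteq> 0"
proof
  assume "q \<sigma> \<in> q ` supp f"
  then obtain \<tau> where \<tau>: "f \<tau> \<noteq> 0" "q \<tau> = q \<sigma>" by (auto simp: supp_def)
  then obtain t where "t \<in> ring_units" "\<sigma> = act t \<tau>"
    using fibre_orbit[of \<tau> \<sigma>] assms supp_arrow by metis
  then show "f \<sigma> \<noteq> 0"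
    using \<tau> assms supp_arrow by (simp add: twisted_act unit_inverse_mult_eq_0)
qed (auto simp: supp_def)

text \<open>By equivariance a function vanishes on all of a fibre of \<open>q\<close> or nowhere on it, so the complement of
  the support also projects to an open set.\<close>

lemma q_supp_clopen:
  assumes "twisted f"
  shows "openin (gtop G) (q ` supp f)" "closedin (gtop G) (q ` supp f)"
proof -
  have s: "supp f = {\<sigma> \<in> garrows \<Sigma>. f \<sigma> \<noteq> 0}" using supp_arrow[OF assms] by (auto simp: supp_def)
  show "openin (gtop G) (q ` supp f)"
    using twisted_open[OF assms, of "\<lambda>v. v \<noteq> 0"] q_open s by (simp add: open_map_def)
  have "garrows G - q ` supp f = q ` {\<sigma> \<in> garrows \<Sigma>. f \<sigma> = 0}" (is "?L = ?R")
  proof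
    show "?L \<subseteq> ?R"
    proof
      fix a assume a: "a \<in> ?L"
      then obtain \<sigma> where \<sigma>: "\<sigma> \<in> garrows \<Sigma>" "a = q \<sigma>" using arrow_over by blast
      then have "f \<sigma> = 0" using a mem_q_supp_iff[OF assms \<sigma>(1)] by simp
      then show "a \<in> ?R" using \<sigma> by blast
    qed
    show "?R \<subseteq> ?L" using mem_q_supp_iff[OF assms] q_arrow by auto
  qed
  moreover have "openin (gtop G) (q ` {\<sigma> \<in> garrows \<Sigma>. f \<sigma> = 0})"
    using twisted_open[OF assms, of "\<lambda>v. v = 0"] q_open by (simp add: open_map_def)
  moreover have "q ` supp f \<subseteq> garrows G"
    using s q_arrow by auto
  ultimately show "closedin (gtop G) (q ` supp f)" by (simp add: closedin_def)
qed

lemma algI: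
  assumes "twisted f" "q ` supp f \<subseteq> K" "compactin (gtop G) K"
  shows "f \<in> alg"
  using assms closed_compactin[OF assms(3,2) q_supp_clopen(2)] by (simp add: alg_iff)

lemma alg_compact: "f \<in> alg \<Longrightarrow> compactin (gtop G) (q ` supp f)"
  by (simp add: alg_iff)

lemma alg_ext:
  assumes "f \<in> alg" "g \<in> alg" "\<And>\<sigma>. \<sigma> \<in> garrows \<Sigma> \<Longrightarrow> f \<sigma> = g \<sigma>"
  shows "f = g"
  using assms by (metis alg_twisted ext twisted_def)

lemma alg_scale:
  assumes "f \<in> alg"
  shows "(\<lambda>\<sigma>. c * f \<sigma>) \<in> alg"
proof (rule algI)
  have f: "twisted f" using assms by (rule alg_twisted)
  show "twisted (\<lambda>\<sigma>. c * f \<sigma>)"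
  proof (rule twistedI)
    fix \<sigma> assume \<sigma>: "\<sigma> \<in> garrows \<Sigma>"
    then show "\<exists>U. openin (gtop \<Sigma>) U \<and> \<sigma> \<in> U \<and> (\<forall>\<tau>\<in>U. c * f \<tau> = c * f \<sigma>)"
      using twisted_open[OF f, of "\<lambda>v. v = f \<sigma>"]
      by (intro exI[of _ "{\<tau> \<in> garrows \<Sigma>. f \<tau> = f \<sigma>}"]) auto
  qed (use f in \<open>auto simp: twisted_def algebra_simps\<close>)
  show "q ` supp (\<lambda>\<sigma>. c * f \<sigma>) \<subseteq> q ` supp f" by (auto simp: supp_def)
qed (use assms in \<open>rule alg_compact\<close>)

section \<open>Characteristic functions of sheets\<close>

text \<open>The sheets are the images of continuous sections of \<open>q\<close> over compact open sets.\<close>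

definition sheet :: "'s set \<Rightarrow> bool" where
  "sheet Z \<longleftrightarrow> openin (gtop \<Sigma>) Z \<and> inj_on q Z \<and> compactin (gtop G) (q ` Z)"

text \<open>The only equivariant function that is 1 on \<open>Z\<close> and 0 off the orbits of \<open>Z\<close>: equivariance forces its
  value at \<open>\<sigma>\<close> to be the unit that moves \<open>\<sigma>\<close> into \<open>Z\<close>, which is unique as the action is free.\<close>

definition char_fun :: "'s set \<Rightarrow> 's \<Rightarrow> 'r" where
  "char_fun Z \<sigma> =
     (if \<sigma> \<in> garrows \<Sigma> \<and> (\<exists>t\<in>ring_units. act t \<sigma> \<in> Z)
      then THE t. t \<in> ring_units \<and> act t \<sigma> \<in> Z else 0)"

lemma sheet_arrows: "sheet Z \<Longrightarrow> Z \<subseteq> garrows \<Sigma>"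
  by (auto simp: sheet_def dest: openin_subset)

lemma char_fun_eqI:
  assumes "sheet Z" "\<sigma> \<in> garrows \<Sigma>" "t \<in> ring_units" "act t \<sigma> \<in> Z"
  shows "char_fun Z \<sigma> = t"
proof -
  have "(THE t. t \<in> ring_units \<and> act t \<sigma> \<in> Z) = t"
  proof (rule the_equality)
    fix u assume u: "u \<in> ring_units \<and> act u \<sigma> \<in> Z"
    then have "act u \<sigma> = act t \<sigma>"
      using assms by (auto simp: sheet_def q_act intro: inj_onD[of q Z])
    then show "u = t" using act_free assms u by blast
  qed (use assms in simp)
  then show ?thesis using assms by (auto simp: char_fun_def)
qed

lemma char_fun_nonzeroE:
  assumes "sheet Z" "char_fun Z \<sigma> \<noteq> 0"
  shows "\<sigma> \<in> garrows \<Sigma>" "char_fun Z \<sigma> \<in> ring_units" "act (char_fun Z \<sigma>) \<sigma> \<in> Z"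
proof -
  obtain t where "\<sigma> \<in> garrows \<Sigma>" "t \<in> ring_units" "act t \<sigma> \<in> Z"
    using assms by (auto simp: char_fun_def split: if_splits)
  then show "\<sigma> \<in> garrows \<Sigma>" "char_fun Z \<sigma> \<in> ring_units" "act (char_fun Z \<sigma>) \<sigma> \<in> Z"
    using char_fun_eqI[OF assms(1)] by auto
qed

lemma char_fun_eq_1: "sheet Z \<Longrightarrow> char_fun Z \<sigma> = 1 \<longleftrightarrow> \<sigma> \<in> Z"
  using char_fun_eqI[of Z \<sigma> 1] char_fun_nonzeroE[of Z \<sigma>] sheet_arrows[of Z]
  by (auto simp: act_one one_ring_units)

lemma q_supp_char_fun:
  assumes Z: "sheet Z"
  shows "q ` supp (char_fun Z) = q ` Z"
proof
  show "q ` supp (char_fun Z) \<subseteq> q ` Z"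
  proof
    fix a assume "a \<in> q ` supp (char_fun Z)"
    then obtain \<sigma> where \<sigma>: "char_fun Z \<sigma> \<noteq> 0" "a = q \<sigma>" by (auto simp: supp_def)
    then have "a = q (act (char_fun Z \<sigma>) \<sigma>)" using char_fun_nonzeroE[OF Z \<sigma>(1)] by (simp add: q_act)
    then show "a \<in> q ` Z" using char_fun_nonzeroE(3)[OF Z \<sigma>(1)] by blast
  qed
  show "q ` Z \<subseteq> q ` supp (char_fun Z)"
  proof (rule image_mono, rule subsetI)
    fix \<sigma> assume "\<sigma> \<in> Z"
    then have "char_fun Z \<sigma> = 1" using char_fun_eq_1[OF Z] by simp
    then show "\<sigma> \<in> supp (char_fun Z)" by (simp add: supp_def)
  qed
qed

lemma char_fun_in_alg:
  assumes Z: "sheet Z"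
  shows "char_fun Z \<in> alg"
proof (rule algI)
  show "compactin (gtop G) (q ` Z)" using Z by (simp add: sheet_def)
  show "q ` supp (char_fun Z) \<subseteq> q ` Z" using q_supp_char_fun[OF Z] by simp
  have closed: "closedin (gtop G) (q ` Z)"
    using Z Hausdorff by (auto simp: sheet_def intro: compactin_imp_closedin)
  show "twisted (char_fun Z)"
  proof (rule twistedI)
    fix \<sigma> assume \<sigma>: "\<sigma> \<in> garrows \<Sigma>"
    show "\<exists>U. openin (gtop \<Sigma>) U \<and> \<sigma> \<in> U \<and> (\<forall>\<tau>\<in>U. char_fun Z \<tau> = char_fun Z \<sigma>)"
    proof (cases "char_fun Z \<sigma> = 0")
      case True
      let ?U = "{\<tau> \<in> garrows \<Sigma>. q \<tau> \<in> garrows G - q ` Z}"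
      have zero: "char_fun Z \<tau> = 0" if "q \<tau> \<notin> q ` Z" for \<tau>
        using that q_supp_char_fun[OF Z] by (auto simp: supp_def)
      have "q \<sigma> \<notin> q ` Z"
      proof
        assume "q \<sigma> \<in> q ` Z"
        then obtain \<tau> where \<tau>: "\<tau> \<in> Z" "q \<sigma> = q \<tau>" by auto
        then obtain t where "t \<in> ring_units" "\<tau> = act t \<sigma>"
          using fibre_orbit[OF \<sigma>] sheet_arrows[OF Z] by blast
        then have "char_fun Z \<sigma> = t" "t \<in> ring_units" using char_fun_eqI[OF Z \<sigma>] \<tau> by auto
        then show False using True by (simp add: ring_units_def)
      qed
      moreover have "openin (gtop \<Sigma>) ?U"
        using closed openin_continuous_map_preimage[OF q_continuous] by blast
      ultimately show ?thesis using \<sigma> True zero q_arrow by (intro exI[of _ ?U]) auto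
    next
      case False
      then obtain t where t: "t \<in> ring_units" "act t \<sigma> \<in> Z"
        using char_fun_nonzeroE[OF Z False] by blast
      have "openin (gtop \<Sigma>) {\<tau> \<in> garrows \<Sigma>. act t \<tau> \<in> Z}"
        using Z openin_continuous_map_preimage[OF continuous_act[OF t(1)]] by (simp add: sheet_def)
      moreover have "char_fun Z \<tau> = t" if "\<tau> \<in> garrows \<Sigma>" "act t \<tau> \<in> Z" for \<tau>
        using char_fun_eqI[OF Z that(1) t(1) that(2)] .
      ultimately show ?thesis
        using t \<sigma> by (intro exI[of _ "{\<tau> \<in> garrows \<Sigma>. act t \<tau> \<in> Z}"]) simp
    qed
  next
    fix t :: 'r and \<sigma> assume t: "t \<in> ring_units" and \<sigma>: "\<sigma> \<in> garrows \<Sigma>"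
    note inv = ring_unit_inverse[OF t]
    show "char_fun Z (act t \<sigma>) = unit_inverse t * char_fun Z \<sigma>"
    proof (cases "char_fun Z \<sigma> = 0")
      case True
      have "char_fun Z (act t \<sigma>) = 0"
      proof (rule ccontr)
        assume "char_fun Z (act t \<sigma>) \<noteq> 0"
        from char_fun_nonzeroE[OF Z this]
        have "char_fun Z \<sigma> = char_fun Z (act t \<sigma>) * t" "char_fun Z (act t \<sigma>) * t \<in> ring_units"
          using char_fun_eqI[OF Z \<sigma>, of "char_fun Z (act t \<sigma>) * t"] t \<sigma>
          by (auto simp: act_act mult_ring_units)
        then show False using True by (simp add: ring_units_def)
      qed
      then show ?thesis using True by simp
    next
      case False
      then have u: "char_fun Z \<sigma> \<in> ring_units" "act (char_fun Z \<sigma>) \<sigma> \<in> Z"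
        using char_fun_nonzeroE[OF Z] by auto
      have "act (unit_inverse t * char_fun Z \<sigma>) (act t \<sigma>) = act (char_fun Z \<sigma>) \<sigma>"
        using u(1) t \<sigma> inv by (simp add: act_act mult_ring_units mult.commute[of _ t] mult.assoc[symmetric])
      then show ?thesis
        using u t \<sigma> inv by (intro char_fun_eqI[OF Z]) (auto simp: act_arrow mult_ring_units)
    qed
  qed (simp add: char_fun_def)
qed

section \<open>Bisection functions\<close>

definition bisection_functions :: "('s \<Rightarrow> 'r) set" where
  "bisection_functions =
     {f \<in> alg. inj_on (grange G) (q ` supp f) \<and> inj_on (gsource G) (q ` supp f) \<and>
        (\<forall>\<sigma>. f \<sigma> \<noteq> 0 \<longrightarrow> f \<sigma> \<in> ring_units)}"

lemma bisection_function_alg: "n \<in> bisection_functions \<Longrightarrow> n \<in> alg"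
  by (simp add: bisection_functions_def)

lemma bisection_function_unit: "n \<in> bisection_functions \<Longrightarrow> n \<sigma> \<noteq> 0 \<Longrightarrow> n \<sigma> \<in> ring_units"
  by (simp add: bisection_functions_def)

lemma bisection_function_q_eq:
  assumes "n \<in> bisection_functions" "n \<sigma> \<noteq> 0" "n \<tau> \<noteq> 0" "rng \<sigma> = rng \<tau> \<or> src \<sigma> = src \<tau>"
  shows "q \<sigma> = q \<tau>"
proof -
  have "q \<sigma> \<in> q ` supp n" "q \<tau> \<in> q ` supp n" using assms by (auto simp: supp_def)
  then show ?thesis using assms by (auto simp: bisection_functions_def dest: inj_onD)
qed

text \<open>The level set of the value 1 meets each orbit of the units at most once, so it is a section of \<open>q\<close>
  over its image.\<close>

lemma value_one_unique:
  assumes "twisted f" "q \<sigma> = q \<tau>" "f \<sigma> = 1" "f \<tau> = 1"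
  shows "\<sigma> = \<tau>"
proof -
  have arr: "\<sigma> \<in> garrows \<Sigma>" "\<tau> \<in> garrows \<Sigma>" using assms supp_arrow[OF assms(1)] by auto
  then obtain t where t: "t \<in> ring_units" "\<tau> = act t \<sigma>" using fibre_orbit assms(2) by blast
  then have "t = 1"
    using assms(3,4) twisted_act[OF assms(1) t(1) arr(1)] ring_unit_inverse[OF t(1)] by simp
  then show ?thesis using t arr by (simp add: act_one)
qed

lemma bisection_function_eq:
  assumes "n \<in> bisection_functions" "n \<sigma> = 1" "n \<tau> = 1" "rng \<sigma> = rng \<tau> \<or> src \<sigma> = src \<tau>"
  shows "\<sigma> = \<tau>"
  using bisection_function_q_eq[OF assms(1) _ _ assms(4)] assms
  by (intro value_one_unique[of n]) (auto simp: bisection_function_alg alg_twisted)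

lemma char_fun_in_bisection_functions:
  "sheet Z \<Longrightarrow> inj_on (grange G) (q ` Z) \<Longrightarrow> inj_on (gsource G) (q ` Z) \<Longrightarrow>
     char_fun Z \<in> bisection_functions"
  unfolding bisection_functions_def using char_fun_nonzeroE
  by (auto simp: char_fun_in_alg q_supp_char_fun)

text \<open>The sheets whose projection is a bisection form a basis of the topology of \<open>\<Sigma>\<close>, and they are the
  level sets of the value 1 of their characteristic functions.\<close>

lemma small_sheet:
  assumes "openin (gtop \<Sigma>) U" "\<sigma> \<in> U"
  obtains Z where "sheet Z" "\<sigma> \<in> Z" "Z \<subseteq> U" "char_fun Z \<in> bisection_functions"
proof -
  have \<sigma>: "\<sigma> \<in> garrows \<Sigma>" using assms openin_subset by blast
  obtain V where V: "openin (gtop \<Sigma>) V" "\<sigma> \<in> V" "inj_on q V"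
    using q_locally_injective[OF \<sigma>] .
  have UV: "openin (gtop \<Sigma>) (U \<inter> V)" using assms V by blast
  then have "openin (gtop G) (q ` (U \<inter> V))" using q_open by (simp add: open_map_def)
  then obtain C where C: "openin (gtop G) C" "compactin (gtop G) C" "q \<sigma> \<in> C" "C \<subseteq> q ` (U \<inter> V)"
    "inj_on (grange G) C" "inj_on (gsource G) C"
    using compact_open_bisection[of "q ` (U \<inter> V)" "q \<sigma>"] assms V by blast
  define Z where "Z = U \<inter> V \<inter> {\<tau> \<in> garrows \<Sigma>. q \<tau> \<in> C}"
  have qZ: "q ` Z = C"
    using C(4) openin_subset[OF UV] unfolding Z_def by blast
  have "openin (gtop \<Sigma>) Z"
    unfolding Z_def using UV openin_continuous_map_preimage[OF q_continuous C(1)] by blast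
  then have "sheet Z"
    using qZ C V by (auto simp: sheet_def Z_def intro: inj_on_subset)
  moreover have "\<sigma> \<in> Z" "Z \<subseteq> U" using \<sigma> assms V C by (auto simp: Z_def)
  ultimately show thesis
    using that char_fun_in_bisection_functions qZ C by auto
qed

section \<open>The diagonal subalgebra\<close>

lemma diag_alg: "d \<in> diag \<Longrightarrow> d \<in> alg"
  by (simp add: diagonal_subalgebra_def)

lemma diag_zero: "d \<in> diag \<Longrightarrow> q \<sigma> \<notin> gunits G \<Longrightarrow> d \<sigma> = 0"
  by (auto simp: diagonal_subalgebra_def supp_def)

lemma diagI: "f \<in> alg \<Longrightarrow> (\<And>\<sigma>. f \<sigma> \<noteq> 0 \<Longrightarrow> q \<sigma> \<in> gunits G) \<Longrightarrow> f \<in> diag"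
  using supp_arrow[of f] by (auto simp: diagonal_subalgebra_def supp_def alg_iff)

lemma sheet_units:
  assumes "openin (gtop G) K" "compactin (gtop G) K" "K \<subseteq> gunits G"
  shows "sheet (unit_over ` K)"
proof -
  have "q ` unit_over ` K = K"
    unfolding image_image using assms q_unit_over by force
  moreover have "inj_on q (unit_over ` K)"
    by (rule inj_on_subset[OF q_inj_units]) (use assms unit_over_unit in blast)
  ultimately show ?thesis
    using assms open_units_over[of K] by (simp add: sheet_def)
qed

lemma char_fun_units:
  assumes "openin (gtop G) K" "compactin (gtop G) K" "K \<subseteq> gunits G"
  shows "char_fun (unit_over ` K) \<in> diag"
    and "x \<in> gunits G \<Longrightarrow> char_fun (unit_over ` K) (unit_over x) = (if x \<in> K then 1 else 0)"
proof -
  let ?Z = "unit_over ` K"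
  note Z = sheet_units[OF assms]
  have qZ: "q ` ?Z = K"
    unfolding image_image using assms q_unit_over by force
  have qs: "q \<sigma> \<in> K" if "char_fun ?Z \<sigma> \<noteq> 0" for \<sigma>
    using that q_supp_char_fun[OF Z] qZ by (auto simp: supp_def)
  show "char_fun ?Z \<in> diag"
    using qs assms by (intro diagI char_fun_in_alg[OF Z]) auto
  show "char_fun ?Z (unit_over x) = (if x \<in> K then 1 else 0)" if "x \<in> gunits G"
    using char_fun_eq_1[OF Z, of "unit_over x"] qs[of "unit_over x"] that by (auto simp: q_unit_over)
qed

lemma conv_outside: "\<sigma> \<notin> garrows \<Sigma> \<Longrightarrow> conv f g \<sigma> = 0"
  by (simp add: steinberg_conv_def)

lemma conv_diag_left:
  assumes d: "d \<in> diag" and f: "f \<in> alg" and \<sigma>: "\<sigma> \<in> garrows \<Sigma>"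
  shows "conv d f \<sigma> = d (unit_over (rng \<sigma>)) * f \<sigma>"
proof -
  let ?x = "rng \<sigma>"
  have x: "?x \<in> gunits G" using rng_src_unit[OF \<sigma>] by simp
  have dt: "twisted d" using d by (simp add: diag_alg alg_twisted)
  have unit: "a \<in> gunits G" "d (unit_over a) \<noteq> 0" if "a \<in> q ` supp d" for a
  proof -
    show a: "a \<in> gunits G" using that d diag_zero by (auto simp: supp_def)
    then show "d (unit_over a) \<noteq> 0"
      using mem_q_supp_iff[OF dt unit_over_arrow[OF a]] that by (simp add: q_unit_over)
  qed
  have "conv d f \<sigma> = (\<Sum>a \<in> {a \<in> q ` supp d. grange G a = ?x}.
      d (unit_over a) * f (gmult \<Sigma> (ginv \<Sigma> (unit_over a)) \<sigma>))"
    using unit by (intro steinberg_conv_section diag_alg d f \<sigma>) (auto simp: supp_def q_unit_over)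
  also have "{a \<in> q ` supp d. grange G a = ?x} = (if d (unit_over ?x) \<noteq> 0 then {?x} else {})"
  proof -
    have "a = ?x" if "a \<in> q ` supp d" "grange G a = ?x" for a
      using base.range_unit[OF unit(1)[OF that(1)]] that(2) by simp
    moreover have "?x \<in> q ` supp d \<longleftrightarrow> d (unit_over ?x) \<noteq> 0"
      using mem_q_supp_iff[OF dt unit_over_arrow[OF x]] by (simp add: q_unit_over[OF x])
    ultimately show ?thesis using base.range_unit[OF x] by (cases "d (unit_over ?x) = 0") force+
  qed
  also have "gmult \<Sigma> (ginv \<Sigma> (unit_over ?x)) \<sigma> = \<sigma>"
    using twist.range_mult_left[OF \<sigma>] range_twist[OF \<sigma>] twist.inv_unit[OF unit_over_unit[OF x]] by simp
  then have "(\<Sum>a \<in> (if d (unit_over ?x) \<noteq> 0 then {?x} else {}).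
      d (unit_over a) * f (gmult \<Sigma> (ginv \<Sigma> (unit_over a)) \<sigma>)) = d (unit_over ?x) * f \<sigma>"
    by simp
  finally show ?thesis .
qed

lemma quotient_of_same_range:
  assumes "\<sigma> \<in> garrows \<Sigma>" "\<tau> \<in> garrows \<Sigma>" "rng \<sigma> = rng \<tau>"
  shows "gmult \<Sigma> (ginv \<Sigma> \<sigma>) \<tau> \<in> garrows \<Sigma>"
    and "q (gmult \<Sigma> (ginv \<Sigma> \<sigma>) \<tau>) = gmult G (ginv G (q \<sigma>)) (q \<tau>)"
    and "(\<sigma>, gmult \<Sigma> (ginv \<Sigma> \<sigma>) \<tau>) \<in> composable \<Sigma>"
    and "gmult \<Sigma> \<sigma> (gmult \<Sigma> (ginv \<Sigma> \<sigma>) \<tau>) = \<tau>"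
proof -
  have c: "(ginv \<Sigma> \<sigma>, \<tau>) \<in> composable \<Sigma>"
    using assms by (simp add: composable_twist_iff twist.inv_closed q_inv base.source_inv q_arrow)
  then show 1: "gmult \<Sigma> (ginv \<Sigma> \<sigma>) \<tau> \<in> garrows \<Sigma>" by (rule twist.mult_closed)
  show "q (gmult \<Sigma> (ginv \<Sigma> \<sigma>) \<tau>) = gmult G (ginv G (q \<sigma>)) (q \<tau>)"
    using q_mult[OF c] assms by (simp add: q_inv)
  show "(\<sigma>, gmult \<Sigma> (ginv \<Sigma> \<sigma>) \<tau>) \<in> composable \<Sigma>"
    using twist.range_mult[OF c] assms 1 by (simp add: twist.composable_iff twist.range_inv)
  show "gmult \<Sigma> \<sigma> (gmult \<Sigma> (ginv \<Sigma> \<sigma>) \<tau>) = \<tau>"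
    using assms by (intro twist.mult_inv_cancel) (auto simp: range_twist)
qed

text \<open>A quotient \<open>a\<^bsup>-1\<^esup> (q \<sigma>)\<close> is a unit only if \<open>a = q \<sigma>\<close>, so a single term of the sum survives.\<close>

lemma conv_diag_right:
  assumes f: "f \<in> alg" and d: "d \<in> diag" and \<sigma>: "\<sigma> \<in> garrows \<Sigma>"
  shows "conv f d \<sigma> = f \<sigma> * d (unit_over (src \<sigma>))"
proof -
  let ?M = "{a \<in> q ` supp f. grange G a = rng \<sigma>}"
  define S where "S a = (if a = q \<sigma> then \<sigma> else inv_into (supp f) q a)" for a
  have ft: "twisted f" using f by (rule alg_twisted)
  have S: "S a \<in> supp f \<and> q (S a) = a" if "a \<in> q ` supp f" for a
    using mem_q_supp_iff[OF ft \<sigma>] inv_into_into[OF that] f_inv_into_f[OF that] that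
    by (cases "a = q \<sigma>") (simp_all add: S_def supp_def[of f])
  have "conv f d \<sigma> = (\<Sum>a \<in> ?M. f (S a) * d (gmult \<Sigma> (ginv \<Sigma> (S a)) \<sigma>))"
    using S by (intro steinberg_conv_section f diag_alg d \<sigma>) auto
  also have "\<dots> = (\<Sum>a \<in> ?M. if a = q \<sigma> then f \<sigma> * d (unit_over (src \<sigma>)) else 0)"
  proof (rule sum.cong[OF refl])
    fix a assume a: "a \<in> ?M"
    then have Sa: "S a \<in> garrows \<Sigma>" "q (S a) = a" "rng (S a) = rng \<sigma>"
      using S supp_arrow[OF ft] by (auto simp: supp_def)
    show "f (S a) * d (gmult \<Sigma> (ginv \<Sigma> (S a)) \<sigma>) =
        (if a = q \<sigma> then f \<sigma> * d (unit_over (src \<sigma>)) else 0)"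
    proof (cases "a = q \<sigma>")
      case True
      then show ?thesis
        using twist.mult_inv_left[OF \<sigma>] source_twist[OF \<sigma>] by (simp add: S_def)
    next
      case False
      have "gmult G (ginv G a) (q \<sigma>) \<notin> gunits G"
      proof
        assume u: "gmult G (ginv G a) (q \<sigma>) \<in> gunits G"
        have arr: "a \<in> garrows G" "q \<sigma> \<in> garrows G" "grange G a = rng \<sigma>"
          using q_arrow[OF Sa(1)] q_arrow[OF \<sigma>] Sa(2,3) by simp_all
        have "ginv G a = ginv G (q \<sigma>)"
          by (rule base.eq_if_mult_inv_unit)
            (simp_all add: arr base.inv_closed base.source_inv base.inv_inv u)
        then have "ginv G (ginv G a) = ginv G (ginv G (q \<sigma>))" by simp
        then show False
          using False base.inv_inv[OF q_arrow[OF \<sigma>]] base.inv_inv[OF q_arrow[OF Sa(1)]] Sa(2) by simp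
      qed
      then have "d (gmult \<Sigma> (ginv \<Sigma> (S a)) \<sigma>) = 0"
        using quotient_of_same_range(2)[OF Sa(1) \<sigma> Sa(3)] Sa by (intro diag_zero[OF d]) simp
      then show ?thesis using False by simp
    qed
  qed
  also have "\<dots> = (if q \<sigma> \<in> ?M then f \<sigma> * d (unit_over (src \<sigma>)) else 0)"
    using finite_range_fibre[OF alg_compact[OF f]] by (simp add: sum.delta)
  also have "\<dots> = f \<sigma> * d (unit_over (src \<sigma>))"
    using mem_q_supp_iff[OF ft \<sigma>] by auto
  finally show ?thesis .
qed

lemma diag_mult_closed:
  assumes d: "d \<in> diag" and f: "f \<in> alg"
  shows "conv d f \<in> alg" "conv f d \<in> alg"
proof -
  have ft: "twisted f" and dt: "twisted d" using f d by (auto simp: alg_twisted diag_alg)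
  have gen: "h \<in> alg" if h0: "\<And>\<sigma>. \<sigma> \<notin> garrows \<Sigma> \<Longrightarrow> h \<sigma> = 0"
    and h: "\<And>\<sigma>. \<sigma> \<in> garrows \<Sigma> \<Longrightarrow> h \<sigma> = d (unit_over (p (q \<sigma>))) * f \<sigma>"
    and p: "continuous_map (gtop \<Sigma>) (unit_space G) (\<lambda>\<sigma>. p (q \<sigma>))" for h p
  proof (rule algI[OF _ _ alg_compact[OF f]])
    show "q ` supp h \<subseteq> q ` supp f" using h h0 by (fastforce simp: supp_def)
    show "twisted h"
    proof (rule twistedI)
      fix \<sigma> assume \<sigma>: "\<sigma> \<in> garrows \<Sigma>"
      have c: "continuous_map (gtop \<Sigma>) (gtop \<Sigma>) (\<lambda>\<sigma>. unit_over (p (q \<sigma>)))"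
        using continuous_map_compose[OF p continuous_unit_over] by (simp add: o_def)
      let ?U = "{\<tau> \<in> garrows \<Sigma>. f \<tau> = f \<sigma>} \<inter>
        {\<tau> \<in> garrows \<Sigma>. unit_over (p (q \<tau>)) \<in> {\<upsilon> \<in> garrows \<Sigma>. d \<upsilon> = d (unit_over (p (q \<sigma>)))}}"
      have "openin (gtop \<Sigma>) ?U"
        using twisted_open[OF ft, of "\<lambda>v. v = f \<sigma>"]
          openin_continuous_map_preimage[OF c twisted_open[OF dt, of "\<lambda>v. v = d (unit_over (p (q \<sigma>)))"]]
        by blast
      moreover have "unit_over (p (q \<sigma>)) \<in> garrows \<Sigma>" using c \<sigma> by (auto simp: continuous_map_def)
      ultimately show "\<exists>U. openin (gtop \<Sigma>) U \<and> \<sigma> \<in> U \<and> (\<forall>\<tau>\<in>U. h \<tau> = h \<sigma>)"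
        using \<sigma> h by (intro exI[of _ ?U]) auto
    next
      fix t :: 'r and \<sigma> assume "t \<in> ring_units" "\<sigma> \<in> garrows \<Sigma>"
      then show "h (act t \<sigma>) = unit_inverse t * h \<sigma>"
        using h twisted_act[OF ft] by (simp add: act_arrow q_act algebra_simps)
    qed (rule h0)
  qed
  show "conv d f \<in> alg"
    by (rule gen[where p = "grange G"])
      (simp_all add: conv_outside conv_diag_left[OF d f] continuous_range_q)
  show "conv f d \<in> alg"
    by (rule gen[where p = "gsource G"])
      (simp_all add: conv_outside conv_diag_right[OF f d] continuous_source_q mult.commute)
qed

lemma diag_commute:
  assumes d: "d \<in> diag" and e: "e \<in> diag"
  shows "conv d e = conv e d"
proof
  fix \<sigma>
  show "conv d e \<sigma> = conv e d \<sigma>"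
  proof (cases "\<sigma> \<in> garrows \<Sigma>")
    case True
    have "e \<sigma> = 0" if "q \<sigma> \<notin> gunits G" using diag_zero[OF e that] .
    then show ?thesis
      using conv_diag_left[OF d diag_alg[OF e] True] conv_diag_right[OF diag_alg[OF e] d True]
      by (cases "q \<sigma> \<in> gunits G") (auto simp: base.range_unit base.source_unit mult.commute)
  qed (simp add: conv_outside)
qed

text \<open>Characteristic functions of compact open sets of units separate a range from a different
  source.\<close>

lemma isotropy_of_commuting:
  assumes f: "f \<in> alg" and comm: "\<And>d. d \<in> diag \<Longrightarrow> conv d f = conv f d" and \<sigma>: "f \<sigma> \<noteq> 0"
  shows "rng \<sigma> = src \<sigma>"
proof (rule ccontr)
  assume ne: "rng \<sigma> \<noteq> src \<sigma>"
  have arr: "\<sigma> \<in> garrows \<Sigma>" using \<sigma> f supp_arrow alg_twisted by blast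
  note u = rng_src_unit[OF arr]
  obtain K where K: "openin (gtop G) K" "compactin (gtop G) K" "K \<subseteq> gunits G" "rng \<sigma> \<in> K" "src \<sigma> \<notin> K"
    using separating_compact_open[OF u ne] .
  note d = char_fun_units[OF K(1-3)]
  show False
    using comm[OF d(1)] conv_diag_left[OF d(1) f arr] conv_diag_right[OF f d(1) arr]
      d(2)[OF u(1)] d(2)[OF u(2)] K \<sigma> by simp
qed

text \<open>The support projects to an open set of isotropy, hence into its interior, the unit space.\<close>

lemma diag_maximal_commutative:
  assumes eff: "effective_groupoid G" and f: "f \<in> alg"
    and comm: "\<And>d. d \<in> diag \<Longrightarrow> conv d f = conv f d"
  shows "f \<in> diag"
proof (rule diagI[OF f])
  fix \<sigma> assume \<sigma>: "f \<sigma> \<noteq> 0"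
  have ft: "twisted f" using f by (rule alg_twisted)
  have "q ` supp f \<subseteq> isotropy G"
    using isotropy_of_commuting[OF f comm] supp_arrow[OF ft] q_arrow
    by (auto simp: isotropy_def supp_def)
  then have "q ` supp f \<subseteq> gtop G interior_of isotropy G"
    using q_supp_clopen(1)[OF ft] by (intro interior_of_maximal)
  then show "q \<sigma> \<in> gunits G"
    using eff \<sigma> by (auto simp: effective_groupoid_def supp_def)
qed

text \<open>A sheet over an open set of isotropy has a characteristic function that commutes with the diagonal;
  if this puts the function into the diagonal, the open set consists of units.\<close>

lemma effectiveI:
  assumes masa: "\<And>f. f \<in> alg \<Longrightarrow> (\<And>d. d \<in> diag \<Longrightarrow> conv d f = conv f d) \<Longrightarrow> f \<in> diag"
  shows "effective_groupoid G"
  unfolding effective_groupoid_def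
proof
  have "gunits G \<subseteq> isotropy G"
    using base.units_arrows by (auto simp: isotropy_def base.range_unit base.source_unit)
  then show "gunits G \<subseteq> gtop G interior_of isotropy G"
    using etale_open_units[OF etale] by (intro interior_of_maximal)
  show "gtop G interior_of isotropy G \<subseteq> gunits G"
  proof
    fix a assume a: "a \<in> gtop G interior_of isotropy G"
    then have "a \<in> garrows G" using interior_of_subset_topspace[of "gtop G"] by blast
    then obtain \<sigma> where \<sigma>: "\<sigma> \<in> garrows \<Sigma>" "q \<sigma> = a" by (metis arrow_over)
    have "openin (gtop \<Sigma>) {\<tau> \<in> garrows \<Sigma>. q \<tau> \<in> gtop G interior_of isotropy G}"
      by (rule openin_continuous_map_preimage[OF q_continuous openin_interior_of])
    moreover have "\<sigma> \<in> {\<tau> \<in> garrows \<Sigma>. q \<tau> \<in> gtop G interior_of isotropy G}"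
      using \<sigma> a by simp
    ultimately obtain Z where Z: "sheet Z" "\<sigma> \<in> Z"
      "Z \<subseteq> {\<tau> \<in> garrows \<Sigma>. q \<tau> \<in> gtop G interior_of isotropy G}"
      by (rule small_sheet)
    have iso: "rng \<tau> = src \<tau>" if "char_fun Z \<tau> \<noteq> 0" for \<tau>
    proof -
      have "q \<tau> \<in> q ` Z" using q_supp_char_fun[OF Z(1)] that by (auto simp: supp_def)
      then have "q \<tau> \<in> isotropy G" using Z(3) interior_of_subset by fastforce
      then show ?thesis by (simp add: isotropy_def)
    qed
    have f: "char_fun Z \<in> alg" by (rule char_fun_in_alg[OF Z(1)])
    have "char_fun Z \<in> diag"
    proof (rule masa[OF f])
      fix d assume d: "d \<in> diag"
      show "conv d (char_fun Z) = conv (char_fun Z) d"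
      proof (rule alg_ext)
        fix \<tau> assume "\<tau> \<in> garrows \<Sigma>"
        then show "conv d (char_fun Z) \<tau> = conv (char_fun Z) d \<tau>"
          using conv_diag_left[OF d f] conv_diag_right[OF f d] iso[of \<tau>]
          by (cases "char_fun Z \<tau> = 0") (auto simp: mult.commute)
      qed (use diag_mult_closed[OF d f] in auto)
    qed
    moreover have "char_fun Z \<sigma> = 1" using char_fun_eq_1[OF Z(1)] Z(2) by simp
    ultimately show "a \<in> gunits G" using diag_zero[of "char_fun Z" \<sigma>] \<sigma> by auto
  qed
qed

end

section \<open>Products of bisection functions\<close>

context ample_twist
begin

text \<open>When ranges are injective on the support of \<open>n\<close>, the only term of the sum belongs to \<open>\<sigma>\<close> itself.\<close>

lemma conv_section:
  assumes n: "n \<in> alg" and m: "m \<in> alg" and inj: "inj_on (grange G) (q ` supp n)"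
    and c: "(\<sigma>, \<tau>) \<in> composable \<Sigma>" and \<sigma>: "n \<sigma> \<noteq> 0"
  shows "conv n m (gmult \<Sigma> \<sigma> \<tau>) = n \<sigma> * m \<tau>"
proof -
  define S where "S a = (if a = q \<sigma> then \<sigma> else inv_into (supp n) q a)" for a
  have arr: "\<sigma> \<in> garrows \<Sigma>" "\<tau> \<in> garrows \<Sigma>" using c by (auto simp: composable_twist_iff)
  have S: "S a \<in> supp n \<and> q (S a) = a" if "a \<in> q ` supp n" for a
    using inv_into_into[OF that] f_inv_into_f[OF that] \<sigma>
    by (cases "a = q \<sigma>") (simp_all add: S_def supp_def[of n])
  have r: "rng (gmult \<Sigma> \<sigma> \<tau>) = rng \<sigma>"
    using c arr by (simp add: q_mult base.range_mult base.composable_iff composable_twist_iff q_arrow)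
  have "q \<sigma> \<in> q ` supp n" using \<sigma> by (simp add: supp_def)
  then have set: "{a \<in> q ` supp n. grange G a = rng (gmult \<Sigma> \<sigma> \<tau>)} = {q \<sigma>}"
    using inj r by (auto dest: inj_onD)
  have "conv n m (gmult \<Sigma> \<sigma> \<tau>) = (\<Sum>a \<in> {a \<in> q ` supp n. grange G a = rng (gmult \<Sigma> \<sigma> \<tau>)}.
      n (S a) * m (gmult \<Sigma> (ginv \<Sigma> (S a)) (gmult \<Sigma> \<sigma> \<tau>)))"
    using S by (intro steinberg_conv_section n m twist.mult_closed[OF c]) auto
  also have "\<dots> = n \<sigma> * m (gmult \<Sigma> (ginv \<Sigma> \<sigma>) (gmult \<Sigma> \<sigma> \<tau>))"
    unfolding set by (simp add: S_def)
  also have "gmult \<Sigma> (ginv \<Sigma> \<sigma>) (gmult \<Sigma> \<sigma> \<tau>) = \<tau>"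
    using c by (intro twist.inv_mult_cancel) (auto simp: twist.composable_iff)
  finally show ?thesis .
qed

lemma conv_nonzeroE:
  assumes "n \<in> alg" "conv n m \<upsilon> \<noteq> 0"
  obtains \<sigma> \<tau> where "(\<sigma>, \<tau>) \<in> composable \<Sigma>" "\<upsilon> = gmult \<Sigma> \<sigma> \<tau>" "n \<sigma> \<noteq> 0" "m \<tau> \<noteq> 0"
proof -
  have \<upsilon>: "\<upsilon> \<in> garrows \<Sigma>" using assms conv_outside by blast
  obtain a where a: "a \<in> q ` supp n" "grange G a = rng \<upsilon>"
    and ne: "n (inv_into (supp n) q a) * m (gmult \<Sigma> (ginv \<Sigma> (inv_into (supp n) q a)) \<upsilon>) \<noteq> 0"
  proof (rule sum.not_neutral_contains_not_neutral)
    show "(\<Sum>a \<in> {a \<in> q ` supp n. grange G a = rng \<upsilon>}. n (inv_into (supp n) q a) *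
        m (gmult \<Sigma> (ginv \<Sigma> (inv_into (supp n) q a)) \<upsilon>)) \<noteq> 0"
      using assms(2) \<upsilon> by (simp add: steinberg_conv_def)
  qed blast
  let ?\<sigma> = "inv_into (supp n) q a"
  have \<sigma>: "?\<sigma> \<in> garrows \<Sigma>" "rng ?\<sigma> = rng \<upsilon>"
    using inv_into_into[OF a(1)] f_inv_into_f[OF a(1)] a(2) supp_arrow[OF alg_twisted[OF assms(1)]]
    by (auto simp: supp_def)
  show thesis
    using that[OF quotient_of_same_range(3)[OF \<sigma>(1) \<upsilon> \<sigma>(2)]]
      quotient_of_same_range(4)[OF \<sigma>(1) \<upsilon> \<sigma>(2)] ne by fastforce
qed

lemma normalized_arrow:
  assumes "n \<in> bisection_functions" "n \<sigma> \<noteq> 0"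
  shows "n (act (n \<sigma>) \<sigma>) = 1" "act (n \<sigma>) \<sigma> \<in> garrows \<Sigma>" "q (act (n \<sigma>) \<sigma>) = q \<sigma>"
proof -
  have t: "n \<sigma> \<in> ring_units" "\<sigma> \<in> garrows \<Sigma>"
    using assms bisection_function_unit supp_arrow alg_twisted bisection_function_alg by blast+
  then show "n (act (n \<sigma>) \<sigma>) = 1" "act (n \<sigma>) \<sigma> \<in> garrows \<Sigma>" "q (act (n \<sigma>) \<sigma>) = q \<sigma>"
    using twisted_act[OF alg_twisted[OF bisection_function_alg[OF assms(1)]] t] ring_unit_inverse[OF t(1)]
    by (simp_all add: act_arrow q_act)
qed

lemma mult_rng_src:
  assumes "(\<sigma>, \<tau>) \<in> composable \<Sigma>"
  shows "rng (gmult \<Sigma> \<sigma> \<tau>) = rng \<sigma>" "src (gmult \<Sigma> \<sigma> \<tau>) = src \<tau>" "src \<sigma> = rng \<tau>"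
  using assms by (auto simp: q_mult base.range_mult base.source_mult base.composable_iff
      composable_twist_iff q_arrow)

text \<open>On the ranges of the support of \<open>n\<close> the product is \<open>m\<close> composed with the continuous left
  division by the arrows on which \<open>n\<close> is 1; off these ranges, which form a compact open set, it
  vanishes.\<close>

lemma conv_in_bisection_functions:
  assumes n: "n \<in> bisection_functions" and m: "m \<in> bisection_functions"
  shows "conv n m \<in> bisection_functions"
proof -
  have na: "n \<in> alg" and ma: "m \<in> alg" using n m by (simp_all add: bisection_function_alg)
  have nt: "twisted n" and mt: "twisted m" using na ma by (simp_all add: alg_twisted)
  have inj: "inj_on (grange G) (q ` supp n)" using n by (simp add: bisection_functions_def)
  note split = conv_section[OF na ma inj]
  define Z where "Z = {\<sigma> \<in> garrows \<Sigma>. n \<sigma> = 1}"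
  have Z: "openin (gtop \<Sigma>) Z" unfolding Z_def using nt by (rule twisted_open)
  have rZ: "rng z = rng \<sigma>" if "z \<in> garrows \<Sigma>" "\<sigma> \<in> garrows \<Sigma>" "grange \<Sigma> z = grange \<Sigma> \<sigma>" for z \<sigma>
    using that q_range_source(1) by metis
  have injZ: "inj_on (grange \<Sigma>) Z"
  proof (rule inj_onI)
    fix \<sigma> \<tau> assume st: "\<sigma> \<in> Z" "\<tau> \<in> Z" "grange \<Sigma> \<sigma> = grange \<Sigma> \<tau>"
    then show "\<sigma> = \<tau>" using rZ bisection_function_eq[OF n, of \<sigma> \<tau>] by (simp add: Z_def)
  qed
  let ?dom = "{\<sigma> \<in> garrows \<Sigma>. grange \<Sigma> \<sigma> \<in> grange \<Sigma> ` Z}"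
  let ?z = "\<lambda>\<sigma>. inv_into Z (grange \<Sigma>) (grange \<Sigma> \<sigma>)"
  let ?dv = "\<lambda>\<sigma>. gmult \<Sigma> (ginv \<Sigma> (?z \<sigma>)) \<sigma>"
  note div = twist.continuous_left_division[OF open_range_twist Z injZ]
  have in_dom: "conv n m \<sigma> = m (?dv \<sigma>)" "(?z \<sigma>, ?dv \<sigma>) \<in> composable \<Sigma>"
      "gmult \<Sigma> (?z \<sigma>) (?dv \<sigma>) = \<sigma>" if "\<sigma> \<in> ?dom" for \<sigma>
  proof -
    have "grange \<Sigma> \<sigma> \<in> grange \<Sigma> ` Z" using that by simp
    from inv_into_into[OF this] f_inv_into_f[OF this]
    have z: "?z \<sigma> \<in> garrows \<Sigma>" "n (?z \<sigma>) = 1" "rng (?z \<sigma>) = rng \<sigma>"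
      using rZ that by (auto simp: Z_def)
    have \<sigma>: "\<sigma> \<in> garrows \<Sigma>" using that by simp
    note qq = quotient_of_same_range[OF z(1) \<sigma> z(3)]
    then show "(?z \<sigma>, ?dv \<sigma>) \<in> composable \<Sigma>" "gmult \<Sigma> (?z \<sigma>) (?dv \<sigma>) = \<sigma>" by simp_all
    show "conv n m \<sigma> = m (?dv \<sigma>)" using split[OF qq(3)] z(2) qq(4) by simp
  qed
  have dom_iff: "\<sigma> \<in> ?dom \<longleftrightarrow> rng \<sigma> \<in> grange G ` q ` supp n" if \<sigma>: "\<sigma> \<in> garrows \<Sigma>" for \<sigma>
  proof
    assume "\<sigma> \<in> ?dom"
    then obtain z where "z \<in> Z" "grange \<Sigma> \<sigma> = grange \<Sigma> z" by auto
    then have "rng \<sigma> = rng z" "n z \<noteq> 0" using rZ[of z \<sigma>] \<sigma> by (auto simp: Z_def)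
    then show "rng \<sigma> \<in> grange G ` q ` supp n" by (auto simp: supp_def)
  next
    assume "rng \<sigma> \<in> grange G ` q ` supp n"
    then obtain \<tau> where \<tau>: "n \<tau> \<noteq> 0" "rng \<sigma> = rng \<tau>" by (auto simp: supp_def)
    let ?\<tau>' = "act (n \<tau>) \<tau>"
    have "?\<tau>' \<in> Z" "grange \<Sigma> ?\<tau>' = grange \<Sigma> \<sigma>"
      using normalized_arrow[OF n \<tau>(1)] \<sigma> \<tau>(2) by (simp_all add: Z_def range_twist)
    then show "\<sigma> \<in> ?dom" using \<sigma> by (metis (mono_tags, lifting) imageI mem_Collect_eq)
  qed
  have out_dom: "conv n m \<sigma> = 0" if "\<sigma> \<in> garrows \<Sigma>" "\<sigma> \<notin> ?dom" for \<sigma>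
  proof (rule ccontr)
    assume "conv n m \<sigma> \<noteq> 0"
    then obtain \<sigma>1 \<sigma>2 where "(\<sigma>1, \<sigma>2) \<in> composable \<Sigma>" "\<sigma> = gmult \<Sigma> \<sigma>1 \<sigma>2" "n \<sigma>1 \<noteq> 0"
      by (rule conv_nonzeroE[OF na])
    then have "rng \<sigma> = rng \<sigma>1" "q \<sigma>1 \<in> q ` supp n" by (simp_all add: mult_rng_src supp_def)
    then show False using that dom_iff by simp
  qed
  have tw: "twisted (conv n m)"
  proof (rule twistedI)
    fix \<sigma> assume \<sigma>: "\<sigma> \<in> garrows \<Sigma>"
    show "\<exists>U. openin (gtop \<Sigma>) U \<and> \<sigma> \<in> U \<and> (\<forall>\<tau>\<in>U. conv n m \<tau> = conv n m \<sigma>)"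
    proof (cases "\<sigma> \<in> ?dom")
      case True
      let ?U = "{\<tau> \<in> topspace (subtopology (gtop \<Sigma>) ?dom). ?dv \<tau> \<in> {\<upsilon> \<in> garrows \<Sigma>. m \<upsilon> = m (?dv \<sigma>)}}"
      have "openin (gtop \<Sigma>) ?U"
        using openin_continuous_map_preimage[OF div(2) twisted_open[OF mt]] div(1)
        by (rule openin_trans_full)
      moreover have "?dv \<sigma> \<in> garrows \<Sigma>" using in_dom(2)[OF True] by (simp add: composable_twist_iff)
      then have "\<sigma> \<in> ?U" using True by simp
      moreover have "\<forall>\<tau>\<in>?U. conv n m \<tau> = conv n m \<sigma>"
      proof
        fix \<tau> assume \<tau>: "\<tau> \<in> ?U"
        then have "\<tau> \<in> ?dom" by simp
        then show "conv n m \<tau> = conv n m \<sigma>" using \<tau> in_dom(1)[OF True] in_dom(1)[of \<tau>] by simp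
      qed
      ultimately show ?thesis by blast
    next
      case False
      let ?W = "grange G ` q ` supp n"
      let ?U = "{\<tau> \<in> garrows \<Sigma>. rng \<tau> \<in> gunits G - ?W}"
      have W: "compactin (gtop G) ?W" "?W \<subseteq> gunits G"
        using image_compact_open(5,6)[OF q_supp_clopen(1)[OF nt] alg_compact[OF na]] .
      then have "closedin (unit_space G) ?W"
        using base.Hausdorff_units by (intro compactin_imp_closedin) (auto simp: compactin_subtopology)
      then have "openin (unit_space G) (gunits G - ?W)"
        using base.topspace_unit_space by (metis openin_diff openin_topspace)
      then have "openin (gtop \<Sigma>) ?U"
        by (rule openin_continuous_map_preimage[OF continuous_range_q])
      moreover have "\<sigma> \<in> ?U" using \<sigma> False dom_iff rng_src_unit by auto
      moreover have "\<forall>\<tau>\<in>?U. conv n m \<tau> = conv n m \<sigma>"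
        using out_dom[OF \<sigma> False] out_dom dom_iff by auto
      ultimately show ?thesis by blast
    qed
  next
    fix t :: 'r and \<sigma> assume t: "t \<in> ring_units" and \<sigma>: "\<sigma> \<in> garrows \<Sigma>"
    have same: "act t \<sigma> \<in> ?dom \<longleftrightarrow> \<sigma> \<in> ?dom"
      using dom_iff[OF \<sigma>] dom_iff[OF act_arrow[OF \<sigma> t]] by (simp add: q_act[OF \<sigma> t])
    show "conv n m (act t \<sigma>) = unit_inverse t * conv n m \<sigma>"
    proof (cases "\<sigma> \<in> ?dom")
      case True
      note d = in_dom[OF True]
      have arr: "?dv \<sigma> \<in> garrows \<Sigma>" "?z \<sigma> \<in> garrows \<Sigma>" using d(2) by (simp_all add: composable_twist_iff)
      have c: "(?z \<sigma>, act t (?dv \<sigma>)) \<in> composable \<Sigma>"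
        using d(2) arr t by (simp add: composable_twist_iff act_arrow q_act)
      have "?z \<sigma> \<in> Z" using True by (auto intro: inv_into_into)
      then have "n (?z \<sigma>) = 1" by (simp add: Z_def)
      then have "conv n m (gmult \<Sigma> (?z \<sigma>) (act t (?dv \<sigma>))) = m (act t (?dv \<sigma>))"
        using split[OF c] by simp
      also have "\<dots> = unit_inverse t * conv n m \<sigma>" using twisted_act[OF mt t arr(1)] d(1) by simp
      finally show ?thesis using act_mult_right[OF d(2) t] d(3) by simp
    next
      case False
      then have "act t \<sigma> \<notin> ?dom" using same by blast
      from out_dom[OF act_arrow[OF \<sigma> t] this] out_dom[OF \<sigma> False] show ?thesis by simp
    qed
  qed (rule conv_outside)
  have alg: "conv n m \<in> alg"
  proof (rule algI[OF tw])
    show "compactin (gtop G)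
        {gmult G a b | a b. a \<in> q ` supp n \<and> b \<in> q ` supp m \<and> gsource G a = grange G b}"
      using alg_compact[OF na] alg_compact[OF ma] by (rule base.compact_mult)
    show "q ` supp (conv n m) \<subseteq>
        {gmult G a b | a b. a \<in> q ` supp n \<and> b \<in> q ` supp m \<and> gsource G a = grange G b}"
    proof
      fix a assume "a \<in> q ` supp (conv n m)"
      then obtain \<upsilon> where \<upsilon>: "conv n m \<upsilon> \<noteq> 0" "a = q \<upsilon>" by (auto simp: supp_def)
      obtain \<sigma> \<tau> where st: "(\<sigma>, \<tau>) \<in> composable \<Sigma>" "\<upsilon> = gmult \<Sigma> \<sigma> \<tau>" "n \<sigma> \<noteq> 0" "m \<tau> \<noteq> 0"
        using conv_nonzeroE[OF na \<upsilon>(1)] .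
      then have "a = gmult G (q \<sigma>) (q \<tau>)" "q \<sigma> \<in> q ` supp n" "q \<tau> \<in> q ` supp m" "src \<sigma> = rng \<tau>"
        using \<upsilon> by (simp_all add: q_mult supp_def composable_twist_iff)
      then show "a \<in> {gmult G a b | a b. a \<in> q ` supp n \<and> b \<in> q ` supp m \<and> gsource G a = grange G b}"
        by blast
    qed
  qed
  have q_eq: "q \<upsilon> = q \<upsilon>'"
    if ne: "conv n m \<upsilon> \<noteq> 0" "conv n m \<upsilon>' \<noteq> 0" and rs: "rng \<upsilon> = rng \<upsilon>' \<or> src \<upsilon> = src \<upsilon>'" for \<upsilon> \<upsilon>'
  proof -
    obtain \<sigma> \<tau> where st: "(\<sigma>, \<tau>) \<in> composable \<Sigma>" "\<upsilon> = gmult \<Sigma> \<sigma> \<tau>" "n \<sigma> \<noteq> 0" "m \<tau> \<noteq> 0"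
      using conv_nonzeroE[OF na ne(1)] .
    obtain \<sigma>' \<tau>' where st': "(\<sigma>', \<tau>') \<in> composable \<Sigma>" "\<upsilon>' = gmult \<Sigma> \<sigma>' \<tau>'" "n \<sigma>' \<noteq> 0" "m \<tau>' \<noteq> 0"
      using conv_nonzeroE[OF na ne(2)] .
    note r = mult_rng_src[OF st(1)] mult_rng_src[OF st'(1)]
    have "q \<sigma> = q \<sigma>' \<and> q \<tau> = q \<tau>'"
      using rs
    proof
      assume "rng \<upsilon> = rng \<upsilon>'"
      then have "q \<sigma> = q \<sigma>'" using bisection_function_q_eq[OF n st(3) st'(3)] r st(2) st'(2) by simp
      then show ?thesis using bisection_function_q_eq[OF m st(4) st'(4)] r by simp
    next
      assume "src \<upsilon> = src \<upsilon>'"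
      then have "q \<tau> = q \<tau>'" using bisection_function_q_eq[OF m st(4) st'(4)] r st(2) st'(2) by simp
      then show ?thesis using bisection_function_q_eq[OF n st(3) st'(3)] r by simp
    qed
    then show ?thesis using q_mult[OF st(1)] q_mult[OF st'(1)] st(2) st'(2) by simp
  qed
  have "conv n m \<upsilon> \<in> ring_units" if ne: "conv n m \<upsilon> \<noteq> 0" for \<upsilon>
  proof -
    obtain \<sigma> \<tau> where st: "(\<sigma>, \<tau>) \<in> composable \<Sigma>" "\<upsilon> = gmult \<Sigma> \<sigma> \<tau>" "n \<sigma> \<noteq> 0" "m \<tau> \<noteq> 0"
      using conv_nonzeroE[OF na ne(1)] .
    then show ?thesis
      using split[OF st(1,3)] bisection_function_unit[OF n] bisection_function_unit[OF m]
      by (simp add: mult_ring_units)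
  qed
  then show ?thesis
    using alg q_eq by (auto simp: bisection_functions_def inj_on_def supp_def)
qed

text \<open>The units by which the two factors miss the value 1 are inverse to each other, so moving one from the
  first factor to the second does not change the product.\<close>

lemma conv_bisection_eq_1:
  assumes n: "n \<in> bisection_functions" and m: "m \<in> bisection_functions" and "conv n m \<upsilon> = 1"
  obtains \<sigma> \<tau> where "(\<sigma>, \<tau>) \<in> composable \<Sigma>" "\<upsilon> = gmult \<Sigma> \<sigma> \<tau>" "n \<sigma> = 1" "m \<tau> = 1"
proof -
  have na: "n \<in> alg" and ma: "m \<in> alg" using n m by (simp_all add: bisection_function_alg)
  have "conv n m \<upsilon> \<noteq> 0" using assms by simp
  then obtain \<sigma> \<tau> where st: "(\<sigma>, \<tau>) \<in> composable \<Sigma>" "\<upsilon> = gmult \<Sigma> \<sigma> \<tau>" "n \<sigma> \<noteq> 0" "m \<tau> \<noteq> 0"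
    by (rule conv_nonzeroE[OF na])
  let ?t = "n \<sigma>" and ?u = "unit_inverse (n \<sigma>)"
  have t: "?t \<in> ring_units" using bisection_function_unit[OF n st(3)] .
  note u = ring_unit_inverse[OF t]
  have arr: "\<sigma> \<in> garrows \<Sigma>" "\<tau> \<in> garrows \<Sigma>" using st(1) by (simp_all add: composable_twist_iff)
  have uu: "unit_inverse ?u = ?t" using u by (intro unit_inverse_eq) simp
  have "n \<sigma> * m \<tau> = 1"
    using conv_section[OF na ma _ st(1,3)] n assms(3) st(2) by (simp add: bisection_functions_def)
  then have "m (act ?u \<tau>) = 1"
    using twisted_act[OF alg_twisted[OF ma] u(3) arr(2)] uu by simp
  moreover have c: "(act ?t \<sigma>, act ?u \<tau>) \<in> composable \<Sigma>"
    using st(1) t u(3) by (simp add: composable_twist_iff act_arrow q_act)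
  moreover have "gmult \<Sigma> (act ?t \<sigma>) (act ?u \<tau>) = \<upsilon>"
  proof -
    have c': "(\<sigma>, act ?u \<tau>) \<in> composable \<Sigma>"
      using st(1) u(3) by (simp add: composable_twist_iff act_arrow q_act)
    have "gmult \<Sigma> (act ?t \<sigma>) (act ?u \<tau>) = act ?t (act ?u (gmult \<Sigma> \<sigma> \<tau>))"
      using act_mult_left[OF c' t] act_mult_right[OF st(1) u(3)] by simp
    also have "\<dots> = \<upsilon>"
      using act_act[OF twist.mult_closed[OF st(1)] t u(3)] act_one[OF twist.mult_closed[OF st(1)]]
        u(1) st(2) by simp
    finally show ?thesis .
  qed
  ultimately show thesis using that normalized_arrow(1)[OF n st(3)] by metis
qed

section \<open>Idempotents of the diagonal\<close>

definition idempotents :: "('s \<Rightarrow> 'r) set" where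
  "idempotents = {d \<in> diag. conv d d = d}"

lemma idempotent_diag: "d \<in> idempotents \<Longrightarrow> d \<in> diag"
  by (simp add: idempotents_def)

text \<open>The value at a unit is an idempotent of the ring.\<close>

lemma idempotent_value:
  assumes "indecomposable_ring TYPE('r)" "d \<in> idempotents" "x \<in> gunits G"
  shows "d (unit_over x) = 0 \<or> d (unit_over x) = 1"
proof -
  have d: "d \<in> diag" "conv d d = d" using assms by (auto simp: idempotents_def)
  have "d (unit_over x) * d (unit_over x) = d (unit_over x)"
    using conv_diag_left[OF d(1) diag_alg[OF d(1)] unit_over_arrow[OF assms(3)]] d(2) assms(3)
    by (simp add: q_unit_over base.range_unit)
  then show ?thesis using assms(1) unfolding indecomposable_ring_def by blast
qed

lemma char_fun_units_idempotent:
  assumes K: "openin (gtop G) K" "compactin (gtop G) K" "K \<subseteq> gunits G"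
  shows "char_fun (unit_over ` K) \<in> idempotents"
proof -
  let ?e = "char_fun (unit_over ` K)"
  note e = char_fun_units[OF K]
  have "conv ?e ?e = ?e"
  proof (rule alg_ext)
    fix \<sigma> assume \<sigma>: "\<sigma> \<in> garrows \<Sigma>"
    have "?e (unit_over (rng \<sigma>)) = 1" if "?e \<sigma> \<noteq> 0"
    proof -
      have "q \<sigma> \<in> q ` unit_over ` K"
        using q_supp_char_fun[OF sheet_units[OF K]] that by (auto simp: supp_def)
      then have "q \<sigma> \<in> K" using K q_unit_over by force
      then show ?thesis using e(2)[of "rng \<sigma>"] K base.range_unit[of "q \<sigma>"] by auto
    qed
    then show "conv ?e ?e \<sigma> = ?e \<sigma>"
      using conv_diag_left[OF e(1) diag_alg[OF e(1)] \<sigma>] by (cases "?e \<sigma> = 0") auto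
  qed (use e diag_alg diag_mult_closed in auto)
  then show ?thesis using e by (simp add: idempotents_def)
qed

text \<open>An idempotent \<open>e\<close> restricts \<open>n\<close> to the arrows whose range (source) lies in some set; as \<open>n\<close> lives on a
  bisection, the same restriction is given by the set of the sources (ranges) that remain.\<close>

lemma idempotent_exchange:
  assumes ind: "indecomposable_ring TYPE('r)" and n: "n \<in> bisection_functions" and e: "e \<in> idempotents"
  shows "\<exists>d \<in> idempotents. conv e n = conv n d"
    and "\<exists>d \<in> idempotents. conv n e = conv d n"
proof -
  have na: "n \<in> alg" and ed: "e \<in> diag" using n e by (simp_all add: bisection_function_alg idempotent_diag)
  note vals = idempotent_value[OF ind e]
  have orbit: "q \<sigma> \<in> q ` supp g"
    if "\<tau> \<in> supp g" "rng \<sigma> = rng \<tau> \<or> src \<sigma> = src \<tau>" "n \<sigma> \<noteq> 0" "\<And>\<tau>. g \<tau> \<noteq> 0 \<Longrightarrow> n \<tau> \<noteq> 0" for \<sigma> \<tau> g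
    using bisection_function_q_eq[OF n that(3) _ that(2)] that(1,4) by (auto simp: supp_def)
  show "\<exists>d \<in> idempotents. conv e n = conv n d"
  proof -
    let ?g = "conv e n"
    have g: "?g \<in> alg" using diag_mult_closed[OF ed na] by simp
    have gs: "?g \<sigma> = e (unit_over (rng \<sigma>)) * n \<sigma>" if "\<sigma> \<in> garrows \<Sigma>" for \<sigma>
      using conv_diag_left[OF ed na that] .
    have gn: "n \<tau> \<noteq> 0" if "?g \<tau> \<noteq> 0" for \<tau>
      using gs[of \<tau>] that by (cases "\<tau> \<in> garrows \<Sigma>") (auto simp: conv_outside)
    let ?K = "gsource G ` q ` supp ?g"
    note K = image_compact_open(1-3)[OF q_supp_clopen(1)[OF alg_twisted[OF g]] alg_compact[OF g]]
    note d = char_fun_units[OF K]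
    have "?g = conv n (char_fun (unit_over ` ?K))"
    proof (rule alg_ext[OF g])
      show "conv n (char_fun (unit_over ` ?K)) \<in> alg" using diag_mult_closed[OF d(1) na] by simp
      fix \<sigma> assume \<sigma>: "\<sigma> \<in> garrows \<Sigma>"
      have "?g \<sigma> = n \<sigma> \<and> (?g \<sigma> \<noteq> 0 \<longrightarrow> src \<sigma> \<in> ?K) \<or> ?g \<sigma> = 0 \<and> (n \<sigma> \<noteq> 0 \<longrightarrow> src \<sigma> \<notin> ?K)"
      proof (cases "?g \<sigma> = 0")
        case True
        have "src \<sigma> \<notin> ?K" if "n \<sigma> \<noteq> 0"
        proof
          assume "src \<sigma> \<in> ?K"
          then obtain \<tau> where "\<tau> \<in> supp ?g" "src \<sigma> = src \<tau>" by auto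
          then have "q \<sigma> \<in> q ` supp ?g" using orbit that gn by blast
          then show False using True mem_q_supp_iff[OF alg_twisted[OF g] \<sigma>] by simp
        qed
        then show ?thesis using True by simp
      next
        case False
        then show ?thesis using gs[OF \<sigma>] vals[OF rng_src_unit(1)[OF \<sigma>]] by (auto simp: supp_def)
      qed
      then show "?g \<sigma> = conv n (char_fun (unit_over ` ?K)) \<sigma>"
        using conv_diag_right[OF na d(1) \<sigma>] d(2)[OF rng_src_unit(2)[OF \<sigma>]] by auto
    qed
    then show ?thesis using char_fun_units_idempotent[OF K] by blast
  qed
  show "\<exists>d \<in> idempotents. conv n e = conv d n"
  proof -
    let ?g = "conv n e"
    have g: "?g \<in> alg" using diag_mult_closed[OF ed na] by simp
    have gs: "?g \<sigma> = n \<sigma> * e (unit_over (src \<sigma>))" if "\<sigma> \<in> garrows \<Sigma>" for \<sigma>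
      using conv_diag_right[OF na ed that] .
    have gn: "n \<tau> \<noteq> 0" if "?g \<tau> \<noteq> 0" for \<tau>
      using gs[of \<tau>] that by (cases "\<tau> \<in> garrows \<Sigma>") (auto simp: conv_outside)
    let ?K = "grange G ` q ` supp ?g"
    note K = image_compact_open(4-6)[OF q_supp_clopen(1)[OF alg_twisted[OF g]] alg_compact[OF g]]
    note d = char_fun_units[OF K]
    have "?g = conv (char_fun (unit_over ` ?K)) n"
    proof (rule alg_ext[OF g])
      show "conv (char_fun (unit_over ` ?K)) n \<in> alg" using diag_mult_closed[OF d(1) na] by simp
      fix \<sigma> assume \<sigma>: "\<sigma> \<in> garrows \<Sigma>"
      have "?g \<sigma> = n \<sigma> \<and> (?g \<sigma> \<noteq> 0 \<longrightarrow> rng \<sigma> \<in> ?K) \<or> ?g \<sigma> = 0 \<and> (n \<sigma> \<noteq> 0 \<longrightarrow> rng \<sigma> \<notin> ?K)"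
      proof (cases "?g \<sigma> = 0")
        case True
        have "rng \<sigma> \<notin> ?K" if "n \<sigma> \<noteq> 0"
        proof
          assume "rng \<sigma> \<in> ?K"
          then obtain \<tau> where "\<tau> \<in> supp ?g" "rng \<sigma> = rng \<tau>" by auto
          then have "q \<sigma> \<in> q ` supp ?g" using orbit that gn by blast
          then show False using True mem_q_supp_iff[OF alg_twisted[OF g] \<sigma>] by simp
        qed
        then show ?thesis using True by simp
      next
        case False
        then show ?thesis using gs[OF \<sigma>] vals[OF rng_src_unit(2)[OF \<sigma>]] by (auto simp: supp_def)
      qed
      then show "?g \<sigma> = conv (char_fun (unit_over ` ?K)) n \<sigma>"
        using conv_diag_left[OF d(1) na \<sigma>] d(2)[OF rng_src_unit(1)[OF \<sigma>]] by auto
    qed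
    then show ?thesis using char_fun_units_idempotent[OF K] by blast
  qed
qed

definition source_idempotent :: "'s set \<Rightarrow> 's \<Rightarrow> 'r" where
  "source_idempotent Z = char_fun (unit_over ` gsource G ` q ` Z)"

lemma source_idempotent:
  assumes "sheet Z"
  shows "source_idempotent Z \<in> idempotents"
    and "x \<in> gunits G \<Longrightarrow> source_idempotent Z (unit_over x) = (if x \<in> gsource G ` q ` Z then 1 else 0)"
proof -
  have "openin (gtop G) (q ` Z)" "compactin (gtop G) (q ` Z)"
    using assms q_open by (auto simp: sheet_def open_map_def)
  note K = image_compact_open(1-3)[OF this]
  show "source_idempotent Z \<in> idempotents"
    unfolding source_idempotent_def by (rule char_fun_units_idempotent[OF K])
  show "x \<in> gunits G \<Longrightarrow> source_idempotent Z (unit_over x) = (if x \<in> gsource G ` q ` Z then 1 else 0)"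
    unfolding source_idempotent_def by (rule char_fun_units(2)[OF K])
qed

text \<open>Right multiplication by \<open>source_idempotent Z\<close> restricts a function with injective sources to the orbits of the
  sheet.  In this way a local property of \<open>m\<close>, its value on a sheet, becomes an equation in the algebra
  that involves the diagonal and a scalar only, and which an isomorphism therefore preserves.\<close>

lemma cut_down:
  assumes Z: "sheet Z" and m: "m \<in> alg" and inj: "inj_on (gsource G) (q ` supp m)"
    and c: "c \<noteq> 0" "\<And>z. z \<in> Z \<Longrightarrow> m z = c"
  shows "conv m (source_idempotent Z) = (\<lambda>\<sigma>. c * char_fun Z \<sigma>)"
proof (rule alg_ext)
  note e = idempotent_diag[OF source_idempotent(1)[OF Z]]
  have mt: "twisted m" using m by (rule alg_twisted)
  show "conv m (source_idempotent Z) \<in> alg" using diag_mult_closed[OF e m] by simp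
  show "(\<lambda>\<sigma>. c * char_fun Z \<sigma>) \<in> alg" by (rule alg_scale[OF char_fun_in_alg[OF Z]])
  fix \<sigma> assume \<sigma>: "\<sigma> \<in> garrows \<Sigma>"
  have s: "src \<sigma> \<in> gunits G" using rng_src_unit[OF \<sigma>] by simp
  have eq: "conv m (source_idempotent Z) \<sigma> = m \<sigma> * (if src \<sigma> \<in> gsource G ` q ` Z then 1 else 0)"
    using conv_diag_right[OF m e \<sigma>] source_idempotent(2)[OF Z s] by simp
  show "conv m (source_idempotent Z) \<sigma> = c * char_fun Z \<sigma>"
  proof (cases "char_fun Z \<sigma> = 0")
    case True
    have "m \<sigma> = 0" if sZ: "src \<sigma> \<in> gsource G ` q ` Z"
    proof (rule ccontr)
      assume ne: "m \<sigma> \<noteq> 0"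
      obtain z where z: "z \<in> Z" "src \<sigma> = src z" using sZ by auto
      then have "q \<sigma> \<in> q ` supp m" "q z \<in> q ` supp m" using ne c by (auto simp: supp_def)
      then have "q \<sigma> = q z" using inj z(2) by (auto dest: inj_onD)
      then have "q \<sigma> \<in> q ` supp (char_fun Z)" using q_supp_char_fun[OF Z] z(1) by simp
      then show False using True mem_q_supp_iff[OF alg_twisted[OF char_fun_in_alg[OF Z]] \<sigma>] by simp
    qed
    then show ?thesis using eq True by auto
  next
    case False
    from char_fun_nonzeroE[OF Z this] obtain t where t: "t = char_fun Z \<sigma>" "t \<in> ring_units" "act t \<sigma> \<in> Z"
      by blast
    have "m (act t \<sigma>) = c" using c(2)[OF t(3)] .
    then have "unit_inverse t * m \<sigma> = c" using twisted_act[OF mt t(2) \<sigma>] by simp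
    then have "m \<sigma> = c * t"
      using ring_unit_inverse(1)[OF t(2)] by (metis mult.assoc mult.commute mult.left_neutral)
    moreover have "src \<sigma> \<in> gsource G ` q ` Z"
      using imageI[OF imageI[OF t(3), of q], of "gsource G"] q_act[OF \<sigma> t(2)] by simp
    ultimately show ?thesis using eq t(1) by simp
  qed
qed

section \<open>Recognising bisection functions\<close>

text \<open>Arrows in different fibres of \<open>q\<close> are separated by the topology of \<open>G\<close>, arrows in the same fibre by
  the free action of the units.\<close>

lemma bisection_functions_separate:
  assumes \<sigma>: "\<sigma> \<in> garrows \<Sigma>" and ne: "\<sigma> \<noteq> \<tau>"
  obtains n where "n \<in> bisection_functions" "n \<sigma> = 1" "n \<tau> \<noteq> 1"
proof (cases "q \<sigma> = q \<tau>")
  case True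
  obtain Z where Z: "sheet Z" "\<sigma> \<in> Z" "char_fun Z \<in> bisection_functions"
    by (rule small_sheet[OF openin_topspace \<sigma>])
  then have "char_fun Z \<sigma> = 1" using char_fun_eq_1[OF Z(1)] by simp
  then show thesis
    using that[OF Z(3)] ne value_one_unique[OF alg_twisted[OF char_fun_in_alg[OF Z(1)]] True] by fastforce
next
  case False
  have "openin (gtop G) (garrows G - {q \<tau>})"
    using Hausdorff_imp_t1_space[OF Hausdorff] unfolding t1_space_openin_delete_alt by blast
  then have "openin (gtop \<Sigma>) {\<upsilon> \<in> garrows \<Sigma>. q \<upsilon> \<in> garrows G - {q \<tau>}}"
    by (rule openin_continuous_map_preimage[OF q_continuous])
  moreover have "\<sigma> \<in> {\<upsilon> \<in> garrows \<Sigma>. q \<upsilon> \<in> garrows G - {q \<tau>}}"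
    using \<sigma> False q_arrow by simp
  ultimately obtain Z where Z: "sheet Z" "\<sigma> \<in> Z" "Z \<subseteq> {\<upsilon> \<in> garrows \<Sigma>. q \<upsilon> \<in> garrows G - {q \<tau>}}"
    "char_fun Z \<in> bisection_functions"
    by (rule small_sheet)
  then have "\<tau> \<notin> Z" by auto
  then show thesis using that[OF Z(4)] char_fun_eq_1[OF Z(1)] Z(2) by blast
qed

text \<open>If two arrows of the support have the same source but different ranges, an idempotent \<open>e\<close> that
  separates the ranges keeps one and removes the other, whereas on the other side \<open>d\<close> treats both
  alike.  So the source determines the range, and all quotients \<open>a b\<^bsup>-1\<^esup>\<close> of arrows of the support
  with the same source form an open set of isotropy, which consists of units.\<close>

lemma source_injective_of_exchange:
  assumes eff: "effective_groupoid G" and ind: "indecomposable_ring TYPE('r)" and m: "m \<in> alg"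
    and ex: "\<And>e. e \<in> idempotents \<Longrightarrow> \<exists>d \<in> idempotents. conv e m = conv m d"
  shows "inj_on (gsource G) (q ` supp m)"
proof -
  have mt: "twisted m" using m by (rule alg_twisted)
  let ?C = "q ` supp m"
  have same: "rng \<sigma> = rng \<tau>" if ne: "m \<sigma> \<noteq> 0" "m \<tau> \<noteq> 0" and s: "src \<sigma> = src \<tau>" for \<sigma> \<tau>
  proof (rule ccontr)
    assume r: "rng \<sigma> \<noteq> rng \<tau>"
    have arr: "\<sigma> \<in> garrows \<Sigma>" "\<tau> \<in> garrows \<Sigma>" using ne supp_arrow[OF mt] by auto
    note u = rng_src_unit(1)[OF arr(1)] rng_src_unit(1)[OF arr(2)] rng_src_unit(2)[OF arr(2)]
    obtain K where K: "openin (gtop G) K" "compactin (gtop G) K" "K \<subseteq> gunits G" "rng \<sigma> \<in> K" "rng \<tau> \<notin> K"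
      using separating_compact_open[OF u(1,2) r] .
    note e = char_fun_units[OF K(1-3)]
    obtain d where d: "d \<in> idempotents" "conv (char_fun (unit_over ` K)) m = conv m d"
      using ex[OF char_fun_units_idempotent[OF K(1-3)]] by blast
    note dd = idempotent_diag[OF d(1)]
    have "m \<sigma> = m \<sigma> * d (unit_over (src \<tau>))" "0 = m \<tau> * d (unit_over (src \<tau>))"
      using conv_diag_left[OF e(1) m arr(1)] conv_diag_right[OF m dd arr(1)] e(2)[OF u(1)] K(4)
        conv_diag_left[OF e(1) m arr(2)] conv_diag_right[OF m dd arr(2)] e(2)[OF u(2)] K(5) d(2) s
      by simp_all
    then show False using ne idempotent_value[OF ind d(1) u(3)] by auto
  qed
  have "openin (gtop G) ?C" by (rule q_supp_clopen(1)[OF mt])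
  moreover from this have "openin (gtop G) (ginv G ` ?C)"
    using homeomorphic_imp_open_map[OF base.homeomorphic_inv] by (simp add: open_map_def)
  ultimately have op: "openin (gtop G)
      {gmult G a b | a b. a \<in> ?C \<and> b \<in> ginv G ` ?C \<and> gsource G a = grange G b}" (is "openin _ ?D")
    by (rule etale_open_mult[OF etale])
  have CG: "?C \<subseteq> garrows G" using \<open>openin (gtop G) ?C\<close> by (rule openin_subset)
  have iso: "?D \<subseteq> isotropy G"
  proof
    fix c assume "c \<in> ?D"
    then obtain \<sigma> \<tau> where st: "m \<sigma> \<noteq> 0" "m \<tau> \<noteq> 0" "c = gmult G (q \<sigma>) (ginv G (q \<tau>))"
      "src \<sigma> = grange G (ginv G (q \<tau>))"
      by (auto simp: supp_def)
    then have arr: "q \<sigma> \<in> garrows G" "q \<tau> \<in> garrows G" using supp_arrow[OF mt] q_arrow by auto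
    then have c: "(q \<sigma>, ginv G (q \<tau>)) \<in> composable G" and s: "src \<sigma> = src \<tau>"
      using st(4) by (auto simp: base.composable_iff base.inv_closed base.range_inv)
    then show "c \<in> isotropy G"
      using base.mult_closed[OF c] base.range_mult[OF c] base.source_mult[OF c] same[OF st(1,2) s] st(3) arr
      by (simp add: isotropy_def base.source_inv)
  qed
  have D: "?D \<subseteq> gunits G"
    using interior_of_maximal[OF iso op] eff by (simp add: effective_groupoid_def)
  show ?thesis
  proof (rule inj_onI)
    fix a b assume ab: "a \<in> ?C" "b \<in> ?C" "gsource G a = gsource G b"
    then have arr: "a \<in> garrows G" "b \<in> garrows G" using CG by auto
    have "ginv G b \<in> ginv G ` ?C" "gsource G a = grange G (ginv G b)"
      using ab base.range_inv[OF arr(2)] by simp_all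
    then have "gmult G a (ginv G b) \<in> ?D" using ab(1) by blast
    then show "a = b" using base.eq_if_mult_inv_unit[OF arr ab(3)] D by blast
  qed
qed

text \<open>The mirror image of the first half of the previous argument reduces this to injectivity of the
  source.\<close>

lemma range_injective_of_exchange:
  assumes ind: "indecomposable_ring TYPE('r)" and m: "m \<in> alg"
    and ex: "\<And>e. e \<in> idempotents \<Longrightarrow> \<exists>d \<in> idempotents. conv m e = conv d m"
    and inj: "inj_on (gsource G) (q ` supp m)"
  shows "inj_on (grange G) (q ` supp m)"
proof (rule inj_onI)
  have mt: "twisted m" using m by (rule alg_twisted)
  fix a b assume ab: "a \<in> q ` supp m" "b \<in> q ` supp m" "grange G a = grange G b"
  then obtain \<sigma> \<tau> where st: "a = q \<sigma>" "b = q \<tau>" "m \<sigma> \<noteq> 0" "m \<tau> \<noteq> 0" by (auto simp: supp_def)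
  have arr: "\<sigma> \<in> garrows \<Sigma>" "\<tau> \<in> garrows \<Sigma>" using st supp_arrow[OF mt] by auto
  note u = rng_src_unit(2)[OF arr(1)] rng_src_unit(2)[OF arr(2)] rng_src_unit(1)[OF arr(2)]
  have "src \<sigma> = src \<tau>"
  proof (rule ccontr)
    assume s: "src \<sigma> \<noteq> src \<tau>"
    obtain K where K: "openin (gtop G) K" "compactin (gtop G) K" "K \<subseteq> gunits G" "src \<sigma> \<in> K" "src \<tau> \<notin> K"
      using separating_compact_open[OF u(1,2) s] .
    note e = char_fun_units[OF K(1-3)]
    obtain d where d: "d \<in> idempotents" "conv m (char_fun (unit_over ` K)) = conv d m"
      using ex[OF char_fun_units_idempotent[OF K(1-3)]] by blast
    note dd = idempotent_diag[OF d(1)]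
    have "m \<sigma> = d (unit_over (rng \<tau>)) * m \<sigma>" "0 = d (unit_over (rng \<tau>)) * m \<tau>"
      using conv_diag_right[OF m e(1) arr(1)] conv_diag_left[OF dd m arr(1)] e(2)[OF u(1)] K(4)
        conv_diag_right[OF m e(1) arr(2)] conv_diag_left[OF dd m arr(2)] e(2)[OF u(2)] K(5) d(2) st ab(3)
      by simp_all
    then show False using st idempotent_value[OF ind d(1) u(3)] by auto
  qed
  then show "a = b" using inj ab st by (auto dest: inj_onD)
qed

end

section \<open>The reconstruction of the twist\<close>

text \<open>Multiplicativity is assumed only for products with a diagonal factor.  Such products stay in the
  algebra by a pointwise formula, so that the assumptions pass to the inverse map and all results below
  hold in both directions.\<close>

locale diagonal_iso =
  T1: ample_twist G1 \<Sigma>1 i1 q1 + T2: ample_twist G2 \<Sigma>2 i2 q2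
  for G1 :: "'g grpd" and \<Sigma>1 :: "'s grpd" and i1 :: "'g \<times> 'r::comm_ring_1 \<Rightarrow> 's" and q1 :: "'s \<Rightarrow> 'g"
    and G2 :: "'h grpd" and \<Sigma>2 :: "'u grpd" and i2 :: "'h \<times> 'r \<Rightarrow> 'u" and q2 :: "'u \<Rightarrow> 'h" +
  fixes \<Psi> :: "('s \<Rightarrow> 'r) \<Rightarrow> ('u \<Rightarrow> 'r)"
  assumes indecomposable: "indecomposable_ring TYPE('r)"
    and effective1: "effective_groupoid G1" and effective2: "effective_groupoid G2"
    and bij: "bij_betw \<Psi> T1.alg T2.alg"
    and image_diag: "\<Psi> ` T1.diag = T2.diag"
    and mult_left: "d \<in> T1.diag \<Longrightarrow> f \<in> T1.alg \<Longrightarrow> \<Psi> (T1.conv d f) = T2.conv (\<Psi> d) (\<Psi> f)"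
    and mult_right: "f \<in> T1.alg \<Longrightarrow> d \<in> T1.diag \<Longrightarrow> \<Psi> (T1.conv f d) = T2.conv (\<Psi> f) (\<Psi> d)"
    and scale: "f \<in> T1.alg \<Longrightarrow> \<Psi> (\<lambda>\<sigma>. c * f \<sigma>) = (\<lambda>\<tau>. c * \<Psi> f \<tau>)"
begin

abbreviation \<Phi> :: "('u \<Rightarrow> 'r) \<Rightarrow> ('s \<Rightarrow> 'r)" where "\<Phi> \<equiv> inv_into T1.alg \<Psi>"

lemma \<Psi>_alg: "f \<in> T1.alg \<Longrightarrow> \<Psi> f \<in> T2.alg"
  and \<Phi>_alg: "g \<in> T2.alg \<Longrightarrow> \<Phi> g \<in> T1.alg"
  and \<Phi>_\<Psi>: "f \<in> T1.alg \<Longrightarrow> \<Phi> (\<Psi> f) = f"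
  and \<Psi>_\<Phi>: "g \<in> T2.alg \<Longrightarrow> \<Psi> (\<Phi> g) = g"
  using bij by (auto simp: bij_betw_def inv_into_into f_inv_into_f)

lemma \<Psi>_diag: "d \<in> T1.diag \<Longrightarrow> \<Psi> d \<in> T2.diag"
  using image_diag by blast

lemma \<Phi>_diag: "d \<in> T2.diag \<Longrightarrow> \<Phi> d \<in> T1.diag"
  using image_diag \<Phi>_\<Psi> T1.diag_alg by (metis imageE)

lemma reversed: "diagonal_iso G2 \<Sigma>2 i2 q2 G1 \<Sigma>1 i1 q1 \<Phi>"
proof unfold_locales
  show "indecomposable_ring TYPE('r)" "effective_groupoid G2" "effective_groupoid G1"
    by (rule indecomposable effective2 effective1)+
  show "bij_betw \<Phi> T2.alg T1.alg" using bij by (rule bij_betw_inv_into)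
  show "\<Phi> ` T2.diag = T1.diag"
  proof
    show "\<Phi> ` T2.diag \<subseteq> T1.diag" using \<Phi>_diag by blast
    show "T1.diag \<subseteq> \<Phi> ` T2.diag" using \<Psi>_diag \<Phi>_\<Psi> T1.diag_alg by (metis image_eqI subsetI)
  qed
  show "\<Phi> (T2.conv d f) = T1.conv (\<Phi> d) (\<Phi> f)" if "d \<in> T2.diag" "f \<in> T2.alg" for d f
  proof -
    have "\<Psi> (T1.conv (\<Phi> d) (\<Phi> f)) = T2.conv d f"
      using that by (simp add: mult_left \<Phi>_diag \<Phi>_alg \<Psi>_\<Phi> T2.diag_alg)
    then show ?thesis
      using \<Phi>_\<Psi>[OF T1.diag_mult_closed(1)[OF \<Phi>_diag[OF that(1)] \<Phi>_alg[OF that(2)]]] by simp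
  qed
  show "\<Phi> (T2.conv f d) = T1.conv (\<Phi> f) (\<Phi> d)" if "f \<in> T2.alg" "d \<in> T2.diag" for d f
  proof -
    have "\<Psi> (T1.conv (\<Phi> f) (\<Phi> d)) = T2.conv f d"
      using that by (simp add: mult_right \<Phi>_diag \<Phi>_alg \<Psi>_\<Phi> T2.diag_alg)
    then show ?thesis
      using \<Phi>_\<Psi>[OF T1.diag_mult_closed(2)[OF \<Phi>_diag[OF that(2)] \<Phi>_alg[OF that(1)]]] by simp
  qed
  show "\<Phi> (\<lambda>\<tau>. c * f \<tau>) = (\<lambda>\<sigma>. c * \<Phi> f \<sigma>)" if "f \<in> T2.alg" for f c
  proof -
    have "\<Psi> (\<lambda>\<sigma>. c * \<Phi> f \<sigma>) = (\<lambda>\<tau>. c * f \<tau>)" using that by (simp add: scale \<Phi>_alg \<Psi>_\<Phi>)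
    then show ?thesis using \<Phi>_\<Psi>[OF T1.alg_scale[OF \<Phi>_alg[OF that]]] by metis
  qed
qed

lemma \<Psi>_idempotent:
  assumes "d \<in> T1.idempotents"
  shows "\<Psi> d \<in> T2.idempotents"
proof -
  have d: "d \<in> T1.diag" "T1.conv d d = d" using assms by (auto simp: T1.idempotents_def)
  then show ?thesis
    using mult_left[OF d(1) T1.diag_alg[OF d(1)]] \<Psi>_diag[OF d(1)] by (simp add: T2.idempotents_def)
qed

lemma \<Psi>_zero: "f \<in> T1.alg \<Longrightarrow> \<Psi> (\<lambda>_. 0) = (\<lambda>_. 0)"
  using scale[of f 0] by simp

text \<open>The exchange property transports along \<open>\<Psi>\<close>.  For the unit values, let \<open>c\<close> be a nonzero value of
  \<open>\<Psi> n\<close>.  Cutting \<open>\<Psi> n\<close> down to a sheet where it is \<open>c\<close> gives \<open>c\<close> times a characteristic function;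
  pulled back, a nonzero restriction of \<open>n\<close> is a multiple of \<open>c\<close>, so that \<open>c\<close> divides a unit.\<close>

lemma \<Psi>_bisection_function:
  assumes n: "n \<in> T1.bisection_functions"
  shows "\<Psi> n \<in> T2.bisection_functions"
proof -
  interpret rev: diagonal_iso G2 \<Sigma>2 i2 q2 G1 \<Sigma>1 i1 q1 \<Phi> by (rule reversed)
  have na: "n \<in> T1.alg" using n by (rule T1.bisection_function_alg)
  have ma: "\<Psi> n \<in> T2.alg" using na by (rule \<Psi>_alg)
  have transport: "\<Psi> (\<Phi> e) = e" "\<Phi> e \<in> T1.idempotents" "\<Phi> e \<in> T1.diag" if "e \<in> T2.idempotents" for e
    using that rev.\<Psi>_idempotent T2.idempotent_diag T2.diag_alg \<Psi>_\<Phi> \<Phi>_diag by auto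
  have inj_s: "inj_on (gsource G2) (q2 ` supp (\<Psi> n))"
  proof (rule T2.source_injective_of_exchange[OF effective2 indecomposable ma])
    fix e assume e: "e \<in> T2.idempotents"
    obtain d where d: "d \<in> T1.idempotents" "T1.conv (\<Phi> e) n = T1.conv n d"
      using T1.idempotent_exchange(1)[OF indecomposable n transport(2)[OF e]] by blast
    have "T2.conv e (\<Psi> n) = T2.conv (\<Psi> n) (\<Psi> d)"
      using mult_left[OF transport(3)[OF e] na] mult_right[OF na T1.idempotent_diag[OF d(1)]]
        d(2) transport(1)[OF e] by simp
    then show "\<exists>d \<in> T2.idempotents. T2.conv e (\<Psi> n) = T2.conv (\<Psi> n) d"
      using \<Psi>_idempotent[OF d(1)] by blast
  qed
  have inj_r: "inj_on (grange G2) (q2 ` supp (\<Psi> n))"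
  proof (rule T2.range_injective_of_exchange[OF indecomposable ma _ inj_s])
    fix e assume e: "e \<in> T2.idempotents"
    obtain d where d: "d \<in> T1.idempotents" "T1.conv n (\<Phi> e) = T1.conv d n"
      using T1.idempotent_exchange(2)[OF indecomposable n transport(2)[OF e]] by blast
    have "T2.conv (\<Psi> n) e = T2.conv (\<Psi> d) (\<Psi> n)"
      using mult_right[OF na transport(3)[OF e]] mult_left[OF T1.idempotent_diag[OF d(1)] na]
        d(2) transport(1)[OF e] by simp
    then show "\<exists>d \<in> T2.idempotents. T2.conv (\<Psi> n) e = T2.conv d (\<Psi> n)"
      using \<Psi>_idempotent[OF d(1)] by blast
  qed
  have "\<Psi> n \<tau> \<in> ring_units" if ne: "\<Psi> n \<tau> \<noteq> 0" for \<tau>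
  proof -
    have mt: "T2.twisted (\<Psi> n)" using ma by (rule T2.alg_twisted)
    have \<tau>: "\<tau> \<in> garrows \<Sigma>2" using ne by (rule T2.supp_arrow[OF mt])
    define c where "c = \<Psi> n \<tau>"
    obtain Z where Z: "T2.sheet Z" "\<tau> \<in> Z" "Z \<subseteq> {\<upsilon> \<in> garrows \<Sigma>2. \<Psi> n \<upsilon> = c}"
      using T2.small_sheet[OF T2.twisted_open[OF mt], of \<tau> "\<lambda>v. v = c"] \<tau> c_def by auto
    note e = T2.source_idempotent(1)[OF Z(1)]
    let ?e = "T2.source_idempotent Z" and ?k = "T2.char_fun Z"
    let ?g = "T1.conv n (\<Phi> ?e)"
    have k: "?k \<in> T2.alg" by (rule T2.char_fun_in_alg[OF Z(1)])
    have g: "?g \<in> T1.alg" using T1.diag_mult_closed(2)[OF transport(3)[OF e] na] .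
    have \<Psi>g: "\<Psi> ?g = (\<lambda>\<upsilon>. c * ?k \<upsilon>)"
    proof -
      have "\<Psi> ?g = T2.conv (\<Psi> n) ?e"
        using mult_right[OF na transport(3)[OF e]] transport(1)[OF e] by simp
      also have "\<dots> = (\<lambda>\<upsilon>. c * ?k \<upsilon>)"
        using Z ne by (intro T2.cut_down[OF Z(1) ma inj_s]) (auto simp: c_def)
      finally show ?thesis .
    qed
    have "?g = (\<lambda>\<sigma>. c * \<Phi> ?k \<sigma>)"
      using \<Phi>_\<Psi>[OF g] \<Psi>g rev.scale[OF k, of c] by simp
    moreover have "?g \<noteq> (\<lambda>_. 0)"
    proof
      assume "?g = (\<lambda>_. 0)"
      then have "(\<lambda>\<upsilon>. c * ?k \<upsilon>) = (\<lambda>_. 0)" using \<Psi>g \<Psi>_zero[OF na] by simp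
      then have "c * ?k \<tau> = 0" by (rule fun_cong)
      moreover have "?k \<tau> = 1" using T2.char_fun_eq_1[OF Z(1)] Z(2) by simp
      ultimately show False using ne by (simp add: c_def)
    qed
    then obtain \<sigma> where ne': "?g \<sigma> \<noteq> 0" by auto
    then have \<sigma>: "\<sigma> \<in> garrows \<Sigma>1" by (rule T1.supp_arrow[OF T1.alg_twisted[OF g]])
    have "?g \<sigma> = n \<sigma> * \<Phi> ?e (T1.unit_over (T1.src \<sigma>))"
      using T1.conv_diag_right[OF na transport(3)[OF e] \<sigma>] .
    then have "?g \<sigma> = n \<sigma>"
      using ne' T1.idempotent_value[OF indecomposable transport(2)[OF e] T1.rng_src_unit(2)[OF \<sigma>]]
      by auto
    then have "?g \<sigma> \<in> ring_units" using ne' T1.bisection_function_unit[OF n] by simp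
    moreover have "c dvd ?g \<sigma>" using \<open>?g = (\<lambda>\<sigma>. c * \<Phi> ?k \<sigma>)\<close> by simp
    ultimately have "c \<in> ring_units" by (metis ring_units_dvd)
    then show ?thesis by (simp add: c_def)
  qed
  then show ?thesis
    using ma inj_s inj_r by (simp add: T2.bisection_functions_def)
qed

lemma \<Phi>_bisection_function: "m \<in> T2.bisection_functions \<Longrightarrow> \<Phi> m \<in> T1.bisection_functions"
proof -
  interpret rev: diagonal_iso G2 \<Sigma>2 i2 q2 G1 \<Sigma>1 i1 q1 \<Phi> by (rule reversed)
  show "m \<in> T2.bisection_functions \<Longrightarrow> \<Phi> m \<in> T1.bisection_functions"
    by (rule rev.\<Psi>_bisection_function)
qed

text \<open>Functions that take the value 1 at \<open>\<sigma>\<close> agree on a sheet around \<open>\<sigma>\<close>, whose characteristic function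
  is the product of each of them with the same idempotent.\<close>

lemma common_refinement:
  assumes \<sigma>: "\<sigma> \<in> garrows \<Sigma>1" and T: "finite T" "T \<subseteq> T1.bisection_functions"
    and one: "\<And>n. n \<in> T \<Longrightarrow> n \<sigma> = 1"
  obtains k where "k \<in> T1.bisection_functions" "k \<sigma> = 1"
    "\<And>n \<tau>. n \<in> T \<Longrightarrow> \<Psi> k \<tau> = 1 \<Longrightarrow> \<Psi> n \<tau> = 1"
proof -
  let ?U = "garrows \<Sigma>1 \<inter> (\<Inter>n\<in>T. {\<upsilon> \<in> garrows \<Sigma>1. n \<upsilon> = 1})"
  have opn: "openin (gtop \<Sigma>1) {\<upsilon> \<in> garrows \<Sigma>1. n \<upsilon> = 1}" if "n \<in> T" for n
    using T1.twisted_open[OF T1.alg_twisted[OF T1.bisection_function_alg], of n "\<lambda>v. v = 1"] T(2) that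
    by blast
  have "openin (gtop \<Sigma>1) ?U"
    using T(1) opn by (cases "T = {}") (auto intro!: openin_Int openin_INT2)
  moreover have "\<sigma> \<in> ?U" using \<sigma> one by simp
  ultimately obtain Z where Z: "T1.sheet Z" "\<sigma> \<in> Z" "Z \<subseteq> ?U" "T1.char_fun Z \<in> T1.bisection_functions"
    by (rule T1.small_sheet)
  note e = T1.source_idempotent(1)[OF Z(1)]
  show thesis
  proof (rule that[OF Z(4)])
    show "T1.char_fun Z \<sigma> = 1" using T1.char_fun_eq_1[OF Z(1)] Z(2) by simp
    fix n \<tau> assume n: "n \<in> T" and \<tau>: "\<Psi> (T1.char_fun Z) \<tau> = 1"
    have nb: "n \<in> T1.bisection_functions" using n T by blast
    note na = T1.bisection_function_alg[OF nb]
    have "T1.conv n (T1.source_idempotent Z) = (\<lambda>\<upsilon>. 1 * T1.char_fun Z \<upsilon>)"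
      using nb n Z(3) by (intro T1.cut_down[OF Z(1) na]) (auto simp: T1.bisection_functions_def)
    then have eq: "\<Psi> (T1.char_fun Z) = T2.conv (\<Psi> n) (\<Psi> (T1.source_idempotent Z))"
      using mult_right[OF na T1.idempotent_diag[OF e]] by simp
    have arr: "\<tau> \<in> garrows \<Sigma>2"
      using \<tau> T2.supp_arrow[OF T2.alg_twisted[OF \<Psi>_alg[OF T1.char_fun_in_alg[OF Z(1)]]], of \<tau>] by simp
    have "1 = \<Psi> n \<tau> * \<Psi> (T1.source_idempotent Z) (T2.unit_over (T2.src \<tau>))"
      using T2.conv_diag_right[OF \<Psi>_alg[OF na] \<Psi>_diag[OF T1.idempotent_diag[OF e]] arr] eq \<tau> by simp
    then show "\<Psi> n \<tau> = 1"
      using T2.idempotent_value[OF indecomposable \<Psi>_idempotent[OF e] T2.rng_src_unit(2)[OF arr]]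
      by auto
  qed
qed

lemma \<Psi>_one_over_support:
  assumes n: "n \<in> T1.bisection_functions" and a: "a \<in> q2 ` supp (\<Psi> n)"
  obtains \<tau> where "\<tau> \<in> garrows \<Sigma>2" "q2 \<tau> = a" "\<Psi> n \<tau> = 1"
  using a T2.normalized_arrow[OF \<Psi>_bisection_function[OF n]] that by (auto simp: supp_def)

text \<open>The compactness argument takes place in \<open>G2\<close>, where the supports of the \<open>\<Psi> n\<close> project to compact
  closed sets.  Over a common point \<open>a\<close> of these sets each \<open>\<Psi> n\<close> takes the value 1 exactly once, and
  common refinements show that this happens at the same arrow for all \<open>n\<close>.\<close>

lemma exists_limit_arrow:
  assumes \<sigma>: "\<sigma> \<in> garrows \<Sigma>1"
  obtains \<tau> where "\<tau> \<in> garrows \<Sigma>2" "\<And>n. n \<in> T1.bisection_functions \<Longrightarrow> n \<sigma> = 1 \<Longrightarrow> \<Psi> n \<tau> = 1"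
proof -
  define F where "F = {n \<in> T1.bisection_functions. n \<sigma> = 1}"
  define S where "S n = q2 ` supp (\<Psi> n)" for n
  have refine: "\<exists>k \<in> F. \<forall>n \<in> T. \<forall>\<tau>. \<Psi> k \<tau> = 1 \<longrightarrow> \<Psi> n \<tau> = 1" if T: "finite T" "T \<subseteq> F" for T
  proof -
    obtain k where "k \<in> T1.bisection_functions" "k \<sigma> = 1"
      "\<And>n \<tau>. n \<in> T \<Longrightarrow> \<Psi> k \<tau> = 1 \<Longrightarrow> \<Psi> n \<tau> = 1"
      using common_refinement[OF \<sigma> T(1)] T(2) by (auto simp: F_def)
    then show ?thesis unfolding F_def by blast
  qed
  have one: "\<exists>\<tau> \<in> garrows \<Sigma>2. q2 \<tau> = a \<and> \<Psi> n \<tau> = 1" if "n \<in> F" "a \<in> S n" for n a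
    using \<Psi>_one_over_support[of n a] that by (auto simp: F_def S_def)
  have tw: "T2.twisted (\<Psi> n)" if "n \<in> F" for n
    using that by (simp add: F_def T2.alg_twisted \<Psi>_alg T1.bisection_function_alg)
  have sub: "S k \<subseteq> S n" if k: "k \<in> F" "\<forall>\<tau>. \<Psi> k \<tau> = 1 \<longrightarrow> \<Psi> n \<tau> = 1" for k n
  proof
    fix a assume "a \<in> S k"
    then obtain \<tau> where \<tau>: "q2 \<tau> = a" "\<Psi> k \<tau> = 1" using one[OF k(1)] by blast
    then have "\<Psi> n \<tau> = 1" using k(2) by blast
    then have "\<tau> \<in> supp (\<Psi> n)" by (simp add: supp_def)
    then show "a \<in> S n" using \<tau>(1) by (auto simp: S_def)
  qed
  have nonempty: "S n \<noteq> {}" if n: "n \<in> F" for n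
  proof
    assume "S n = {}"
    then have "\<Psi> n = (\<lambda>_. 0)" by (auto simp: S_def supp_def)
    moreover have na: "n \<in> T1.alg" using n by (simp add: F_def T1.bisection_function_alg)
    ultimately have "\<Psi> n = \<Psi> (\<lambda>\<upsilon>. 0 * n \<upsilon>)" using \<Psi>_zero[OF na] by simp
    then have "n = (\<lambda>\<upsilon>. 0 * n \<upsilon>)" using \<Phi>_\<Psi>[OF na] \<Phi>_\<Psi>[OF T1.alg_scale[OF na]] by metis
    then have "n \<sigma> = 0 * n \<sigma>" by (rule fun_cong)
    then show False using n by (simp add: F_def)
  qed
  obtain n0 where n0: "n0 \<in> F" using refine[of "{}"] by auto
  have "compactin (gtop G2) (S n0)"
    using n0 by (simp add: F_def S_def T2.alg_compact \<Psi>_alg T1.bisection_function_alg)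
  moreover have "\<forall>C \<in> S ` F. closedin (gtop G2) C"
    using T2.q_supp_clopen(2)[OF tw] by (auto simp: S_def)
  moreover have "S n0 \<inter> \<Inter>\<C> \<noteq> {}" if C: "finite \<C>" "\<C> \<subseteq> S ` F" for \<C>
  proof -
    obtain T where T: "T \<subseteq> F" "finite T" "\<C> = S ` T"
      using finite_subset_image[OF C] by blast
    obtain k where k: "k \<in> F" "\<forall>n \<in> insert n0 T. \<forall>\<tau>. \<Psi> k \<tau> = 1 \<longrightarrow> \<Psi> n \<tau> = 1"
      using refine[of "insert n0 T"] T n0 by auto
    then have "S k \<subseteq> S n0 \<inter> \<Inter>\<C>" using sub[OF k(1)] T(3) by blast
    then show ?thesis using nonempty[OF k(1)] by blast
  qed
  ultimately have "S n0 \<inter> \<Inter>(S ` F) \<noteq> {}"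
    unfolding compactin_fip by blast
  then obtain a where a: "\<And>n. n \<in> F \<Longrightarrow> a \<in> S n" by blast
  obtain \<tau> where \<tau>: "\<tau> \<in> garrows \<Sigma>2" "q2 \<tau> = a" "\<Psi> n0 \<tau> = 1"
    using one[OF n0 a[OF n0]] by blast
  show thesis
  proof (rule that[OF \<tau>(1)])
    fix n assume "n \<in> T1.bisection_functions" "n \<sigma> = 1"
    then have n: "n \<in> F" by (simp add: F_def)
    obtain k where k: "k \<in> F" "\<forall>n \<in> {n0, n}. \<forall>\<tau>. \<Psi> k \<tau> = 1 \<longrightarrow> \<Psi> n \<tau> = 1"
      using refine[of "{n0, n}"] n n0 by auto
    obtain \<tau>' where \<tau>': "q2 \<tau>' = a" "\<Psi> k \<tau>' = 1" using one[OF k(1) a[OF k(1)]] by blast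
    then have "\<tau>' = \<tau>"
      using T2.value_one_unique[OF tw[OF n0], of \<tau>' \<tau>] \<tau> k(2) by simp
    then show "\<Psi> n \<tau> = 1" using k(2) \<tau>'(2) by simp
  qed
qed

definition corresponds :: "'s \<Rightarrow> 'u \<Rightarrow> bool" where
  "corresponds \<sigma> \<tau> \<longleftrightarrow> \<sigma> \<in> garrows \<Sigma>1 \<and> \<tau> \<in> garrows \<Sigma>2 \<and>
     (\<forall>n \<in> T1.bisection_functions. n \<sigma> = 1 \<longleftrightarrow> \<Psi> n \<tau> = 1)"

lemma correspondsD:
  "corresponds \<sigma> \<tau> \<Longrightarrow> n \<in> T1.bisection_functions \<Longrightarrow> n \<sigma> = 1 \<longleftrightarrow> \<Psi> n \<tau> = 1"
  by (simp add: corresponds_def)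

lemma corresponds_reversed:
  "diagonal_iso.corresponds G2 \<Sigma>2 i2 q2 \<Sigma>1 \<Phi> \<tau> \<sigma> \<longleftrightarrow> corresponds \<sigma> \<tau>"
proof -
  interpret rev: diagonal_iso G2 \<Sigma>2 i2 q2 G1 \<Sigma>1 i1 q1 \<Phi> by (rule reversed)
  have "(\<forall>m \<in> T2.bisection_functions. m \<tau> = 1 \<longleftrightarrow> \<Phi> m \<sigma> = 1) \<longleftrightarrow>
      (\<forall>n \<in> T1.bisection_functions. n \<sigma> = 1 \<longleftrightarrow> \<Psi> n \<tau> = 1)"
    using \<Psi>_bisection_function \<Phi>_bisection_function \<Phi>_\<Psi> \<Psi>_\<Phi>
      T1.bisection_function_alg T2.bisection_function_alg by metis
  then show ?thesis by (auto simp: rev.corresponds_def corresponds_def)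
qed

lemma corresponds_unique:
  assumes "corresponds \<sigma> \<tau>" "corresponds \<sigma> \<tau>'"
  shows "\<tau> = \<tau>'"
proof (rule ccontr)
  assume "\<tau> \<noteq> \<tau>'"
  then obtain m where m: "m \<in> T2.bisection_functions" "m \<tau> = 1" "m \<tau>' \<noteq> 1"
    using T2.bisection_functions_separate[of \<tau> \<tau>'] assms by (auto simp: corresponds_def)
  have "\<Psi> (\<Phi> m) = m" using \<Psi>_\<Phi>[OF T2.bisection_function_alg[OF m(1)]] .
  then show False
    using correspondsD[OF assms(1) \<Phi>_bisection_function[OF m(1)]]
      correspondsD[OF assms(2) \<Phi>_bisection_function[OF m(1)]] m by simp
qed

text \<open>A limit arrow satisfies one implication of the correspondence; a limit arrow for the inverse map,
  taken at the first one, satisfies the other and must be \<open>\<sigma>\<close>, because bisection functions separate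
  arrows.\<close>

lemma corresponds_exists:
  assumes \<sigma>: "\<sigma> \<in> garrows \<Sigma>1"
  shows "\<exists>\<tau>. corresponds \<sigma> \<tau>"
proof -
  interpret rev: diagonal_iso G2 \<Sigma>2 i2 q2 G1 \<Sigma>1 i1 q1 \<Phi> by (rule reversed)
  obtain \<tau> where \<tau>: "\<tau> \<in> garrows \<Sigma>2"
    "\<And>n. n \<in> T1.bisection_functions \<Longrightarrow> n \<sigma> = 1 \<Longrightarrow> \<Psi> n \<tau> = 1"
    using exists_limit_arrow[OF \<sigma>] by blast
  obtain \<sigma>' where \<sigma>': "\<sigma>' \<in> garrows \<Sigma>1"
    "\<And>m. m \<in> T2.bisection_functions \<Longrightarrow> m \<tau> = 1 \<Longrightarrow> \<Phi> m \<sigma>' = 1"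
    using rev.exists_limit_arrow[OF \<tau>(1)] by blast
  have reflect: "n \<sigma>' = 1" if "n \<in> T1.bisection_functions" "\<Psi> n \<tau> = 1" for n
    using \<sigma>'(2)[OF \<Psi>_bisection_function[OF that(1)] that(2)]
      \<Phi>_\<Psi>[OF T1.bisection_function_alg[OF that(1)]] by simp
  have "\<sigma> = \<sigma>'"
  proof (rule ccontr)
    assume "\<sigma> \<noteq> \<sigma>'"
    then obtain n where "n \<in> T1.bisection_functions" "n \<sigma> = 1" "n \<sigma>' \<noteq> 1"
      using T1.bisection_functions_separate[OF \<sigma>] by blast
    then show False using \<tau>(2) reflect by blast
  qed
  then have "corresponds \<sigma> \<tau>" using \<sigma> \<tau> reflect by (auto simp: corresponds_def)
  then show ?thesis ..
qed

text \<open>The value of \<open>n\<close> at \<open>t \<sigma>\<close> is the value at \<open>\<sigma>\<close> of a scalar multiple of \<open>n\<close>.\<close>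

lemma corresponds_act:
  assumes c: "corresponds \<sigma> \<tau>" and t: "t \<in> ring_units"
  shows "corresponds (T1.act t \<sigma>) (T2.act t \<tau>)"
  unfolding corresponds_def
proof (intro conjI ballI)
  have arr: "\<sigma> \<in> garrows \<Sigma>1" "\<tau> \<in> garrows \<Sigma>2" using c by (auto simp: corresponds_def)
  show "T1.act t \<sigma> \<in> garrows \<Sigma>1" "T2.act t \<tau> \<in> garrows \<Sigma>2"
    using arr t by (simp_all add: T1.act_arrow T2.act_arrow)
  fix n assume n: "n \<in> T1.bisection_functions"
  note na = T1.bisection_function_alg[OF n]
  let ?u = "unit_inverse t"
  have u: "?u \<in> ring_units" using ring_unit_inverse[OF t] by simp
  have "supp (\<lambda>\<upsilon>. ?u * n \<upsilon>) = supp n"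
    using t by (simp add: supp_def unit_inverse_mult_eq_0)
  then have b: "(\<lambda>\<upsilon>. ?u * n \<upsilon>) \<in> T1.bisection_functions"
    using n T1.alg_scale[OF na, of ?u] mult_ring_units[OF u] t
    by (simp add: T1.bisection_functions_def unit_inverse_mult_eq_0)
  show "n (T1.act t \<sigma>) = 1 \<longleftrightarrow> \<Psi> n (T2.act t \<tau>) = 1"
    using correspondsD[OF c b] scale[OF na, of ?u]
      T1.twisted_act[OF T1.alg_twisted[OF na] t arr(1)]
      T2.twisted_act[OF T2.alg_twisted[OF \<Psi>_alg[OF na]] t arr(2)] by simp
qed

definition arrow_map :: "'s \<Rightarrow> 'u" where
  "arrow_map \<sigma> = (THE \<tau>. corresponds \<sigma> \<tau>)"

lemma corresponds_arrow_map: "\<sigma> \<in> garrows \<Sigma>1 \<Longrightarrow> corresponds \<sigma> (arrow_map \<sigma>)"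
  unfolding arrow_map_def using corresponds_exists corresponds_unique by (metis theI)

lemma arrow_map_eqI: "corresponds \<sigma> \<tau> \<Longrightarrow> arrow_map \<sigma> = \<tau>"
  using corresponds_arrow_map corresponds_unique by (metis corresponds_def)

lemma arrow_map_arrow: "\<sigma> \<in> garrows \<Sigma>1 \<Longrightarrow> arrow_map \<sigma> \<in> garrows \<Sigma>2"
  using corresponds_arrow_map by (auto simp: corresponds_def)

lemma arrow_map_act:
  "\<sigma> \<in> garrows \<Sigma>1 \<Longrightarrow> t \<in> ring_units \<Longrightarrow> arrow_map (T1.act t \<sigma>) = T2.act t (arrow_map \<sigma>)"
  by (intro arrow_map_eqI corresponds_act corresponds_arrow_map)

lemma shrinking_function:
  assumes \<sigma>: "\<sigma> \<in> garrows \<Sigma>1" and U: "openin (gtop \<Sigma>2) U" "arrow_map \<sigma> \<in> U"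
  obtains n where "n \<in> T1.bisection_functions" "n \<sigma> = 1" "\<forall>\<tau>. \<Psi> n \<tau> = 1 \<longrightarrow> \<tau> \<in> U"
proof -
  obtain Z where Z: "T2.sheet Z" "arrow_map \<sigma> \<in> Z" "Z \<subseteq> U" "T2.char_fun Z \<in> T2.bisection_functions"
    using T2.small_sheet[OF U] .
  have "\<Psi> (\<Phi> (T2.char_fun Z)) = T2.char_fun Z" using \<Psi>_\<Phi>[OF T2.char_fun_in_alg[OF Z(1)]] .
  then show thesis
    using that[OF \<Phi>_bisection_function[OF Z(4)]] T2.char_fun_eq_1[OF Z(1)] Z(2,3)
      correspondsD[OF corresponds_arrow_map[OF \<sigma>] \<Phi>_bisection_function[OF Z(4)]] by auto
qed

lemma continuous_arrow_map: "continuous_map (gtop \<Sigma>1) (gtop \<Sigma>2) arrow_map"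
  unfolding continuous_map_def
proof (intro conjI allI impI)
  show "arrow_map \<in> garrows \<Sigma>1 \<rightarrow> garrows \<Sigma>2" using arrow_map_arrow by blast
  fix U assume U: "openin (gtop \<Sigma>2) U"
  show "openin (gtop \<Sigma>1) {\<sigma> \<in> garrows \<Sigma>1. arrow_map \<sigma> \<in> U}"
  proof (subst openin_subopen, intro ballI)
    fix \<sigma> assume "\<sigma> \<in> {\<sigma> \<in> garrows \<Sigma>1. arrow_map \<sigma> \<in> U}"
    then have \<sigma>: "\<sigma> \<in> garrows \<Sigma>1" "arrow_map \<sigma> \<in> U" by auto
    obtain n where n: "n \<in> T1.bisection_functions" "n \<sigma> = 1" "\<forall>\<tau>. \<Psi> n \<tau> = 1 \<longrightarrow> \<tau> \<in> U"
      by (rule shrinking_function[OF \<sigma>(1) U \<sigma>(2)])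
    let ?V = "{\<upsilon> \<in> garrows \<Sigma>1. n \<upsilon> = 1}"
    have "openin (gtop \<Sigma>1) ?V"
      by (rule T1.twisted_open[OF T1.alg_twisted[OF T1.bisection_function_alg[OF n(1)]]])
    moreover have "?V \<subseteq> {\<sigma> \<in> garrows \<Sigma>1. arrow_map \<sigma> \<in> U}"
      using n(3) correspondsD[OF corresponds_arrow_map n(1)] by blast
    ultimately show "\<exists>T. openin (gtop \<Sigma>1) T \<and> \<sigma> \<in> T \<and> T \<subseteq> {\<sigma> \<in> garrows \<Sigma>1. arrow_map \<sigma> \<in> U}"
      using \<sigma>(1) n(2) by blast
  qed
qed

lemma arrow_map_inverse:
  assumes "\<sigma> \<in> garrows \<Sigma>1"
  shows "diagonal_iso.arrow_map G2 \<Sigma>2 i2 q2 \<Sigma>1 \<Phi> (arrow_map \<sigma>) = \<sigma>"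
proof -
  interpret rev: diagonal_iso G2 \<Sigma>2 i2 q2 G1 \<Sigma>1 i1 q1 \<Phi> by (rule reversed)
  show ?thesis using corresponds_arrow_map[OF assms] corresponds_reversed by (intro rev.arrow_map_eqI) simp
qed

text \<open>The choice of the arrow over \<open>a\<close> does not matter, since \<open>arrow_map\<close> is equivariant.\<close>

definition base_map :: "'g \<Rightarrow> 'h" where
  "base_map a = q2 (arrow_map (inv_into (garrows \<Sigma>1) q1 a))"

lemma base_map_q:
  assumes \<sigma>: "\<sigma> \<in> garrows \<Sigma>1"
  shows "base_map (q1 \<sigma>) = q2 (arrow_map \<sigma>)"
proof -
  let ?\<sigma> = "inv_into (garrows \<Sigma>1) q1 (q1 \<sigma>)"
  have \<sigma>': "?\<sigma> \<in> garrows \<Sigma>1" "q1 ?\<sigma> = q1 \<sigma>"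
    using \<sigma> by (auto intro: inv_into_into f_inv_into_f)
  obtain t where "t \<in> ring_units" "\<sigma> = T1.act t ?\<sigma>"
    using T1.fibre_orbit[OF \<sigma>'(1) \<sigma> \<sigma>'(2)] .
  then show ?thesis
    using \<sigma>' arrow_map_act T2.q_act arrow_map_arrow by (metis base_map_def)
qed

lemma continuous_base_map: "continuous_map (gtop G1) (gtop G2) base_map"
proof (rule continuous_compose_quotient_map[OF T1.quotient_q])
  have "continuous_map (gtop \<Sigma>1) (gtop G2) (\<lambda>\<sigma>. q2 (arrow_map \<sigma>))"
    using continuous_map_compose[OF continuous_arrow_map T2.q_continuous] by (simp add: o_def)
  then show "continuous_map (gtop \<Sigma>1) (gtop G2) (base_map \<circ> q1)"
    by (rule continuous_map_eq) (simp add: base_map_q)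
qed

lemma base_map_inverse:
  assumes "a \<in> garrows G1"
  shows "diagonal_iso.base_map G2 \<Sigma>2 i2 q2 \<Sigma>1 q1 \<Phi> (base_map a) = a"
proof -
  interpret rev: diagonal_iso G2 \<Sigma>2 i2 q2 G1 \<Sigma>1 i1 q1 \<Phi> by (rule reversed)
  obtain \<sigma> where \<sigma>: "\<sigma> \<in> garrows \<Sigma>1" "a = q1 \<sigma>" using T1.arrow_over[OF assms] .
  then show ?thesis
    using base_map_q rev.base_map_q arrow_map_arrow arrow_map_inverse by simp
qed

lemma homeomorphic_arrow_map: "homeomorphic_map (gtop \<Sigma>1) (gtop \<Sigma>2) arrow_map"
  and homeomorphic_base_map: "homeomorphic_map (gtop G1) (gtop G2) base_map"
proof -
  interpret rev: diagonal_iso G2 \<Sigma>2 i2 q2 G1 \<Sigma>1 i1 q1 \<Phi> by (rule reversed)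
  have inv: "arrow_map (rev.arrow_map \<tau>) = \<tau>" if "\<tau> \<in> garrows \<Sigma>2" for \<tau>
    using rev.corresponds_arrow_map[OF that] corresponds_reversed by (intro arrow_map_eqI) simp
  have invb: "base_map (rev.base_map b) = b" if b: "b \<in> garrows G2" for b
  proof -
    obtain \<tau> where \<tau>: "\<tau> \<in> garrows \<Sigma>2" "b = q2 \<tau>" using T2.arrow_over[OF b] .
    then show ?thesis using base_map_q rev.base_map_q rev.arrow_map_arrow inv by simp
  qed
  show "homeomorphic_map (gtop \<Sigma>1) (gtop \<Sigma>2) arrow_map"
    using continuous_arrow_map rev.continuous_arrow_map arrow_map_inverse inv
    by (intro homeomorphic_maps_imp_map[of _ _ _ rev.arrow_map]) (simp add: homeomorphic_maps_def)
  show "homeomorphic_map (gtop G1) (gtop G2) base_map"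
    using continuous_base_map rev.continuous_base_map base_map_inverse invb
    by (intro homeomorphic_maps_imp_map[of _ _ _ rev.base_map]) (simp add: homeomorphic_maps_def)
qed

text \<open>Let \<open>n\<close> and \<open>m\<close> be 1 at \<open>\<sigma>\<close> and \<open>\<tau>\<close>.  As the product of \<open>\<Psi> n\<close> and \<open>\<Psi> m\<close> is 1 at the image \<open>\<upsilon>\<close> of
  \<open>\<sigma> \<tau>\<close>, there are factors of \<open>\<upsilon>\<close> at which \<open>\<Psi> n\<close> and \<open>\<Psi> m\<close> are 1.  Letting \<open>n\<close> and \<open>m\<close> shrink shows
  that \<open>\<upsilon>\<close> has the range of the image of \<open>\<sigma>\<close> and the source of the image of \<open>\<tau>\<close>; on the supports of
  \<open>\<Psi> n\<close> and \<open>\<Psi> m\<close>, range and source then identify the factors with these images.\<close>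

lemma arrow_map_mult:
  assumes mult: "\<forall>n \<in> T1.bisection_functions. \<forall>m \<in> T1.bisection_functions.
      \<Psi> (T1.conv n m) = T2.conv (\<Psi> n) (\<Psi> m)"
    and c: "(\<sigma>, \<tau>) \<in> composable \<Sigma>1"
  shows "(arrow_map \<sigma>, arrow_map \<tau>) \<in> composable \<Sigma>2"
    and "arrow_map (gmult \<Sigma>1 \<sigma> \<tau>) = gmult \<Sigma>2 (arrow_map \<sigma>) (arrow_map \<tau>)"
proof -
  let ?\<upsilon> = "arrow_map (gmult \<Sigma>1 \<sigma> \<tau>)"
  have arr: "\<sigma> \<in> garrows \<Sigma>1" "\<tau> \<in> garrows \<Sigma>1" "gmult \<Sigma>1 \<sigma> \<tau> \<in> garrows \<Sigma>1"
    using c T1.twist.mult_closed by (auto simp: T1.composable_twist_iff)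
  have split: "\<exists>\<sigma>' \<tau>'. (\<sigma>', \<tau>') \<in> composable \<Sigma>2 \<and> ?\<upsilon> = gmult \<Sigma>2 \<sigma>' \<tau>' \<and> \<Psi> n \<sigma>' = 1 \<and> \<Psi> m \<tau>' = 1"
    if n: "n \<in> T1.bisection_functions" "n \<sigma> = 1" and m: "m \<in> T1.bisection_functions" "m \<tau> = 1" for n m
  proof -
    have "T1.conv n m (gmult \<Sigma>1 \<sigma> \<tau>) = 1"
      using T1.conv_section[OF T1.bisection_function_alg[OF n(1)] T1.bisection_function_alg[OF m(1)] _ c]
        n m by (simp add: T1.bisection_functions_def)
    then have "T2.conv (\<Psi> n) (\<Psi> m) ?\<upsilon> = 1"
      using correspondsD[OF corresponds_arrow_map[OF arr(3)] T1.conv_in_bisection_functions[OF n(1) m(1)]]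
        mult n(1) m(1) by simp
    then show ?thesis
      using T2.conv_bisection_eq_1[OF \<Psi>_bisection_function[OF n(1)] \<Psi>_bisection_function[OF m(1)]]
      by blast
  qed
  have one: "\<exists>n \<in> T1.bisection_functions. n \<upsilon> = 1" if "\<upsilon> \<in> garrows \<Sigma>1" for \<upsilon>
    using shrinking_function[OF that openin_topspace arrow_map_arrow[OF that]] by blast
  have r: "T2.rng ?\<upsilon> = T2.rng (arrow_map \<sigma>)"
  proof (rule ccontr)
    assume ne: "T2.rng ?\<upsilon> \<noteq> T2.rng (arrow_map \<sigma>)"
    let ?U = "{\<tau> \<in> garrows \<Sigma>2. T2.rng \<tau> \<in> gunits G2 - {T2.rng ?\<upsilon>}}"
    have "openin (gtop \<Sigma>2) ?U"
      using T2.base.open_delete_unit by (rule openin_continuous_map_preimage[OF T2.continuous_range_q])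
    moreover have "arrow_map \<sigma> \<in> ?U"
      using ne arrow_map_arrow[OF arr(1)] T2.rng_src_unit(1) by auto
    ultimately obtain n where n: "n \<in> T1.bisection_functions" "n \<sigma> = 1" "\<forall>\<tau>. \<Psi> n \<tau> = 1 \<longrightarrow> \<tau> \<in> ?U"
      by (rule shrinking_function[OF arr(1)])
    obtain m where m: "m \<in> T1.bisection_functions" "m \<tau> = 1" using one[OF arr(2)] by blast
    obtain \<sigma>' \<tau>' where "(\<sigma>', \<tau>') \<in> composable \<Sigma>2" "?\<upsilon> = gmult \<Sigma>2 \<sigma>' \<tau>'" "\<Psi> n \<sigma>' = 1"
      using split[OF n(1,2) m] by blast
    then show False using n(3) T2.mult_rng_src(1)[of \<sigma>' \<tau>'] by auto
  qed
  have s: "T2.src ?\<upsilon> = T2.src (arrow_map \<tau>)"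
  proof (rule ccontr)
    assume ne: "T2.src ?\<upsilon> \<noteq> T2.src (arrow_map \<tau>)"
    let ?U = "{\<tau> \<in> garrows \<Sigma>2. T2.src \<tau> \<in> gunits G2 - {T2.src ?\<upsilon>}}"
    have "openin (gtop \<Sigma>2) ?U"
      using T2.base.open_delete_unit by (rule openin_continuous_map_preimage[OF T2.continuous_source_q])
    moreover have "arrow_map \<tau> \<in> ?U"
      using ne arrow_map_arrow[OF arr(2)] T2.rng_src_unit(2) by auto
    ultimately obtain m where m: "m \<in> T1.bisection_functions" "m \<tau> = 1" "\<forall>\<tau>. \<Psi> m \<tau> = 1 \<longrightarrow> \<tau> \<in> ?U"
      by (rule shrinking_function[OF arr(2)])
    obtain n where n: "n \<in> T1.bisection_functions" "n \<sigma> = 1" using one[OF arr(1)] by blast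
    obtain \<sigma>' \<tau>' where "(\<sigma>', \<tau>') \<in> composable \<Sigma>2" "?\<upsilon> = gmult \<Sigma>2 \<sigma>' \<tau>'" "\<Psi> m \<tau>' = 1"
      using split[OF n m(1,2)] by blast
    then show False using m(3) T2.mult_rng_src(2)[of \<sigma>' \<tau>'] by auto
  qed
  obtain n where n: "n \<in> T1.bisection_functions" "n \<sigma> = 1" using one[OF arr(1)] by blast
  obtain m where m: "m \<in> T1.bisection_functions" "m \<tau> = 1" using one[OF arr(2)] by blast
  obtain \<sigma>' \<tau>' where st: "(\<sigma>', \<tau>') \<in> composable \<Sigma>2" "?\<upsilon> = gmult \<Sigma>2 \<sigma>' \<tau>'" "\<Psi> n \<sigma>' = 1" "\<Psi> m \<tau>' = 1"
    using split[OF n m] by blast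
  have "\<sigma>' = arrow_map \<sigma>"
    using T2.bisection_function_eq[OF \<Psi>_bisection_function[OF n(1)] st(3), of "arrow_map \<sigma>"]
      correspondsD[OF corresponds_arrow_map[OF arr(1)] n(1)] n(2) r T2.mult_rng_src(1)[OF st(1)] st(2) by simp
  moreover have "\<tau>' = arrow_map \<tau>"
    using T2.bisection_function_eq[OF \<Psi>_bisection_function[OF m(1)] st(4), of "arrow_map \<tau>"]
      correspondsD[OF corresponds_arrow_map[OF arr(2)] m(1)] m(2) s T2.mult_rng_src(2)[OF st(1)] st(2) by simp
  ultimately show "(arrow_map \<sigma>, arrow_map \<tau>) \<in> composable \<Sigma>2"
    "?\<upsilon> = gmult \<Sigma>2 (arrow_map \<sigma>) (arrow_map \<tau>)"
    using st by simp_all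
qed

lemma twists_isomorphic:
  assumes mult: "\<forall>n \<in> T1.bisection_functions. \<forall>m \<in> T1.bisection_functions.
      \<Psi> (T1.conv n m) = T2.conv (\<Psi> n) (\<Psi> m)"
  shows "twists_isomorphic G1 \<Sigma>1 i1 q1 G2 \<Sigma>2 i2 q2"
proof -
  note am = arrow_map_mult[OF mult]
  have arrow_hom: "groupoid_hom \<Sigma>1 \<Sigma>2 arrow_map"
    using am arrow_map_arrow by (auto simp: groupoid_hom_def)
  have base_hom: "(base_map a, base_map b) \<in> composable G2 \<and>
      base_map (gmult G1 a b) = gmult G2 (base_map a) (base_map b)"
    if ab: "(a, b) \<in> composable G1" for a b
  proof -
    obtain \<sigma> \<tau> where st: "\<sigma> \<in> garrows \<Sigma>1" "a = q1 \<sigma>" "\<tau> \<in> garrows \<Sigma>1" "b = q1 \<tau>"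
      using ab T1.arrow_over unfolding T1.base.composable_iff by metis
    then have c: "(\<sigma>, \<tau>) \<in> composable \<Sigma>1"
      using ab by (simp add: T1.composable_twist_iff T1.base.composable_iff)
    have "(base_map a, base_map b) \<in> composable G2"
      using am(1)[OF c] st by (simp add: base_map_q T2.composable_twist_iff T2.base.composable_iff T2.q_arrow)
    moreover have "base_map (gmult G1 a b) = gmult G2 (base_map a) (base_map b)"
      using base_map_q[OF T1.twist.mult_closed[OF c]] T1.q_mult[OF c] am[OF c] T2.q_mult[OF am(1)[OF c]] st
      by (simp add: base_map_q)
    ultimately show ?thesis ..
  qed
  have base_arrow: "base_map a \<in> garrows G2" if "a \<in> garrows G1" for a
    using continuous_base_map that by (auto simp: continuous_map_def)
  have unit: "arrow_map (i1 (x, t)) = i2 (base_map x, t)" if x: "x \<in> gunits G1" and t: "t \<in> ring_units" for x t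
  proof -
    let ?e = "T1.unit_over x"
    have e: "?e \<in> garrows \<Sigma>1" by (rule T1.unit_over_arrow[OF x])
    have eu: "?e \<in> gunits \<Sigma>1" by (rule T1.unit_over_unit[OF x])
    have cc: "(?e, ?e) \<in> composable \<Sigma>1" "gmult \<Sigma>1 ?e ?e = ?e"
      using T1.i_mult[OF x one_ring_units one_ring_units] by simp_all
    let ?f = "arrow_map ?e"
    have f: "?f \<in> garrows \<Sigma>2" by (rule arrow_map_arrow[OF e])
    have "(?f, ?f) \<in> composable \<Sigma>2" "gmult \<Sigma>2 ?f ?f = ?f" using am[OF cc(1)] cc(2) by simp_all
    then have "?f = gsource \<Sigma>2 ?f"
      using T2.twist.inv_mult_cancel[OF f f] T2.twist.mult_inv_left[OF f] by (simp add: T2.twist.composable_iff)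
    then have "?f \<in> gunits \<Sigma>2" using T2.twist.source_closed[OF f] by simp
    then obtain y where y: "y \<in> gunits G2" "?f = T2.unit_over y" using T2.twist_units by auto
    then have "y = base_map x"
      using base_map_q[OF e] by (simp add: T1.q_unit_over[OF x] T2.q_unit_over)
    then show ?thesis
      using arrow_map_act[OF e t] y T1.act_unit_over[OF x t] T2.act_unit_over[OF y(1) t] by simp
  qed
  show ?thesis
    unfolding twists_isomorphic_def topological_groupoid_iso_def
  proof (intro exI conjI ballI)
    show "groupoid_hom \<Sigma>1 \<Sigma>2 arrow_map" by (rule arrow_hom)
    show "homeomorphic_map (gtop \<Sigma>1) (gtop \<Sigma>2) arrow_map" by (rule homeomorphic_arrow_map)
    show "groupoid_hom G1 G2 base_map"
      using base_hom base_arrow by (auto simp: groupoid_hom_def)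
    show "homeomorphic_map (gtop G1) (gtop G2) base_map" by (rule homeomorphic_base_map)
    show "arrow_map (i1 (x, t)) = i2 (base_map x, t)" if "x \<in> gunits G1" "t \<in> ring_units" for x t
      using unit that by blast
    show "q2 (arrow_map \<sigma>) = base_map (q1 \<sigma>)" if "\<sigma> \<in> garrows \<Sigma>1" for \<sigma>
      using base_map_q[OF that] by simp
  qed
qed

end

section \<open>Transport along an isomorphism of twists\<close>

lemma groupoid_hom_simps:
  assumes "groupoid G" "groupoid H" and f: "groupoid_hom G H f"
  shows hom_arrow: "a \<in> garrows G \<Longrightarrow> f a \<in> garrows H"
    and hom_composable: "(a, b) \<in> composable G \<Longrightarrow> (f a, f b) \<in> composable H"
    and hom_mult: "(a, b) \<in> composable G \<Longrightarrow> f (gmult G a b) = gmult H (f a) (f b)"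
    and hom_unit: "x \<in> gunits G \<Longrightarrow> f x \<in> gunits H"
    and hom_range: "a \<in> garrows G \<Longrightarrow> f (grange G a) = grange H (f a)"
    and hom_source: "a \<in> garrows G \<Longrightarrow> f (gsource G a) = gsource H (f a)"
    and hom_inv: "a \<in> garrows G \<Longrightarrow> f (ginv G a) = ginv H (f a)"
proof -
  interpret G: groupoid G by fact
  interpret H: groupoid H by fact
  show arrow: "f a \<in> garrows H" if "a \<in> garrows G" for a
    using f that by (auto simp: groupoid_hom_def)
  show comp: "(f a, f b) \<in> composable H" and mult: "f (gmult G a b) = gmult H (f a) (f b)"
    if "(a, b) \<in> composable G" for a b
    using f that by (auto simp: groupoid_hom_def)
  show unit: "f x \<in> gunits H" if x: "x \<in> gunits G" for x
  proof -
    have xa: "x \<in> garrows G" using x G.units_arrows by blast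
    have c: "(x, x) \<in> composable G" using x xa by (simp add: G.composable_iff G.range_unit G.source_unit)
    have "gmult G x x = x" using G.range_mult_left[OF xa] x by (simp add: G.range_unit)
    then have "gmult H (f x) (f x) = f x" using mult[OF c] by simp
    then have "f x = gsource H (f x)"
      using comp[OF c] H.inv_mult_cancel[of "f x" "f x"] H.mult_inv_left[OF arrow[OF xa]]
      by (simp add: H.composable_iff)
    then show ?thesis using H.source_closed[OF arrow[OF xa]] by simp
  qed
  show range: "f (grange G a) = grange H (f a)" and source: "f (gsource G a) = gsource H (f a)"
    if a: "a \<in> garrows G" for a
  proof -
    have "(grange G a, a) \<in> composable G" "(a, gsource G a) \<in> composable G"
      using a by (simp_all add: G.composable_iff G.range_arrow G.source_arrow G.range_closed
          G.source_closed G.range_unit G.source_unit)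
    from this[THEN comp] show "f (grange G a) = grange H (f a)" "f (gsource G a) = gsource H (f a)"
      using unit[OF G.range_closed[OF a]] unit[OF G.source_closed[OF a]]
      by (simp_all add: H.composable_iff H.range_unit H.source_unit)
  qed
  show "f (ginv G a) = ginv H (f a)" if a: "a \<in> garrows G" for a
  proof -
    have c: "(ginv G a, a) \<in> composable G" using a by (simp add: G.composable_iff G.inv_closed G.source_inv)
    have "gmult H (f (ginv G a)) (f a) = gsource H (f a)"
      using mult[OF c] source[OF a] G.mult_inv_left[OF a] by simp
    moreover have "gmult H (gmult H (f (ginv G a)) (f a)) (ginv H (f a)) = f (ginv G a)"
      using comp[OF c] by (intro H.mult_inv_cancel_right) (auto simp: H.composable_iff)
    moreover have "gmult H (gsource H (f a)) (ginv H (f a)) = ginv H (f a)"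
      using H.range_mult_left[OF H.inv_closed[OF arrow[OF a]]] arrow[OF a] by (simp add: H.range_inv)
    ultimately show ?thesis by simp
  qed
qed

lemma groupoid_hom_inverse:
  assumes "groupoid G" "groupoid H" and f: "groupoid_hom G H f"
    and inv: "\<And>a. a \<in> garrows G \<Longrightarrow> g (f a) = a"
    and g: "\<And>b. b \<in> garrows H \<Longrightarrow> g b \<in> garrows G \<and> f (g b) = b"
  shows "groupoid_hom H G g"
proof -
  interpret G: groupoid G by fact
  interpret H: groupoid H by fact
  note hom = groupoid_hom_simps[OF assms(1-3)]
  have "(g a, g b) \<in> composable G \<and> g (gmult H a b) = gmult G (g a) (g b)"
    if ab: "(a, b) \<in> composable H" for a b
  proof -
    have arr: "a \<in> garrows H" "b \<in> garrows H" "gsource H a = grange H b"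
      using ab by (auto simp: H.composable_iff)
    have "f (gsource G (g a)) = f (grange G (g b))"
      using arr g by (simp add: hom)
    then have "gsource G (g a) = grange G (g b)"
      using inv arr g G.source_arrow G.range_arrow by metis
    then have c: "(g a, g b) \<in> composable G" using arr g by (simp add: G.composable_iff)
    have "gmult H a b = f (gmult G (g a) (g b))" using hom(3)[OF c] arr g by simp
    then show ?thesis using c inv[OF G.mult_closed[OF c]] by simp
  qed
  then show ?thesis using g by (auto simp: groupoid_hom_def)
qed

text \<open>The inverse maps are parameters in order to make the situation symmetric.\<close>

locale twist_iso =
  T1: ample_twist G1 \<Sigma>1 i1 q1 + T2: ample_twist G2 \<Sigma>2 i2 q2
  for G1 :: "'g grpd" and \<Sigma>1 :: "'s grpd" and i1 :: "'g \<times> 'r::comm_ring_1 \<Rightarrow> 's" and q1 :: "'s \<Rightarrow> 'g"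
    and G2 :: "'h grpd" and \<Sigma>2 :: "'u grpd" and i2 :: "'h \<times> 'r \<Rightarrow> 'u" and q2 :: "'u \<Rightarrow> 'h" +
  fixes \<psi> :: "'s \<Rightarrow> 'u" and \<psi>' :: "'u \<Rightarrow> 's" and \<theta> :: "'g \<Rightarrow> 'h" and \<theta>' :: "'h \<Rightarrow> 'g"
  assumes hom: "groupoid_hom \<Sigma>1 \<Sigma>2 \<psi>" and homeo: "homeomorphic_maps (gtop \<Sigma>1) (gtop \<Sigma>2) \<psi> \<psi>'"
    and base_hom: "groupoid_hom G1 G2 \<theta>" and base_homeo: "homeomorphic_maps (gtop G1) (gtop G2) \<theta> \<theta>'"
    and on_i: "x \<in> gunits G1 \<Longrightarrow> t \<in> ring_units \<Longrightarrow> \<psi> (i1 (x, t)) = i2 (\<theta> x, t)"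
    and on_q: "\<sigma> \<in> garrows \<Sigma>1 \<Longrightarrow> q2 (\<psi> \<sigma>) = \<theta> (q1 \<sigma>)"
begin

lemma inverses:
  "\<sigma> \<in> garrows \<Sigma>1 \<Longrightarrow> \<psi> \<sigma> \<in> garrows \<Sigma>2" "\<sigma> \<in> garrows \<Sigma>1 \<Longrightarrow> \<psi>' (\<psi> \<sigma>) = \<sigma>"
  "\<tau> \<in> garrows \<Sigma>2 \<Longrightarrow> \<psi>' \<tau> \<in> garrows \<Sigma>1" "\<tau> \<in> garrows \<Sigma>2 \<Longrightarrow> \<psi> (\<psi>' \<tau>) = \<tau>"
  "a \<in> garrows G1 \<Longrightarrow> \<theta> a \<in> garrows G2" "a \<in> garrows G1 \<Longrightarrow> \<theta>' (\<theta> a) = a"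
  "b \<in> garrows G2 \<Longrightarrow> \<theta>' b \<in> garrows G1" "b \<in> garrows G2 \<Longrightarrow> \<theta> (\<theta>' b) = b"
  using homeo base_homeo by (auto simp: homeomorphic_maps_def continuous_map_def)

lemmas hom_simps = groupoid_hom_simps[OF T1.twist.groupoid_axioms T2.twist.groupoid_axioms hom]
lemmas base_hom_simps = groupoid_hom_simps[OF T1.base.groupoid_axioms T2.base.groupoid_axioms base_hom]

lemma reversed: "twist_iso G2 \<Sigma>2 i2 q2 G1 \<Sigma>1 i1 q1 \<psi>' \<psi> \<theta>' \<theta>"
proof unfold_locales
  show "groupoid_hom \<Sigma>2 \<Sigma>1 \<psi>'"
    by (rule groupoid_hom_inverse[OF T1.twist.groupoid_axioms T2.twist.groupoid_axioms hom])
      (simp_all add: inverses)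
  show bh: "groupoid_hom G2 G1 \<theta>'"
    by (rule groupoid_hom_inverse[OF T1.base.groupoid_axioms T2.base.groupoid_axioms base_hom])
      (simp_all add: inverses)
  show "homeomorphic_maps (gtop \<Sigma>2) (gtop \<Sigma>1) \<psi>' \<psi>" "homeomorphic_maps (gtop G2) (gtop G1) \<theta>' \<theta>"
    using homeo base_homeo by (blast intro: homeomorphic_maps_sym[THEN iffD1])+
  show "\<psi>' (i2 (x, t)) = i1 (\<theta>' x, t)" if x: "x \<in> gunits G2" and t: "t \<in> ring_units" for x t
  proof -
    have u: "\<theta>' x \<in> gunits G1"
      using hom_unit[OF T2.base.groupoid_axioms T1.base.groupoid_axioms bh x] .
    have "\<theta> (\<theta>' x) = x" by (rule inverses(8)[OF subsetD[OF T2.base.units_arrows x]])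
    then have "i2 (x, t) = \<psi> (i1 (\<theta>' x, t))" using on_i[OF u t] by simp
    then show ?thesis using inverses(2)[OF T1.i_arrow[OF u t]] by simp
  qed
  show "q1 (\<psi>' \<tau>) = \<theta>' (q2 \<tau>)" if "\<tau> \<in> garrows \<Sigma>2" for \<tau>
    using on_q[OF inverses(3)[OF that]] inverses(4)[OF that]
      inverses(6)[OF T1.q_arrow[OF inverses(3)[OF that]]] by simp
qed

definition pullback :: "('u \<Rightarrow> 'r) \<Rightarrow> 's \<Rightarrow> 'r" where
  "pullback f \<sigma> = (if \<sigma> \<in> garrows \<Sigma>1 then f (\<psi> \<sigma>) else 0)"

lemma \<psi>_act:
  assumes "\<sigma> \<in> garrows \<Sigma>1" "t \<in> ring_units"
  shows "\<psi> (T1.act t \<sigma>) = T2.act t (\<psi> \<sigma>)"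
  using hom_simps(3)[OF T1.act_composable(1)[OF assms]] assms T1.rng_src_unit(1)[OF assms(1)]
  by (simp add: twist_action_def on_i on_q base_hom_simps T1.q_arrow)

lemma pullback_alg:
  assumes f: "f \<in> T2.alg"
  shows "pullback f \<in> T1.alg"
proof (rule T1.algI)
  have ft: "T2.twisted f" using f by (rule T2.alg_twisted)
  have cont: "continuous_map (gtop \<Sigma>1) (gtop \<Sigma>2) \<psi>" "continuous_map (gtop G2) (gtop G1) \<theta>'"
    using homeo base_homeo by (simp_all add: homeomorphic_maps_def)
  show "T1.twisted (pullback f)"
  proof (rule T1.twistedI)
    fix \<sigma> assume \<sigma>: "\<sigma> \<in> garrows \<Sigma>1"
    let ?U = "{\<upsilon> \<in> garrows \<Sigma>1. \<psi> \<upsilon> \<in> {\<tau> \<in> garrows \<Sigma>2. f \<tau> = f (\<psi> \<sigma>)}}"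
    have "openin (gtop \<Sigma>1) ?U"
      by (rule openin_continuous_map_preimage[OF cont(1) T2.twisted_open[OF ft]])
    then show "\<exists>U. openin (gtop \<Sigma>1) U \<and> \<sigma> \<in> U \<and> (\<forall>\<tau>\<in>U. pullback f \<tau> = pullback f \<sigma>)"
      using \<sigma> inverses(1) by (intro exI[of _ ?U]) (simp add: pullback_def)
  next
    fix t :: 'r and \<sigma> assume "t \<in> ring_units" "\<sigma> \<in> garrows \<Sigma>1"
    then show "pullback f (T1.act t \<sigma>) = unit_inverse t * pullback f \<sigma>"
      by (simp add: pullback_def T1.act_arrow \<psi>_act T2.twisted_act[OF ft] inverses)
  qed (simp add: pullback_def)
  show "compactin (gtop G1) (\<theta>' ` q2 ` supp f)"
    using T2.alg_compact[OF f] cont(2) by (rule image_compactin)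
  show "q1 ` supp (pullback f) \<subseteq> \<theta>' ` q2 ` supp f"
  proof
    fix a assume "a \<in> q1 ` supp (pullback f)"
    then obtain \<sigma> where \<sigma>: "\<sigma> \<in> garrows \<Sigma>1" "f (\<psi> \<sigma>) \<noteq> 0" "a = q1 \<sigma>"
      by (auto simp: supp_def pullback_def split: if_splits)
    then have "a = \<theta>' (q2 (\<psi> \<sigma>))" by (simp add: on_q inverses T1.q_arrow)
    then show "a \<in> \<theta>' ` q2 ` supp f" using \<sigma>(2) by (auto simp: supp_def)
  qed
qed

lemma pullback_diag:
  assumes "f \<in> T2.diag"
  shows "pullback f \<in> T1.diag"
proof (rule T1.diagI[OF pullback_alg[OF T2.diag_alg[OF assms]]])
  interpret rev: twist_iso G2 \<Sigma>2 i2 q2 G1 \<Sigma>1 i1 q1 \<psi>' \<psi> \<theta>' \<theta> by (rule reversed)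
  fix \<sigma> assume "pullback f \<sigma> \<noteq> 0"
  then have \<sigma>: "\<sigma> \<in> garrows \<Sigma>1" "f (\<psi> \<sigma>) \<noteq> 0" by (auto simp: pullback_def split: if_splits)
  then have "\<theta> (q1 \<sigma>) \<in> gunits G2" using T2.diag_zero[OF assms, of "\<psi> \<sigma>"] on_q[OF \<sigma>(1)] by auto
  then have "\<theta>' (\<theta> (q1 \<sigma>)) \<in> gunits G1" by (rule rev.base_hom_simps(4))
  then show "q1 \<sigma> \<in> gunits G1" using \<sigma> by (simp add: inverses T1.q_arrow)
qed

lemma pullback_conv:
  assumes f: "f \<in> T2.alg" and g: "g \<in> T2.alg"
  shows "pullback (T2.conv f g) = T1.conv (pullback f) (pullback g)"
proof
  fix \<sigma>
  interpret rev: twist_iso G2 \<Sigma>2 i2 q2 G1 \<Sigma>1 i1 q1 \<psi>' \<psi> \<theta>' \<theta> by (rule reversed)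
  show "pullback (T2.conv f g) \<sigma> = T1.conv (pullback f) (pullback g) \<sigma>"
  proof (cases "\<sigma> \<in> garrows \<Sigma>1")
    case \<sigma>: True
    define S where "S a = inv_into (supp f) q2 a" for a
    have supp2: "\<tau> \<in> garrows \<Sigma>2" if "\<tau> \<in> supp f" for \<tau>
      using that T2.supp_arrow[OF T2.alg_twisted[OF f]] by (simp add: supp_def)
    have S: "S b \<in> supp f" "q2 (S b) = b" "S b \<in> garrows \<Sigma>2" if "b \<in> q2 ` supp f" for b
      using inv_into_into[OF that] f_inv_into_f[OF that] supp2 by (simp_all add: S_def)
    have fwd: "\<theta> a \<in> q2 ` supp f" "a \<in> garrows G1" if a: "a \<in> q1 ` supp (pullback f)" for a
    proof -
      obtain \<upsilon> where "\<upsilon> \<in> garrows \<Sigma>1" "f (\<psi> \<upsilon>) \<noteq> 0" "a = q1 \<upsilon>"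
        using a by (auto simp: supp_def pullback_def split: if_splits)
      then show "\<theta> a \<in> q2 ` supp f" "a \<in> garrows G1"
        using on_q[of \<upsilon>, symmetric] T1.q_arrow by (simp_all add: supp_def)
    qed
    have bwd: "\<theta>' b \<in> q1 ` supp (pullback f)" "b \<in> garrows G2" if b: "b \<in> q2 ` supp f" for b
    proof -
      obtain \<tau> where \<tau>: "\<tau> \<in> garrows \<Sigma>2" "f \<tau> \<noteq> 0" "b = q2 \<tau>"
        using b supp2 by (auto simp: supp_def)
      then have "\<psi>' \<tau> \<in> supp (pullback f)" by (simp add: supp_def pullback_def inverses)
      moreover have "\<theta>' b = q1 (\<psi>' \<tau>)" using \<tau> rev.on_q by simp
      ultimately show "\<theta>' b \<in> q1 ` supp (pullback f)" "b \<in> garrows G2"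
        using \<tau> T2.q_arrow by simp_all
    qed
    have S1: "\<psi>' (S (\<theta> a)) \<in> supp (pullback f) \<and> q1 (\<psi>' (S (\<theta> a))) = a"
      if "a \<in> q1 ` supp (pullback f)" for a
      using S[OF fwd(1)[OF that]] fwd(2)[OF that] rev.on_q[of "S (\<theta> a)"]
      by (simp add: supp_def pullback_def inverses)
    let ?M = "{b \<in> q2 ` supp f. grange G2 b = T2.rng (\<psi> \<sigma>)}"
    let ?N = "{a \<in> q1 ` supp (pullback f). grange G1 a = T1.rng \<sigma>}"
    have "T1.conv (pullback f) (pullback g) \<sigma> = (\<Sum>a\<in>?N. pullback f (\<psi>' (S (\<theta> a))) *
        pullback g (gmult \<Sigma>1 (ginv \<Sigma>1 (\<psi>' (S (\<theta> a)))) \<sigma>))"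
      using S1 by (intro T1.steinberg_conv_section pullback_alg f g \<sigma>)
    also have "\<dots> = (\<Sum>b\<in>?M. f (S b) * g (gmult \<Sigma>2 (ginv \<Sigma>2 (S b)) (\<psi> \<sigma>)))"
    proof (rule sum.reindex_bij_witness[of _ \<theta>' \<theta>])
      fix a assume a: "a \<in> ?N"
      then have aa: "a \<in> q1 ` supp (pullback f)" by simp
      note fa = fwd[OF aa]
      show "\<theta>' (\<theta> a) = a" using fa by (simp add: inverses)
      show "\<theta> a \<in> ?M" using fa a \<sigma> by (simp add: on_q base_hom_simps(5)[symmetric] T1.q_arrow)
      let ?s = "\<psi>' (S (\<theta> a))"
      note Sa = S[OF fa(1)]
      have s: "?s \<in> garrows \<Sigma>1" "\<psi> ?s = S (\<theta> a)" using Sa by (simp_all add: inverses)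
      have r: "T1.rng ?s = T1.rng \<sigma>" using S1[OF aa] a by simp
      have c: "(ginv \<Sigma>1 ?s, \<sigma>) \<in> composable \<Sigma>1"
        using s \<sigma> r by (simp add: T1.composable_twist_iff T1.twist.inv_closed T1.q_inv
            T1.base.source_inv T1.q_arrow)
      have "\<psi> (gmult \<Sigma>1 (ginv \<Sigma>1 ?s) \<sigma>) = gmult \<Sigma>2 (ginv \<Sigma>2 (S (\<theta> a))) (\<psi> \<sigma>)"
        using hom_simps(3)[OF c] hom_simps(7)[OF s(1)] s(2) by simp
      then show "f (S (\<theta> a)) * g (gmult \<Sigma>2 (ginv \<Sigma>2 (S (\<theta> a))) (\<psi> \<sigma>)) =
          pullback f ?s * pullback g (gmult \<Sigma>1 (ginv \<Sigma>1 ?s) \<sigma>)"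
        using s T1.twist.mult_closed[OF c] by (simp add: pullback_def)
    next
      fix b assume b: "b \<in> ?M"
      then have bb: "b \<in> q2 ` supp f" by simp
      note fb = bwd[OF bb]
      show "\<theta> (\<theta>' b) = b" using fb by (simp add: inverses)
      have "grange G1 (\<theta>' b) = \<theta>' (T2.rng (\<psi> \<sigma>))"
        using b rev.base_hom_simps(5)[OF fb(2)] by simp
      also have "\<dots> = \<theta>' (\<theta> (T1.rng \<sigma>))"
        using \<sigma> by (simp add: on_q base_hom_simps(5) T1.q_arrow)
      also have "\<dots> = T1.rng \<sigma>"
        using \<sigma> by (simp add: inverses T1.base.range_arrow T1.q_arrow)
      finally show "\<theta>' b \<in> ?N" using fb by simp
    qed
    also have "\<dots> = pullback (T2.conv f g) \<sigma>"
      using \<sigma> by (simp add: pullback_def steinberg_conv_def S_def inverses)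
    finally show ?thesis by simp
  qed (simp add: pullback_def T1.conv_outside)
qed

lemma pullback_iso:
  "steinberg_algebra_iso G2 \<Sigma>2 i2 q2 G1 \<Sigma>1 i1 q1 pullback"
  "diagonal_preserving G2 \<Sigma>2 i2 q2 G1 \<Sigma>1 i1 q1 pullback"
proof -
  interpret rev: twist_iso G2 \<Sigma>2 i2 q2 G1 \<Sigma>1 i1 q1 \<psi>' \<psi> \<theta>' \<theta> by (rule reversed)
  have inv: "pullback (rev.pullback g) = g" if "g \<in> T1.alg" for g
    using that pullback_alg[OF rev.pullback_alg[OF that]]
    by (intro T1.alg_ext) (simp_all add: pullback_def rev.pullback_def inverses)
  have inv': "rev.pullback (pullback f) = f" if "f \<in> T2.alg" for f
    using that rev.pullback_alg[OF pullback_alg[OF that]]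
    by (intro T2.alg_ext) (simp_all add: pullback_def rev.pullback_def inverses)
  have "bij_betw pullback T2.alg T1.alg"
    by (rule bij_betw_byWitness[where f' = rev.pullback])
      (use inv inv' pullback_alg rev.pullback_alg in auto)
  then show "steinberg_algebra_iso G2 \<Sigma>2 i2 q2 G1 \<Sigma>1 i1 q1 pullback"
    unfolding steinberg_algebra_iso_def
    by (auto simp: pullback_conv) (auto simp: pullback_def)
  show "diagonal_preserving G2 \<Sigma>2 i2 q2 G1 \<Sigma>1 i1 q1 pullback"
    unfolding diagonal_preserving_def
  proof
    show "pullback ` T2.diag \<subseteq> T1.diag" using pullback_diag by blast
    show "T1.diag \<subseteq> pullback ` T2.diag"
      using rev.pullback_diag inv T1.diag_alg by (metis image_eqI subsetI)
  qed
qed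

end

section \<open>The equivalence\<close>

lemma steinberg_algebra_iso_if_twists_isomorphic:
  assumes "ample_twist G1 \<Sigma>1 i1 q1" "ample_twist G2 \<Sigma>2 i2 q2"
    and iso: "twists_isomorphic G1 \<Sigma>1 i1 q1 G2 \<Sigma>2 i2 q2"
  shows "\<exists>\<Psi>. steinberg_algebra_iso G1 \<Sigma>1 i1 q1 G2 \<Sigma>2 i2 q2 \<Psi> \<and>
    diagonal_preserving G1 \<Sigma>1 i1 q1 G2 \<Sigma>2 i2 q2 \<Psi>"
proof -
  obtain \<psi> \<theta> where iso: "groupoid_hom \<Sigma>1 \<Sigma>2 \<psi>" "homeomorphic_map (gtop \<Sigma>1) (gtop \<Sigma>2) \<psi>"
    "groupoid_hom G1 G2 \<theta>" "homeomorphic_map (gtop G1) (gtop G2) \<theta>"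
    "\<forall>x \<in> gunits G1. \<forall>t \<in> ring_units. \<psi> (i1 (x, t)) = i2 (\<theta> x, t)"
    "\<forall>\<sigma> \<in> garrows \<Sigma>1. q2 (\<psi> \<sigma>) = \<theta> (q1 \<sigma>)"
    using iso unfolding twists_isomorphic_def topological_groupoid_iso_def by blast
  obtain \<psi>' \<theta>' where "homeomorphic_maps (gtop \<Sigma>1) (gtop \<Sigma>2) \<psi> \<psi>'" "homeomorphic_maps (gtop G1) (gtop G2) \<theta> \<theta>'"
    using iso(2,4) by (auto simp: homeomorphic_map_maps)
  then interpret fwd: twist_iso G1 \<Sigma>1 i1 q1 G2 \<Sigma>2 i2 q2 \<psi> \<psi>' \<theta> \<theta>'
    using iso assms(1,2) by (intro twist_iso.intro twist_iso_axioms.intro) auto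
  interpret bwd: twist_iso G2 \<Sigma>2 i2 q2 G1 \<Sigma>1 i1 q1 \<psi>' \<psi> \<theta>' \<theta> by (rule fwd.reversed)
  show ?thesis using bwd.pullback_iso by blast
qed

text \<open>Maximal commutativity of the diagonal, seen through an isomorphism of algebras.\<close>

lemma diagonal_if_image_commutes:
  assumes "ample_twist G1 \<Sigma>1 i1 q1" and eff: "effective_groupoid G1"
    and iso: "steinberg_algebra_iso G1 \<Sigma>1 i1 q1 G2 \<Sigma>2 i2 q2 \<Psi>"
    and f: "f \<in> steinberg_algebra G1 \<Sigma>1 i1 q1"
    and comm: "\<And>d. d \<in> diagonal_subalgebra G1 \<Sigma>1 i1 q1 \<Longrightarrow>
      steinberg_conv G2 \<Sigma>2 q2 (\<Psi> d) (\<Psi> f) = steinberg_conv G2 \<Sigma>2 q2 (\<Psi> f) (\<Psi> d)"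
  shows "f \<in> diagonal_subalgebra G1 \<Sigma>1 i1 q1"
proof -
  interpret T1: ample_twist G1 \<Sigma>1 i1 q1 by fact
  show ?thesis
  proof (rule T1.diag_maximal_commutative[OF eff f])
    fix d assume d: "d \<in> T1.diag"
    have "\<Psi> (T1.conv d f) = \<Psi> (T1.conv f d)"
      using iso comm[OF d] d f T1.diag_alg by (auto simp: steinberg_algebra_iso_def)
    then show "T1.conv d f = T1.conv f d"
      using iso T1.diag_mult_closed[OF d f]
      by (auto simp: steinberg_algebra_iso_def bij_betw_def dest: inj_onD)
  qed
qed

text \<open>The diagonal of the target is commutative, so its elements have preimages that commute with the
  diagonal of the source.\<close>

lemma diagonal_preserving_if_diagonal_into:
  assumes "ample_twist G1 \<Sigma>1 i1 q1" "ample_twist G2 \<Sigma>2 i2 q2" and eff: "effective_groupoid G1"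
    and iso: "steinberg_algebra_iso G1 \<Sigma>1 i1 q1 G2 \<Sigma>2 i2 q2 \<Psi>"
    and into: "\<Psi> ` diagonal_subalgebra G1 \<Sigma>1 i1 q1 \<subseteq> diagonal_subalgebra G2 \<Sigma>2 i2 q2"
  shows "diagonal_preserving G1 \<Sigma>1 i1 q1 G2 \<Sigma>2 i2 q2 \<Psi>"
  unfolding diagonal_preserving_def
proof
  interpret T1: ample_twist G1 \<Sigma>1 i1 q1 by fact
  interpret T2: ample_twist G2 \<Sigma>2 i2 q2 by fact
  have bij: "bij_betw \<Psi> T1.alg T2.alg" using iso by (simp add: steinberg_algebra_iso_def)
  show "T2.diag \<subseteq> \<Psi> ` T1.diag"
  proof
    fix g assume g: "g \<in> T2.diag"
    then obtain f where f: "f \<in> T1.alg" "g = \<Psi> f"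
      using bij T2.diag_alg by (auto simp: bij_betw_def)
    have "f \<in> T1.diag"
      using into T2.diag_commute[OF _ g] f(2)
      by (intro diagonal_if_image_commutes[OF assms(1) eff iso f(1)]) auto
    then show "g \<in> \<Psi> ` T1.diag" using f(2) by blast
  qed
qed (rule into)

lemma twists_isomorphic_if_diagonal_preserving:
  fixes i1 :: "'g \<times> 'r::comm_ring_1 \<Rightarrow> 's"
  assumes "ample_twist G1 \<Sigma>1 i1 q1" "ample_twist G2 \<Sigma>2 i2 q2" and eff: "effective_groupoid G1"
    and ind: "indecomposable_ring TYPE('r)"
    and iso: "steinberg_algebra_iso G1 \<Sigma>1 i1 q1 G2 \<Sigma>2 i2 q2 \<Psi>"
    and dp: "diagonal_preserving G1 \<Sigma>1 i1 q1 G2 \<Sigma>2 i2 q2 \<Psi>"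
  shows "twists_isomorphic G1 \<Sigma>1 i1 q1 G2 \<Sigma>2 i2 q2"
proof -
  interpret T1: ample_twist G1 \<Sigma>1 i1 q1 by fact
  interpret T2: ample_twist G2 \<Sigma>2 i2 q2 by fact
  have bij: "bij_betw \<Psi> T1.alg T2.alg"
    and mult: "\<And>f g. f \<in> T1.alg \<Longrightarrow> g \<in> T1.alg \<Longrightarrow> \<Psi> (T1.conv f g) = T2.conv (\<Psi> f) (\<Psi> g)"
    and scale: "\<And>f c. f \<in> T1.alg \<Longrightarrow> \<Psi> (\<lambda>\<sigma>. c * f \<sigma>) = (\<lambda>\<tau>. c * \<Psi> f \<tau>)"
    using iso by (auto simp: steinberg_algebra_iso_def)
  have diag: "\<Psi> ` T1.diag = T2.diag" using dp by (simp add: diagonal_preserving_def)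
  \<comment> \<open>Maximal commutativity is a property of the pair of algebra and diagonal.\<close>
  have eff2: "effective_groupoid G2"
  proof (rule T2.effectiveI)
    fix g assume g: "g \<in> T2.alg" and comm: "\<And>d. d \<in> T2.diag \<Longrightarrow> T2.conv d g = T2.conv g d"
    obtain f where f: "f \<in> T1.alg" "g = \<Psi> f" using bij g by (auto simp: bij_betw_def)
    have "f \<in> T1.diag"
      using diag comm f(2) by (intro diagonal_if_image_commutes[OF assms(1) eff iso f(1)]) auto
    then show "g \<in> T2.diag" using f(2) diag by blast
  qed
  interpret D: diagonal_iso G1 \<Sigma>1 i1 q1 G2 \<Sigma>2 i2 q2 \<Psi>
    by unfold_locales (use ind eff eff2 bij diag mult scale T1.diag_alg in auto)
  show ?thesis
    using mult T1.bisection_function_alg by (intro D.twists_isomorphic) blast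
qed

theorem corollary8p11:
  fixes G1 :: "'g grpd" and \<Sigma>1 :: "'s grpd"
    and i1 :: "'g \<times> 'r::comm_ring_1 \<Rightarrow> 's" and q1 :: "'s \<Rightarrow> 'g"
    and G2 :: "'h grpd" and \<Sigma>2 :: "'u grpd"
    and i2 :: "'h \<times> 'r \<Rightarrow> 'u" and q2 :: "'u \<Rightarrow> 'h"
  assumes "indecomposable_ring TYPE('r)"
    and "ample_groupoid G1" and "Hausdorff_space (gtop G1)"
    and "ample_groupoid G2" and "Hausdorff_space (gtop G2)"
    and "discrete_twist G1 \<Sigma>1 i1 q1" and "discrete_twist G2 \<Sigma>2 i2 q2"
    and "effective_groupoid G1"
  shows "(twists_isomorphic G1 \<Sigma>1 i1 q1 G2 \<Sigma>2 i2 q2 \<longleftrightarrow>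
            (\<exists>\<Psi>. steinberg_algebra_iso G1 \<Sigma>1 i1 q1 G2 \<Sigma>2 i2 q2 \<Psi> \<and>
                 diagonal_preserving G1 \<Sigma>1 i1 q1 G2 \<Sigma>2 i2 q2 \<Psi>)) \<and>
         ((\<exists>\<Psi>. steinberg_algebra_iso G1 \<Sigma>1 i1 q1 G2 \<Sigma>2 i2 q2 \<Psi> \<and>
                 diagonal_preserving G1 \<Sigma>1 i1 q1 G2 \<Sigma>2 i2 q2 \<Psi>) \<longleftrightarrow>
            (\<exists>\<Psi>. steinberg_algebra_iso G1 \<Sigma>1 i1 q1 G2 \<Sigma>2 i2 q2 \<Psi> \<and>
                 \<Psi> ` diagonal_subalgebra G1 \<Sigma>1 i1 q1 \<subseteq> diagonal_subalgebra G2 \<Sigma>2 i2 q2))"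
proof -
  have T: "ample_twist G1 \<Sigma>1 i1 q1" "ample_twist G2 \<Sigma>2 i2 q2"
    using assms by (simp_all add: ample_twist_def ample_twist_axioms_def)
  show ?thesis
    using steinberg_algebra_iso_if_twists_isomorphic[OF T]
      twists_isomorphic_if_diagonal_preserving[OF T assms(8,1)]
      diagonal_preserving_if_diagonal_into[OF T assms(8)]
    unfolding diagonal_preserving_def by blast
qed

end
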